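(* Let $\lambda,\mu\in\Lambda^+(n,r)$ and $\nu\in\Lambda^+(n)$. Put $g=\ell(\nu)$ (with $g\ge 1$) and $m=\ell(\mu)$. Suppose $\lambda\in P(\mu)$, $\mu\in\Lambda^+(n)_g$, $g<m$, and in addition $\nu\in\Lambda^+(n)_g$. For each nonnegative integer $k$ let $$d_k=\dim_K\mathrm{Hom}_G(\Delta(\lambda+k\nu),\Delta(\mu+k\nu)).$$ Then the sequence $d_0,d_1,d_2,\dots$ is periodic with period a power of $p$, i.e. there is $N\in\mathbb{N}$ with $d_{k+p^N}=d_k$ for all $k\ge0$.
   Context: $K$ is an infinite field of characteristic $p>0$, $G=GL_n(K)$, $r$ a positive integer. $\Lambda(n,r)$ is the set of sequences $(\alpha_1,\dots,\alpha_n)$ of nonnegative integers with sum $r$; $\Lambda^+(n,r)$ is the subset of partitions (weakly decreasing sequences); $\Lambda^+(n)$ is the set of all partitions $(\nu_1\ge\dots\ge\nu_n\ge0)$. $\ell(\mu)$ is the number of nonzero parts of $\mu$. $k\nu=(k\nu_1,\dots,k\nu_n)$, and addition is componentwise. $\Delta(\mu)$ is the Weyl module of $G$ corresponding to the partition $\mu$. $P(\mu)$: let $m=\ell(\mu)$. If $m=1$, $P(\mu)=\Lambda(n,r)$; if $m\ge2$, $P(\mu)$ consists of all $\alpha\in\Lambda(n,r)$ with $\mu_1+\dots+\mu_{i-2}+\mu_i\le\alpha_1+\dots+\alpha_{i-1}$ for all $i=2,\dots,m$. $\Lambda^+(n)_g$, $1\le g\le n$: $\Lambda^+(n)_1=\Lambda^+(n)$,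 and for $g\ge2$, $\Lambda^+(n)_g=\{\mu\in\Lambda^+(n):\mu_{j-1}\le\mu_j+\mu_{j+1},\ j=2,\dots,g\}$, with $\mu_{n+1}=0$. *)

theory Defs
  imports
    "HOL-Library.FuncSet"
    "HOL-Library.Function_Algebras"
    "HOL-Combinatorics.Permutations"
    "HOL-Computational_Algebra.Computational_Algebra"
    "Jordan_Normal_Form.Matrix"
begin

section \<open>Weights and partitions\<close>

text \<open>A sequence of length \<open>n\<close> is a function on \<open>nat\<close>, with parts indexed
  by \<open>1, \<dots>, n\<close>, that vanishes at all other indices; in particular
  \<open>\<mu> (n + 1) = 0\<close>. Addition of sequences is pointwise.\<close>

definition sequences :: "nat \<Rightarrow> (nat \<Rightarrow> nat) set" where
  "sequences n = {\<alpha>. \<forall>i. i \<notin> {1..n} \<longrightarrow> \<alpha> i = 0}"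

definition weights :: "nat \<Rightarrow> nat \<Rightarrow> (nat \<Rightarrow> nat) set" where
  "weights n r = {\<alpha> \<in> sequences n. (\<Sum>i = 1..n. \<alpha> i) = r}"

definition partitions :: "nat \<Rightarrow> (nat \<Rightarrow> nat) set" where
  "partitions n = {\<nu> \<in> sequences n. \<forall>i \<in> {1..n}. \<forall>j \<in> {1..n}. i \<le> j \<longrightarrow> \<nu> j \<le> \<nu> i}"

definition partitions_of :: "nat \<Rightarrow> nat \<Rightarrow> (nat \<Rightarrow> nat) set" where
  "partitions_of n r = weights n r \<inter> partitions n"

definition len :: "(nat \<Rightarrow> nat) \<Rightarrow> nat" where
  "len \<mu> = card {i. \<mu> i \<noteq> 0}"

definition seq_scale :: "nat \<Rightarrow> (nat \<Rightarrow> nat) \<Rightarrow> nat \<Rightarrow> nat" where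
  "seq_scale k \<nu> = (\<lambda>i. k * \<nu> i)"

definition P_set :: "nat \<Rightarrow> nat \<Rightarrow> (nat \<Rightarrow> nat) \<Rightarrow> (nat \<Rightarrow> nat) set" where
  "P_set n r \<mu> =
    (if len \<mu> = 1 then weights n r
     else {\<alpha> \<in> weights n r. \<forall>i \<in> {2..len \<mu>}.
             (\<Sum>j = 1..i - 2. \<mu> j) + \<mu> i \<le> (\<Sum>j = 1..i - 1. \<alpha> j)})"

definition partitions_g :: "nat \<Rightarrow> nat \<Rightarrow> (nat \<Rightarrow> nat) set" where
  "partitions_g n g =
    (if g = 1 then partitions n
     else {\<mu> \<in> partitions n. \<forall>j \<in> {2..g}. \<mu> (j - 1) \<le> \<mu> j + \<mu> (j + 1)})"

section \<open>Tensors on the cells of a diagram\<close>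

text \<open>Let \<open>E = K\<^sup>n\<close> be the natural module with basis \<open>e 0, \<dots>, e (n - 1)\<close>.
  For a finite set \<open>D\<close> of cells, an element of the tensor power of \<open>E\<close> with one
  factor for each cell is represented by its coefficient function: the value at
  \<open>w\<close> is the coefficient of the tensor product of the \<open>e (w c)\<close>, \<open>c \<in> D\<close>.\<close>

type_synonym cell = "nat \<times> nat"
type_synonym 'k tensor = "(cell \<Rightarrow> nat) \<Rightarrow> 'k"

definition diagram :: "(nat \<Rightarrow> nat) \<Rightarrow> cell set" where
  "diagram \<mu> = {(i, j). 1 \<le> i \<and> 1 \<le> j \<and> j \<le> \<mu> i}"

definition words :: "nat \<Rightarrow> cell set \<Rightarrow> (cell \<Rightarrow> nat) set" where
  "words n D = D \<rightarrow>\<^sub>E {0..<n}"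

definition tensors :: "nat \<Rightarrow> cell set \<Rightarrow> 'k::field tensor set" where
  "tensors n D = {t. \<forall>w. w \<notin> words n D \<longrightarrow> t w = 0}"

definition tensor_scale :: "'k::field \<Rightarrow> 'k tensor \<Rightarrow> 'k tensor" where
  "tensor_scale c t = (\<lambda>w. c * t w)"

definition GL :: "nat \<Rightarrow> 'k::field mat set" where
  "GL n = {A \<in> carrier_mat n n. invertible_mat A}"

text \<open>The diagonal action determined by
  \<open>A e\<^sub>b = (\<Sum>a < n. A $$ (a, b) e\<^sub>a)\<close>.\<close>

definition gl_act :: "nat \<Rightarrow> cell set \<Rightarrow> 'k::field mat \<Rightarrow> 'k tensor \<Rightarrow> 'k tensor" where
  "gl_act n D A t =
    (\<lambda>w. if w \<in> words n D
         then \<Sum>u \<in> words n D. (\<Prod>c \<in> D. A $$ (w c, u c)) * t u else 0)"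

section \<open>Weyl modules\<close>

text \<open>The Weyl module of a partition \<open>\<mu>\<close> is defined following Akin, Buchsbaum and
  Weyman, as the image of the composite
  \<open>D\<^bsub>\<mu>\<^sub>1\<^esub> E \<otimes> \<dots> \<otimes> D\<^bsub>\<mu>\<^sub>n\<^esub> E \<rightarrow> E \<otimes> \<dots> \<otimes> E \<rightarrow> \<Lambda>\<^bsub>\<mu>'\<^sub>1\<^esub> E \<otimes> \<Lambda>\<^bsub>\<mu>'\<^sub>2\<^esub> E \<otimes> \<dots>\<close>
  of the comultiplications of the divided power algebra along the rows and the
  multiplications of the exterior algebra along the columns, where \<open>\<mu>'\<close> is the
  conjugate partition.
  The divided power \<open>D\<^bsub>a\<^esub> E\<close> is the space of symmetric tensors in the \<open>a\<close>-th tensor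
  power of \<open>E\<close>, so that its comultiplication is the inclusion. The exterior power
  \<open>\<Lambda>\<^bsub>a\<^esub> E\<close> is embedded in the \<open>a\<close>-th tensor power of \<open>E\<close> by its own comultiplication,
  which sends a product \<open>x\<^sub>1 \<and> \<dots> \<and> x\<^sub>a\<close> to the signed sum of all permutations of
  \<open>x\<^sub>1 \<otimes> \<dots> \<otimes> x\<^sub>a\<close> and is injective over every field.\<close>

definition row_stab :: "(nat \<Rightarrow> nat) \<Rightarrow> (cell \<Rightarrow> cell) set" where
  "row_stab \<mu> = {\<sigma>. \<sigma> permutes diagram \<mu> \<and> (\<forall>c \<in> diagram \<mu>. fst (\<sigma> c) = fst c)}"

definition col_stab :: "(nat \<Rightarrow> nat) \<Rightarrow> (cell \<Rightarrow> cell) set" where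
  "col_stab \<mu> = {\<sigma>. \<sigma> permutes diagram \<mu> \<and> (\<forall>c \<in> diagram \<mu>. snd (\<sigma> c) = snd c)}"

definition row_divided_powers :: "nat \<Rightarrow> (nat \<Rightarrow> nat) \<Rightarrow> 'k::field tensor set" where
  "row_divided_powers n \<mu> =
    {t \<in> tensors n (diagram \<mu>). \<forall>\<sigma> \<in> row_stab \<mu>. \<forall>w \<in> words n (diagram \<mu>). t (w \<circ> \<sigma>) = t w}"

definition col_wedge :: "(nat \<Rightarrow> nat) \<Rightarrow> 'k::field tensor \<Rightarrow> 'k tensor" where
  "col_wedge \<mu> t = (\<lambda>w. \<Sum>\<sigma> \<in> col_stab \<mu>. of_int (sign \<sigma>) * t (w \<circ> \<sigma>))"

definition weyl :: "nat \<Rightarrow> (nat \<Rightarrow> nat) \<Rightarrow> 'k::field tensor set" where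
  "weyl n \<mu> = col_wedge \<mu> ` row_divided_powers n \<mu>"

section \<open>Homomorphisms between Weyl modules\<close>

text \<open>A homomorphism is extended by zero outside its domain, so that it is determined by
  its restriction to the domain. For sequences that are zero outside \<open>{1..n}\<close> all
  spaces involved have finite dimension, so \<open>vector_space.dim\<close> is the usual dimension.\<close>

definition weyl_hom ::
    "nat \<Rightarrow> (nat \<Rightarrow> nat) \<Rightarrow> (nat \<Rightarrow> nat) \<Rightarrow> ('k::field tensor \<Rightarrow> 'k tensor) set" where
  "weyl_hom n \<alpha> \<beta> = {f.
     (\<forall>x \<in> weyl n \<alpha>. f x \<in> weyl n \<beta>) \<and>
     (\<forall>x \<in> weyl n \<alpha>. \<forall>y \<in> weyl n \<alpha>. f (x + y) = f x + f y) \<and>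
     (\<forall>c. \<forall>x \<in> weyl n \<alpha>. f (tensor_scale c x) = tensor_scale c (f x)) \<and>
     (\<forall>A \<in> GL n. \<forall>x \<in> weyl n \<alpha>.
        f (gl_act n (diagram \<alpha>) A x) = gl_act n (diagram \<beta>) A (f x)) \<and>
     (\<forall>x. x \<notin> weyl n \<alpha> \<longrightarrow> f x = 0)}"

definition hom_scale ::
    "'k::field \<Rightarrow> ('k tensor \<Rightarrow> 'k tensor) \<Rightarrow> 'k tensor \<Rightarrow> 'k tensor" where
  "hom_scale c f = (\<lambda>x. tensor_scale c (f x))"

interpretation hom_space: vector_space "hom_scale :: 'k::field \<Rightarrow> _"
  by unfold_locales
    (simp_all add: hom_scale_def tensor_scale_def fun_eq_iff algebra_simps)

definition dim_weyl_hom :: "'k::field itself \<Rightarrow> nat \<Rightarrow> (nat \<Rightarrow> nat) \<Rightarrow> (nat \<Rightarrow> nat) \<Rightarrow> nat" where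
  "dim_weyl_hom K n \<alpha> \<beta> =
    vector_space.dim (hom_scale :: 'k \<Rightarrow> _) (weyl_hom n \<alpha> \<beta>)"

end

theory Submission
  imports Defs "Jordan_Normal_Form.Char_Poly"
begin

text \<open>Homomorphisms from \<open>\<Delta>(\<lambda>)\<close> to \<open>\<Delta>(\<mu>)\<close> correspond to the vectors of
  \<open>\<Delta>(\<mu>)\<close> on which upper triangular matrices act by the character \<open>\<lambda>\<close>, the primitive
  vectors of weight \<open>\<lambda>\<close>. The period is a power \<open>q\<close> of the characteristic that exceeds
  \<open>r\<close>: for every \<open>k\<close> the primitive vectors for \<open>\<lambda> + k\<nu>\<close>, \<open>\<mu> + k\<nu>\<close>
  are matched with those for \<open>\<lambda> + (k + q)\<nu>\<close>, \<open>\<mu> + (k + q)\<nu>\<close>. In the following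
  sketch, \<open>\<lambda>\<close> and \<open>\<mu>\<close> already include the summand \<open>k\<nu>\<close>.

  Everything is done in the dual picture. The coordinates of the translates of the highest weight
  vector of \<open>\<Delta>(\<mu>)\<close> are bideterminants, products of minors of a matrix with one factor for
  each column of the diagram, and \<open>\<Delta>(\<mu>)\<close> is the dual of their span \<open>V(\<mu>)\<close>
  (\<open>weyl_annihilated\<close>, \<open>weylI\<close>). The span \<open>V(\<mu>)\<close> consists of all polynomial
  functions \<open>F\<close> on matrices with \<open>F(Xb) = \<mu>(b) F(X)\<close> for upper triangular \<open>b\<close>
  (\<open>semi_invariant_in_bidet_span\<close>): invariance under the addition of a column to the next one
  forces a lowest monomial of \<open>F\<close> to be a semistandard tableau, which is also the lowest monomial
  of a bideterminant, and subtracting bideterminants one reaches \<open>0\<close>. For a primitive vector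
  \<open>x\<close> of weight \<open>\<lambda>\<close> the coordinates of \<open>Ax\<close> are functions of \<open>A\<close> of this
  kind, so they are combinations of the coordinates of \<open>A\<close> applied to the highest weight vector of
  \<open>\<Delta>(\<lambda>)\<close>. This gives the homomorphism that belongs to \<open>x\<close>
  (\<open>weyl_hom_exists\<close>).

  Let \<open>f\<close> be the bideterminant in \<open>V(\<nu>)\<close> that is a product of leading principal minors.
  Multiplication by \<open>f\<^sup>q\<close> maps \<open>V(\<mu>)\<close> into \<open>V(\<mu> + q\<nu>)\<close>. A function of one
  of these spaces is determined by its restriction to lower unitriangular matrices, where \<open>f\<close> is
  \<open>1\<close>. Consider a function in \<open>V(\<mu> + q\<nu>)\<close> of a row weight that is at least
  \<open>\<lambda> + q\<nu>\<close> in the dominance order. In its restriction, the number of factors from column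
  \<open>b\<close> in any monomial is at most \<open>(\<mu>\<^sub>1 + \<dots> + \<mu>\<^sub>b) - (\<lambda>\<^sub>1 + \<dots> + \<lambda>\<^sub>b)\<close>. The hypothesis
  \<open>\<lambda> \<in> P(\<mu>)\<close> says that this is at most \<open>\<mu>\<^sub>b - \<mu>\<^bsub>b+1\<^esub>\<close> for all \<open>b\<close> below the length
  of \<open>\<mu>\<close>, and for the last row of \<open>\<mu>\<close> the degree of the function gives the same bound,
  because \<open>\<nu>\<close> is shorter than \<open>\<mu>\<close>. There are \<open>\<mu>\<^sub>b - \<mu>\<^bsub>b+1\<^esub>\<close> columns of \<open>\<mu>\<close> that
  end in row \<open>b\<close>, and changing only the last entries of columns one realizes each of these monomials
  as the restriction of a bideterminant in \<open>V(\<mu>)\<close>. Hence the function is divisible by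
  \<open>f\<^sup>q\<close> in \<open>V(\<mu>)\<close> (\<open>divisible\<close>).

  It remains to see that the transpose of the multiplication by \<open>f\<^sup>q\<close> respects primitive vectors
  in both directions. For upper triangular \<open>b\<close> the function \<open>f(bX)\<^sup>q\<close> is the sum of
  \<open>\<nu>(b)\<^sup>q f(X)\<^sup>q\<close> and of \<open>q\<close>-th powers of bideterminants of lower row weights. The latter lower
  some partial sum of the weight by at least \<open>q\<close>, which is more than the distance between
  \<open>\<lambda>\<close> and \<open>\<mu>\<close>, so they do not contribute (\<open>pairing_translate_f\<close>).\<close>

section \<open>Polynomial functions over an infinite field\<close>

definition monomial :: "'i set \<Rightarrow> ('i \<Rightarrow> nat) \<Rightarrow> ('i \<Rightarrow> 'k::field) \<Rightarrow> 'k" where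
  "monomial I m X = (\<Prod>i\<in>I. X i ^ m i)"

text \<open>The exponents may be repeated in the family: what vanishes is the total coefficient of each
  monomial. In this form the lemma also separates a polynomial into homogeneous components for any
  grading.\<close>
lemma monomial_linear_independent:
  fixes h :: "'j \<Rightarrow> 'k::field" and e :: "'j \<Rightarrow> 'i \<Rightarrow> nat"
  assumes "infinite (UNIV :: 'k set)" and "finite I" and "finite J"
    and "\<And>X. (\<Sum>j\<in>J. h j * monomial I (e j) X) = 0"
  shows "(\<Sum>j \<in> {j\<in>J. \<forall>i\<in>I. e j i = m i}. h j) = 0"
  using assms(2,3,4)
proof (induction I arbitrary: J rule: finite_induct)
  case empty
  then show ?case by (simp add: monomial_def)
next
  case (insert i I)
  define J' where "J' = {j\<in>J. e j i = m i}"
  have "(\<Sum>j\<in>J'. h j * monomial I (e j) X) = 0" for X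
  proof -
    define P where "P = (\<Sum>j\<in>J. monom (h j * monomial I (e j) X) (e j i))"
    have "poly P t = 0" for t
    proof -
      have "monomial (insert i I) (e j) (X(i := t)) = t ^ e j i * monomial I (e j) X" for j
      proof -
        have "(\<Prod>l\<in>I. (X(i := t)) l ^ e j l) = (\<Prod>l\<in>I. X l ^ e j l)"
          using insert.hyps(2) by (intro prod.cong) auto
        then show ?thesis by (simp add: monomial_def insert.hyps)
      qed
      then show ?thesis using insert.prems(2)[of "X(i := t)"]
        by (simp add: P_def poly_sum poly_monom mult_ac del: fun_upd_apply)
    qed
    then have "UNIV \<subseteq> {t. poly P t = 0}" by auto
    then have "infinite {t. poly P t = 0}" using assms(1) finite_subset by blast
    then have "P = 0" using poly_roots_finite by blast
    then have "0 = coeff P (m i)" by simp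
    also have "\<dots> = (\<Sum>j\<in>J. if e j i = m i then h j * monomial I (e j) X else 0)"
      by (simp add: P_def coeff_sum)
    also have "\<dots> = (\<Sum>j\<in>J'. h j * monomial I (e j) X)"
      unfolding J'_def by (rule sum.inter_filter[symmetric]) (fact insert.prems(1))
    finally show ?thesis by simp
  qed
  then have "(\<Sum>j \<in> {j\<in>J'. \<forall>l\<in>I. e j l = m l}. h j) = 0"
    using insert.IH[of J'] insert.prems(1) by (auto simp: J'_def)
  moreover have "{j\<in>J'. \<forall>l\<in>I. e j l = m l} = {j\<in>J. \<forall>l\<in>insert i I. e j l = m l}"
    by (auto simp: J'_def)
  ultimately show ?case by simp
qed

text \<open>Polynomials in several variables are treated as functions. Over an infinite field such a function
  determines its coefficients (\<open>expansion_unique\<close>).\<close>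
definition expansion ::
    "'i set \<Rightarrow> (('i \<Rightarrow> nat) \<Rightarrow> 'k::field) \<Rightarrow> (('i \<Rightarrow> 'k) \<Rightarrow> 'k) \<Rightarrow> bool" where
  "expansion I h F \<longleftrightarrow> finite {m. h m \<noteq> 0} \<and> (\<forall>m. h m \<noteq> 0 \<longrightarrow> (\<forall>i. i \<notin> I \<longrightarrow> m i = 0)) \<and>
     (\<forall>X. F X = (\<Sum>m | h m \<noteq> 0. h m * monomial I m X))"

definition polynomial_on :: "'i set \<Rightarrow> (('i \<Rightarrow> 'k::field) \<Rightarrow> 'k) \<Rightarrow> bool" where
  "polynomial_on I F \<longleftrightarrow> (\<exists>h. expansion I h F)"

lemma expansion_eval:
  assumes "expansion I h F" and "finite S" and "\<And>m. h m \<noteq> 0 \<Longrightarrow> m \<in> S"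
  shows "F X = (\<Sum>m\<in>S. h m * monomial I m X)"
proof -
  have "(\<Sum>m\<in>S. h m * monomial I m X) = (\<Sum>m | h m \<noteq> 0. h m * monomial I m X)"
    using assms by (intro sum.mono_neutral_right) auto
  then show ?thesis using assms(1) by (simp add: expansion_def)
qed

lemma expansion_monomial:
  assumes "\<And>i. i \<notin> I \<Longrightarrow> e i = 0"
  shows "expansion I (\<lambda>m. if m = e then c else 0) (\<lambda>X. c * monomial I e X)"
proof (cases "c = 0")
  case False
  then have "{m. (if m = e then c else 0) \<noteq> 0} = {e}" by auto
  then show ?thesis using assms by (auto simp: expansion_def)
qed (simp add: expansion_def)

lemma expansion_add:
  assumes "expansion I h F" and "expansion I h' F'"
  shows "expansion I (\<lambda>m. h m + h' m) (\<lambda>X. F X + F' X)"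
proof -
  let ?S = "{m. h m \<noteq> 0} \<union> {m. h' m \<noteq> 0}"
  have S: "finite ?S" using assms by (auto simp: expansion_def)
  have sub: "{m. h m + h' m \<noteq> 0} \<subseteq> ?S" by auto
  then have "finite {m. h m + h' m \<noteq> 0}" using S finite_subset by blast
  moreover have "F X + F' X = (\<Sum>m\<in>?S. (h m + h' m) * monomial I m X)" for X
    using expansion_eval[OF assms(1) S] expansion_eval[OF assms(2) S]
    by (auto simp: sum.distrib distrib_right)
  moreover have "(\<Sum>m\<in>?S. (h m + h' m) * monomial I m X) =
      (\<Sum>m | h m + h' m \<noteq> 0. (h m + h' m) * monomial I m X)" for X
    using S by (intro sum.mono_neutral_right) auto
  moreover have "m i = 0" if "h m + h' m \<noteq> 0" "i \<notin> I" for m i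
  proof -
    have "h m \<noteq> 0 \<or> h' m \<noteq> 0" using that(1) by auto
    then show ?thesis using assms that(2) unfolding expansion_def by blast
  qed
  ultimately show ?thesis by (simp add: expansion_def)
qed

lemma expansion_scale:
  assumes "expansion I h F"
  shows "expansion I (\<lambda>m. c * h m) (\<lambda>X. c * F X)"
  using assms by (cases "c = 0") (auto simp: expansion_def sum_distrib_left mult.assoc)

lemma expansion_0: "expansion I (\<lambda>m. 0) (\<lambda>X. 0)"
  by (simp add: expansion_def)

lemma expansion_sum:
  assumes "\<And>j. j \<in> J \<Longrightarrow> expansion I (h j) (F j)"
  shows "expansion I (\<lambda>m. \<Sum>j\<in>J. h j m) (\<lambda>X. \<Sum>j\<in>J. F j X)"
  using assms
  by (induction J rule: infinite_finite_induct) (auto intro: expansion_0 expansion_add)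

lemma expansion_unique:
  fixes h :: "('i \<Rightarrow> nat) \<Rightarrow> 'k::field"
  assumes "infinite (UNIV :: 'k set)" and "finite I"
    and "expansion I h F" and "expansion I h' F"
  shows "h = h'"
proof
  fix m
  define k where "k = (\<lambda>m. h m + (-1) * h' m)"
  have k: "expansion I k (\<lambda>X. F X + (-1) * F X)"
    unfolding k_def by (intro expansion_add expansion_scale assms)
  have "k m = 0"
  proof (rule ccontr)
    assume "k m \<noteq> 0"
    let ?J = "{m. k m \<noteq> 0}"
    have fin: "finite ?J" and supp: "\<And>m. k m \<noteq> 0 \<Longrightarrow> \<forall>i. i \<notin> I \<longrightarrow> m i = 0"
      using k by (auto simp: expansion_def)
    have "(\<Sum>j \<in> {j\<in>?J. \<forall>i\<in>I. id j i = m i}. k j) = 0"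
      using k by (intro monomial_linear_independent assms(1,2) fin) (auto simp: expansion_def)
    moreover have "{j\<in>?J. \<forall>i\<in>I. id j i = m i} = {m}"
    proof -
      have "j = m" if "k j \<noteq> 0" "\<forall>i\<in>I. j i = m i" for j
      proof
        show "j i = m i" for i
          using supp[of j] supp[of m] that \<open>k m \<noteq> 0\<close> by (cases "i \<in> I") auto
      qed
      then show ?thesis using \<open>k m \<noteq> 0\<close> by auto
    qed
    ultimately show False using \<open>k m \<noteq> 0\<close> by simp
  qed
  then show "h m = h' m"
    by (simp only: k_def mult_minus1 add_uminus_conv_diff right_minus_eq)
qed

text \<open>Both sides of the functional equation have expansions, so that coefficients can be compared.\<close>
lemma expansion_scaling:
  fixes F :: "('i \<Rightarrow> 'k::field) \<Rightarrow> 'k"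
  assumes inf: "infinite (UNIV :: 'k set)" and fin: "finite I" and h: "expansion I h F"
    and F: "\<And>X. F (\<lambda>i. s i * X i) = k * F X" and m: "h m \<noteq> 0"
  shows "monomial I m s = k"
proof -
  let ?S = "{m. h m \<noteq> 0}"
  have S: "finite ?S" and supp: "\<And>m i. h m \<noteq> 0 \<Longrightarrow> i \<notin> I \<Longrightarrow> m i = 0"
    using h unfolding expansion_def by blast+
  have "F (\<lambda>i. s i * X i) = (\<Sum>m\<in>?S. (h m * monomial I m s) * monomial I m X)" for X
    using h unfolding expansion_def by (simp add: monomial_def power_mult_distrib prod.distrib mult.assoc)
  then have eq: "(\<lambda>X. \<Sum>m\<in>?S. (h m * monomial I m s) * monomial I m X) = (\<lambda>X. k * F X)"
    by (simp add: F fun_eq_iff)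
  have "expansion I (\<lambda>m. \<Sum>m'\<in>?S. if m = m' then h m' * monomial I m' s else 0)
      (\<lambda>X. \<Sum>m\<in>?S. (h m * monomial I m s) * monomial I m X)"
    by (intro expansion_sum expansion_monomial supp) auto
  then have e: "expansion I (\<lambda>m. \<Sum>m'\<in>?S. if m = m' then h m' * monomial I m' s else 0) (\<lambda>X. k * F X)"
    unfolding eq .
  have "(\<Sum>m'\<in>?S. if m = m' then h m' * monomial I m' s else 0) = k * h m"
    using expansion_unique[OF inf fin e expansion_scale[OF h]] by (rule fun_cong)
  then show ?thesis using m S by simp
qed

lemma polynomial_on_0: "polynomial_on I (\<lambda>X. 0)"
  unfolding polynomial_on_def by (rule exI, rule expansion_0)

lemma polynomial_on_add:
  "polynomial_on I F \<Longrightarrow> polynomial_on I F' \<Longrightarrow> polynomial_on I (\<lambda>X. F X + F' X)"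
  unfolding polynomial_on_def by (elim exE, rule exI, rule expansion_add)

lemma polynomial_on_sum:
  "(\<And>j. j \<in> J \<Longrightarrow> polynomial_on I (F j)) \<Longrightarrow> polynomial_on I (\<lambda>X. \<Sum>j\<in>J. F j X)"
  by (induction J rule: infinite_finite_induct) (auto intro: polynomial_on_0 polynomial_on_add)

lemma polynomial_on_scale: "polynomial_on I F \<Longrightarrow> polynomial_on I (\<lambda>X. c * F X)"
  unfolding polynomial_on_def by (elim exE, rule exI, rule expansion_scale)

lemma polynomial_on_monomial: "(\<And>i. i \<notin> I \<Longrightarrow> e i = 0) \<Longrightarrow> polynomial_on I (\<lambda>X. c * monomial I e X)"
  unfolding polynomial_on_def by (rule exI, rule expansion_monomial)

lemma polynomial_on_const: "polynomial_on I (\<lambda>X. c)"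
  using polynomial_on_monomial[of I "\<lambda>_. 0" c] by (simp add: monomial_def)

lemma polynomial_on_var:
  assumes "finite I" and "i \<in> I"
  shows "polynomial_on I (\<lambda>X :: 'i \<Rightarrow> 'k::field. X i)"
proof -
  let ?e = "\<lambda>l. if l = i then 1 else 0 :: nat"
  have "X i = 1 * monomial I ?e X" for X :: "'i \<Rightarrow> 'k"
    using assms by (simp add: monomial_def if_distrib cong: if_cong)
  moreover have "polynomial_on I (\<lambda>X :: 'i \<Rightarrow> 'k. 1 * monomial I ?e X)"
    using assms by (intro polynomial_on_monomial) auto
  ultimately show ?thesis by presburger
qed

lemma polynomial_on_mult:
  assumes "polynomial_on I F" and "polynomial_on I F'"
  shows "polynomial_on I (\<lambda>X. F X * F' X)"
proof -
  obtain h h' where h: "expansion I h F" and h': "expansion I h' F'"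
    using assms by (auto simp: polynomial_on_def)
  have "F X * F' X = (\<Sum>m | h m \<noteq> 0. h m * monomial I m X) * (\<Sum>m | h' m \<noteq> 0. h' m * monomial I m X)" for X
    using h h' unfolding expansion_def by metis
  then have "F X * F' X = (\<Sum>m | h m \<noteq> 0. \<Sum>m' | h' m' \<noteq> 0. (h m * h' m') * monomial I (m + m') X)" for X
    unfolding sum_product
    by (simp add: monomial_def power_add prod.distrib mult.assoc mult.left_commute)
  moreover have "polynomial_on I
      (\<lambda>X. \<Sum>m | h m \<noteq> 0. \<Sum>m' | h' m' \<noteq> 0. (h m * h' m') * monomial I (m + m') X)"
    using h h' by (intro polynomial_on_sum polynomial_on_monomial) (auto simp: expansion_def)
  ultimately show ?thesis by simp
qed

lemma polynomial_on_prod: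
  "(\<And>j. j \<in> J \<Longrightarrow> polynomial_on I (F j)) \<Longrightarrow> polynomial_on I (\<lambda>X. \<Prod>j\<in>J. F j X)"
  by (induction J rule: infinite_finite_induct)
    (auto intro: polynomial_on_const polynomial_on_mult)

lemma polynomial_on_power: "polynomial_on I F \<Longrightarrow> polynomial_on I (\<lambda>X. F X ^ q)"
  by (induction q) (auto intro: polynomial_on_const polynomial_on_mult)

text \<open>Restriction to a curve reduces density arguments to the finiteness of the roots of a polynomial
  in one variable.\<close>
lemma polynomial_on_curve:
  assumes "polynomial_on I F"
  shows "\<exists>P. \<forall>t. poly P t = F (\<lambda>i. poly (Z i) t)"
proof -
  obtain h where h: "expansion I h F" using assms by (auto simp: polynomial_on_def)
  let ?P = "\<Sum>m | h m \<noteq> 0. Polynomial.smult (h m) (\<Prod>i\<in>I. Z i ^ m i)"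
  have "poly ?P t = F (\<lambda>i. poly (Z i) t)" for t
    using h by (auto simp: expansion_def monomial_def poly_sum poly_prod)
  then show ?thesis by blast
qed

lemma polynomial_on_curve_zero:
  fixes F :: "('i \<Rightarrow> 'k::field) \<Rightarrow> 'k"
  assumes "infinite (UNIV :: 'k set)" and "polynomial_on I F" and "finite B"
    and "\<And>t. t \<notin> B \<Longrightarrow> F (\<lambda>i. poly (Z i) t) = 0"
  shows "F (\<lambda>i. poly (Z i) t) = 0"
proof -
  obtain P where P: "\<And>t. poly P t = F (\<lambda>i. poly (Z i) t)"
    using polynomial_on_curve[OF assms(2)] by metis
  have "UNIV - B \<subseteq> {t. poly P t = 0}" using P assms(4) by auto
  then have "infinite {t. poly P t = 0}"
    using assms(1,3) by (meson Diff_infinite_finite infinite_super)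
  then have "P = 0" using poly_roots_finite by blast
  then show ?thesis using P[of t] by simp
qed

lemma polynomial_on_cong:
  assumes "polynomial_on I F" and "\<And>i. i \<in> I \<Longrightarrow> X i = Y i"
  shows "F X = F Y"
proof -
  obtain h where "expansion I h F" using assms by (auto simp: polynomial_on_def)
  moreover have "monomial I m X = monomial I m Y" for m
    unfolding monomial_def using assms(2) by (intro prod.cong) auto
  ultimately show ?thesis by (simp add: expansion_def)
qed

lemma infinite_field_power_eq:
  assumes "infinite (UNIV :: 'k::field set)" and "\<And>t::'k. t \<noteq> 0 \<Longrightarrow> t ^ a = t ^ b"
  shows "a = b"
proof (rule ccontr)
  assume "a \<noteq> b"
  define P where "P = monom (1::'k) a - monom 1 b"
  have "coeff P a = 1" using \<open>a \<noteq> b\<close> by (simp add: P_def)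
  then have "P \<noteq> 0" by auto
  moreover have "UNIV - {0} \<subseteq> {t. poly P t = 0}"
    using assms(2) by (auto simp: P_def poly_monom)
  ultimately show False
    using poly_roots_finite[of P] assms(1) finite_subset by fastforce
qed

section \<open>Translation invariant polynomials\<close>

lemma poly_eq_of_infinite:
  fixes P Q :: "'k::field poly"
  assumes "infinite (UNIV :: 'k set)" and "\<And>t. poly P t = poly Q t"
  shows "P = Q"
proof -
  have "{t. poly (P - Q) t = 0} = UNIV" using assms(2) by simp
  then show ?thesis using assms(1) poly_roots_finite[of "P - Q"] by fastforce
qed

text \<open>The sum is a polynomial \<open>Q(z, s)\<close> of degree at most \<open>E\<close> in \<open>z\<close> and at
  most \<open>\<epsilon>\<close> in \<open>s\<close>. It is divisible by \<open>(z + s)\<^sup>J\<close>, and the quotient \<open>R(z, s)\<close>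
  has degrees at most \<open>E - J\<close> and \<open>\<epsilon> - J\<close>. The lowest coefficient is recovered as
  \<open>R(-s, s)\<close>.\<close>
lemma degree_of_lowest_shifted_coeff:
  fixes P :: "nat \<Rightarrow> 'k::field poly"
  assumes inf: "infinite (UNIV :: 'k set)" and "J \<le> E" and PJ: "P J \<noteq> 0"
    and deg: "\<And>z. degree (\<Sum>j\<in>{J..E}. [:z, 1:] ^ j * P j) \<le> \<epsilon>"
  shows "J \<le> \<epsilon> \<and> degree (P J) + J + J \<le> \<epsilon> + E"
proof -
  define R where "R z = (\<Sum>j\<in>{J..E}. [:z, 1:] ^ (j - J) * P j)" for z
  have Q: "(\<Sum>j\<in>{J..E}. [:z, 1:] ^ j * P j) = [:z, 1:] ^ J * R z" for z
    unfolding R_def sum_distrib_left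
    by (intro sum.cong) (auto simp: mult.assoc[symmetric] power_add[symmetric])
  have degR: "J + degree (R z) \<le> \<epsilon>" if "R z \<noteq> 0" for z
    using deg[of z] that unfolding Q by (simp add: degree_mult_eq degree_linear_power)
  have RP: "poly (R (- s)) s = poly (P J) s" for s
  proof -
    have "poly (R (- s)) s = (\<Sum>j\<in>{J..E}. if j = J then poly (P J) s else 0)"
      unfolding R_def poly_sum by (intro sum.cong) auto
    then show ?thesis using \<open>J \<le> E\<close> by simp
  qed
  obtain s where "poly (P J) s \<noteq> 0"
    using poly_eq_of_infinite[OF inf, of "P J" 0] PJ by auto
  then have "R (- s) \<noteq> 0" using RP by (metis poly_0)
  then have J: "J \<le> \<epsilon>" using degR by fastforce
  define r where "r i = (\<Sum>j\<in>{J..E}. \<Sum>l\<le>i.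
      Polynomial.smult (coeff (P j) (i - l)) (if l \<le> j - J
        then Polynomial.monom (of_nat ((j - J) choose l)) (j - J - l) else 0))" for i
  have r: "coeff (R z) i = poly (r i) z" for z i
    unfolding R_def r_def coeff_sum poly_sum coeff_mult
    by (intro sum.cong refl)
      (auto simp: coeff_linear_poly_power poly_monom coeff_eq_0 degree_linear_power)
  have degr: "degree (r i) \<le> E - J" for i
    unfolding r_def
    by (intro degree_sum_le order.trans[OF degree_smult_le])
       (auto intro!: order.trans[OF degree_monom_le])
  define T where "T = (\<Sum>i\<le>\<epsilon> - J. pcompose (r i) [:0, -1:] * Polynomial.monom 1 i)"
  have "poly (P J) s = poly T s" for s
  proof -
    have "degree (R (- s)) \<le> \<epsilon> - J"
      using degR[of "- s"] by (cases "R (- s) = 0") auto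
    then have "R (- s) = (\<Sum>i\<le>\<epsilon> - J. Polynomial.monom (coeff (R (- s)) i) i)"
      by (rule poly_as_sum_of_monoms'[symmetric])
    then have "poly (R (- s)) s = poly (\<Sum>i\<le>\<epsilon> - J. Polynomial.monom (coeff (R (- s)) i) i) s"
      by simp
    also have "\<dots> = poly T s"
      unfolding T_def poly_sum by (intro sum.cong) (auto simp: poly_monom r poly_pcompose)
    finally show ?thesis by (simp add: RP)
  qed
  then have "P J = T" using poly_eq_of_infinite[OF inf] by blast
  also have "degree T \<le> E - J + (\<epsilon> - J)"
    unfolding T_def
  proof (intro degree_sum_le)
    fix i assume "i \<in> {..\<epsilon> - J}"
    have "degree (pcompose (r i) [:0, -1:] * Polynomial.monom 1 i) \<le>
        degree (pcompose (r i) [:0, -1:]) + degree (Polynomial.monom (1::'k) i)"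
      by (rule degree_mult_le)
    also have "\<dots> \<le> (E - J) + (\<epsilon> - J)"
      using degr[of i] \<open>i \<in> _\<close> by (intro add_mono) (auto simp: degree_monom_eq degree_pcompose)
    finally show "degree (pcompose (r i) [:0, -1:] * Polynomial.monom 1 i) \<le>
        (E - J) + (\<epsilon> - J)" .
  qed simp
  finally show ?thesis using J \<open>J \<le> E\<close> by auto
qed

text \<open>Induction over the variables. Let \<open>P\<^sub>c\<close> be the coefficient of the smallest powers of the first
  \<open>c\<close> variables. The total slack \<open>(e\<^sub>a - v\<^sub>a) - v\<^sub>a\<close> of these variables bounds the degree
  in \<open>s\<close> of \<open>P\<^sub>c\<close> after translation by \<open>s\<close>; it starts as \<open>0\<close> by translation
  invariance and changes as in \<open>degree_of_lowest_shifted_coeff\<close>. By the same lemma the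
  next exponent is at most the slack.\<close>
lemma translation_invariant_lexmin_exponent:
  fixes h :: "(nat \<Rightarrow> nat) \<Rightarrow> 'k::field"
  assumes inf: "infinite (UNIV :: 'k set)"
    and fin: "finite V" and h0: "\<And>v. v \<in> V \<Longrightarrow> h v \<noteq> 0"
    and supp: "\<And>v a. v \<in> V \<Longrightarrow> n \<le> a \<Longrightarrow> v a = 0"
    and inv: "\<And>z s. (\<Sum>v\<in>V. h v * (\<Prod>a<n. (z a + s) ^ v a)) = (\<Sum>v\<in>V. h v * (\<Prod>a<n. z a ^ v a))"
    and e: "\<And>v a. v \<in> V \<Longrightarrow> a < n \<Longrightarrow> v a \<le> e a"
    and v0: "v0 \<in> V"
    and lexmin: "\<And>v c. v \<in> V \<Longrightarrow> c < n \<Longrightarrow> (\<And>a. a < c \<Longrightarrow> v a = v0 a) \<Longrightarrow> v0 c \<le> v c"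
    and "c < n"
  shows "(\<Sum>a\<le>c. v0 a) \<le> (\<Sum>a<c. e a - v0 a)"
proof -
  define Vc where "Vc c = {v\<in>V. \<forall>a<c. v a = v0 a}" for c
  define P where "P c z = (\<Sum>v\<in>Vc c. Polynomial.smult (h v) (\<Prod>a\<in>{c..<n}. [:z a, 1:] ^ v a))" for c z
  have finV: "finite (Vc c)" for c using fin by (simp add: Vc_def)
  have nz: "\<exists>z. P c z \<noteq> 0" for c
  proof (rule ccontr)
    assume "\<not> ?thesis"
    then have P0: "poly (P c z) 0 = 0" for z by simp
    have "(\<Sum>v \<in> {v\<in>Vc c. \<forall>i\<in>{c..<n}. v i = v0 i}. h v) = 0"
    proof (rule monomial_linear_independent[OF inf])
      show "(\<Sum>v\<in>Vc c. h v * monomial {c..<n} v z) = 0" for z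
        using P0[of z] by (simp add: P_def poly_sum poly_prod monomial_def)
    qed (auto intro: finV)
    moreover have "{v\<in>Vc c. \<forall>i\<in>{c..<n}. v i = v0 i} = {v0}"
    proof -
      have "v = v0" if "v \<in> Vc c" "\<forall>i\<in>{c..<n}. v i = v0 i" for v
      proof
        show "v i = v0 i" for i
          using that supp[of v i] supp[OF v0, of i] by (cases "i < c"; cases "i < n") (auto simp: Vc_def)
      qed
      then show ?thesis using v0 by (auto simp: Vc_def)
    qed
    ultimately show False using h0[OF v0] by simp
  qed
  have main: "(\<Sum>a<c. v0 a) \<le> (\<Sum>a<c. e a - v0 a) \<and>
      (\<forall>z. degree (P c z) + (\<Sum>a<c. v0 a) \<le> (\<Sum>a<c. e a - v0 a)) \<and>
      (\<forall>b<c. (\<Sum>a\<le>b. v0 a) \<le> (\<Sum>a<b. e a - v0 a))" if "c \<le> n" for c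
    using that
  proof (induction c)
    case 0
    have "poly (P 0 z) s = poly [:poly (P 0 z) 0:] s" for z s
      using inv[of z s] by (simp add: P_def Vc_def poly_sum poly_prod atLeast0LessThan)
    then have "P 0 z = [:poly (P 0 z) 0:]" for z using poly_eq_of_infinite[OF inf] by blast
    then have "degree (P 0 z) = 0" for z by (metis degree_pCons_0)
    then show ?case by simp
  next
    case (Suc c)
    then have "c < n" by simp
    let ?\<epsilon> = "(\<Sum>a<c. e a - v0 a) - (\<Sum>a<c. v0 a)"
    define Pj where "Pj z j = (\<Sum>v\<in>{v\<in>Vc c. v c = j}.
        Polynomial.smult (h v) (\<Prod>a\<in>{Suc c..<n}. [:z a, 1:] ^ v a))" for z j
    have PjJ: "Pj z (v0 c) = P (Suc c) z" for z
    proof -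
      have "{v\<in>Vc c. v c = v0 c} = Vc (Suc c)" by (auto simp: Vc_def less_Suc_eq)
      then show ?thesis by (simp add: Pj_def P_def)
    qed
    have split: "P c (z(c := x)) = (\<Sum>j\<in>{v0 c..e c}. [:x, 1:] ^ j * Pj z j)" for z x
    proof -
      have "(\<lambda>v. v c) ` Vc c \<subseteq> {v0 c..e c}"
        using lexmin \<open>c < n\<close> e by (auto simp: Vc_def)
      then have "P c (z(c := x)) = (\<Sum>j\<in>{v0 c..e c}. \<Sum>v\<in>{v\<in>Vc c. v c = j}.
          Polynomial.smult (h v) (\<Prod>a\<in>{c..<n}. [:(z(c := x)) a, 1:] ^ v a))"
        unfolding P_def by (intro sum.group[symmetric] finV) auto
      also have "\<dots> = (\<Sum>j\<in>{v0 c..e c}. [:x, 1:] ^ j * Pj z j)"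
        unfolding Pj_def sum_distrib_left
      proof (intro sum.cong refl)
        fix j v assume "v \<in> {v\<in>Vc c. v c = j}"
        have "(\<Prod>a\<in>{Suc c..<n}. [:(z(c := x)) a, 1:] ^ v a) = (\<Prod>a\<in>{Suc c..<n}. [:z a, 1:] ^ v a)"
          by (intro prod.cong) auto
        then show "Polynomial.smult (h v) (\<Prod>a\<in>{c..<n}. [:(z(c := x)) a, 1:] ^ v a) =
            [:x, 1:] ^ j * Polynomial.smult (h v) (\<Prod>a\<in>{Suc c..<n}. [:z a, 1:] ^ v a)"
          using \<open>c < n\<close> \<open>v \<in> _\<close> by (simp add: prod.atLeast_Suc_lessThan del: fun_upd_apply) simp
      qed
      finally show ?thesis .
    qed
    have IH: "(\<Sum>a<c. v0 a) \<le> (\<Sum>a<c. e a - v0 a)"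
        "\<And>z. degree (P c z) \<le> ?\<epsilon>"
        "\<And>b. b < c \<Longrightarrow> (\<Sum>a\<le>b. v0 a) \<le> (\<Sum>a<b. e a - v0 a)"
      using Suc by (auto simp: le_diff_conv2)
    have step: "v0 c \<le> ?\<epsilon> \<and> degree (P (Suc c) z) + v0 c + v0 c \<le> ?\<epsilon> + e c" if "P (Suc c) z \<noteq> 0" for z
      using degree_of_lowest_shifted_coeff[OF inf, of "v0 c" "e c" "Pj z" ?\<epsilon>]
        e[OF v0 \<open>c < n\<close>] IH(2) that by (simp add: split[symmetric] PjJ)
    obtain z where "P (Suc c) z \<noteq> 0" using nz by blast
    then have J: "v0 c \<le> ?\<epsilon>" using step by blast
    have le: "v0 c \<le> e c" using e[OF v0 \<open>c < n\<close>] .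
    have deg: "degree (P (Suc c) z) + v0 c + v0 c \<le> ?\<epsilon> + e c" for z
      using step[of z] J le by (cases "P (Suc c) z = 0") auto
    have "(\<Sum>a\<le>b. v0 a) \<le> (\<Sum>a<b. e a - v0 a)" if "b < Suc c" for b
      using that IH(3)[of b] J IH(1)
      by (cases "b = c") (auto simp: lessThan_Suc_atMost[symmetric])
    moreover have "(\<Sum>a<Suc c. v0 a) \<le> (\<Sum>a<Suc c. e a - v0 a)" using J IH(1) by simp
    moreover have "degree (P (Suc c) z) + (\<Sum>a<Suc c. v0 a) \<le> (\<Sum>a<Suc c. e a - v0 a)" for z
      using deg[of z] J IH(1) le by simp
    ultimately show ?case by blast
  qed
  show ?thesis using main[of "Suc c"] \<open>c < n\<close> by simp
qed

section \<open>Bideterminants\<close>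

text \<open>A notation for inverse permutations that differs from that for inverses in a group.\<close>
abbreviation pinv :: "('a \<Rightarrow> 'a) \<Rightarrow> 'a \<Rightarrow> 'a" where
  "pinv \<equiv> inv_into UNIV"

text \<open>The action of an arbitrary matrix, given by its entries, so that coordinates of a translate can be
  treated as polynomial functions of the matrix.\<close>
definition act :: "nat \<Rightarrow> cell set \<Rightarrow> (nat \<times> nat \<Rightarrow> 'k::field) \<Rightarrow> 'k tensor \<Rightarrow> 'k tensor" where
  "act n D X t =
    (\<lambda>w. if w \<in> words n D then \<Sum>u \<in> words n D. (\<Prod>c \<in> D. X (w c, u c)) * t u else 0)"

definition mmul :: "nat \<Rightarrow> (nat \<times> nat \<Rightarrow> 'k::field) \<Rightarrow> (nat \<times> nat \<Rightarrow> 'k) \<Rightarrow> nat \<times> nat \<Rightarrow> 'k" where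
  "mmul n X Y = (\<lambda>(i, j). \<Sum>k<n. X (i, k) * Y (k, j))"

abbreviation square :: "nat \<Rightarrow> (nat \<times> nat) set" where
  "square n \<equiv> {..<n} \<times> {..<n}"

lemma gl_act_eq_act: "gl_act n D A = act n D (($$) A)"
  by (simp add: gl_act_def act_def fun_eq_iff)

lemma finite_words: "finite D \<Longrightarrow> finite (words n D)"
  by (simp add: words_def finite_PiE)

lemma words_less: "w \<in> words n D \<Longrightarrow> c \<in> D \<Longrightarrow> w c < n"
  by (auto simp: words_def)

lemma act_in_tensors: "act n D X t \<in> tensors n D"
  by (simp add: act_def tensors_def)

lemma act_cong:
  assumes "\<And>i j. i < n \<Longrightarrow> j < n \<Longrightarrow> X (i, j) = Y (i, j)"
  shows "act n D X t = act n D Y t"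
proof -
  have "(\<Prod>c \<in> D. X (w c, u c)) = (\<Prod>c \<in> D. Y (w c, u c))" if "w \<in> words n D" "u \<in> words n D" for w u
    using assms that by (intro prod.cong) (auto simp: words_less)
  then show ?thesis by (auto simp: act_def fun_eq_iff intro!: sum.cong)
qed

lemma act_add: "act n D X (s + t) = act n D X s + act n D X t"
  by (auto simp: act_def fun_eq_iff sum.distrib distrib_left)

lemma act_scale: "act n D X (tensor_scale c t) = tensor_scale c (act n D X t)"
  by (auto simp: act_def fun_eq_iff tensor_scale_def sum_distrib_left mult_ac)

lemma act_mmul:
  assumes "finite D"
  shows "act n D (mmul n X Y) t = act n D X (act n D Y t)"
proof
  fix w
  show "act n D (mmul n X Y) t w = act n D X (act n D Y t) w"
  proof (cases "w \<in> words n D")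
    case True
    have *: "(\<Prod>c\<in>D. mmul n X Y (w c, u c)) =
        (\<Sum>v\<in>words n D. (\<Prod>c\<in>D. X (w c, v c)) * (\<Prod>c\<in>D. Y (v c, u c)))" for u
      using assms unfolding mmul_def words_def
      by (simp add: prod_sum_PiE prod.distrib[symmetric] atLeast0LessThan)
    have "act n D (mmul n X Y) t w = (\<Sum>u\<in>words n D. \<Sum>v\<in>words n D.
        (\<Prod>c\<in>D. X (w c, v c)) * ((\<Prod>c\<in>D. Y (v c, u c)) * t u))"
      using True by (simp add: act_def * sum_distrib_right mult.assoc)
    also have "\<dots> = (\<Sum>v\<in>words n D. \<Sum>u\<in>words n D.
        (\<Prod>c\<in>D. X (w c, v c)) * ((\<Prod>c\<in>D. Y (v c, u c)) * t u))"
      by (rule sum.swap)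
    also have "\<dots> = act n D X (act n D Y t) w"
      using True by (simp add: act_def sum_distrib_left)
    finally show ?thesis .
  qed (simp add: act_def)
qed

lemma finite_diagram:
  assumes "\<mu> \<in> sequences n"
  shows "finite (diagram \<mu>)"
proof -
  have "diagram \<mu> \<subseteq> Sigma {1..n} (\<lambda>i. {1..\<mu> i})"
    using assms by (force simp: diagram_def sequences_def)
  then show ?thesis using finite_subset by blast
qed

lemma diagram_row_bounds:
  assumes "\<mu> \<in> sequences n" and "c \<in> diagram \<mu>"
  shows "1 \<le> fst c" and "fst c \<le> n" and "fst c - 1 < n"
proof -
  have "1 \<le> fst c \<and> fst c \<le> n"
    using assms by (cases "fst c \<in> {1..n}") (auto simp: diagram_def sequences_def split: prod.splits)
  then show "1 \<le> fst c" "fst c \<le> n" "fst c - 1 < n" by auto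
qed

lemma partitions_sequences: "\<mu> \<in> partitions n \<Longrightarrow> \<mu> \<in> sequences n"
  by (simp add: partitions_def)

lemma partitions_antimono:
  assumes "\<mu> \<in> partitions n" and "1 \<le> i" and "i \<le> j"
  shows "\<mu> j \<le> \<mu> i"
proof (cases "j \<le> n")
  case True
  then show ?thesis using assms by (auto simp: partitions_def)
next
  case False
  then show ?thesis using assms by (auto simp: partitions_def sequences_def)
qed

lemma finite_col_stab:
  assumes "finite (diagram \<mu>)"
  shows "finite (col_stab \<mu>)"
proof (rule finite_subset)
  show "col_stab \<mu> \<subseteq> {\<sigma>. \<sigma> permutes diagram \<mu>}" unfolding col_stab_def by blast
  show "finite {\<sigma>. \<sigma> permutes diagram \<mu>}" by (rule finite_permutations[OF assms])
qed

lemma col_stabD: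
  assumes "\<sigma> \<in> col_stab \<mu>"
  shows "\<sigma> permutes diagram \<mu>" and "snd (\<sigma> c) = snd c"
proof -
  show p: "\<sigma> permutes diagram \<mu>" using assms by (simp add: col_stab_def)
  show "snd (\<sigma> c) = snd c"
    using assms permutes_not_in[OF p, of c] by (cases "c \<in> diagram \<mu>") (simp_all add: col_stab_def)
qed

lemma col_stab_id: "id \<in> col_stab \<mu>"
  by (simp add: col_stab_def permutes_id)

lemma col_stabI:
  "\<sigma> permutes diagram \<mu> \<Longrightarrow> (\<And>c. snd (\<sigma> c) = snd c) \<Longrightarrow> \<sigma> \<in> col_stab \<mu>"
  by (simp add: col_stab_def)

lemma col_stab_compose:
  assumes "\<sigma> \<in> col_stab \<mu>" and "\<tau> \<in> col_stab \<mu>"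
  shows "\<sigma> \<circ> \<tau> \<in> col_stab \<mu>"
proof (rule col_stabI)
  show "\<sigma> \<circ> \<tau> permutes diagram \<mu>"
    by (rule permutes_compose[OF col_stabD(1)[OF assms(2)] col_stabD(1)[OF assms(1)]])
  show "snd ((\<sigma> \<circ> \<tau>) c) = snd c" for c
    using col_stabD(2)[OF assms(1), of "\<tau> c"] col_stabD(2)[OF assms(2), of c] by simp
qed

lemma col_stab_inv:
  assumes "\<sigma> \<in> col_stab \<mu>"
  shows "pinv \<sigma> \<in> col_stab \<mu>"
proof -
  have "snd (pinv \<sigma> c) = snd c" for c
    using col_stabD(2)[OF assms, of "pinv \<sigma> c"] permutes_inverses(1)[OF col_stabD(1)[OF assms]] by metis
  then show ?thesis using permutes_inv[OF col_stabD(1)[OF assms]] by (intro col_stabI)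
qed

lemma words_comp:
  assumes "w \<in> words n D" and "\<sigma> permutes D"
  shows "w \<circ> \<sigma> \<in> words n D"
  unfolding words_def
proof (rule PiE_I)
  fix c assume "c \<in> D"
  then have "\<sigma> c \<in> D" using permutes_in_image[OF assms(2)] by blast
  then show "(w \<circ> \<sigma>) c \<in> {0..<n}" using words_less[OF assms(1)] by simp
next
  fix c assume "c \<notin> D"
  then have "(w \<circ> \<sigma>) c = w c" using permutes_not_in[OF assms(2)] by simp
  then show "(w \<circ> \<sigma>) c = undefined" using assms(1) \<open>c \<notin> D\<close> PiE_arb by (metis words_def)
qed

definition row_word :: "(nat \<Rightarrow> nat) \<Rightarrow> cell \<Rightarrow> nat" where
  "row_word \<mu> = (\<lambda>c. if c \<in> diagram \<mu> then fst c - 1 else undefined)"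

lemma row_word_in_words: "\<mu> \<in> sequences n \<Longrightarrow> row_word \<mu> \<in> words n (diagram \<mu>)"
  using diagram_row_bounds[of \<mu> n] by (auto simp: row_word_def words_def)

text \<open>The highest weight vector of the Weyl module: the product over the columns of the exterior products
  of the first basis vectors.\<close>
definition hwv :: "(nat \<Rightarrow> nat) \<Rightarrow> 'k::field tensor" where
  "hwv \<mu> = col_wedge \<mu> (\<lambda>w. if w = row_word \<mu> then 1 else 0)"

text \<open>A product of minors, one for each column of the diagram. The minor that belongs to a column uses the
  leading columns of \<open>X\<close> and the rows that are listed by \<open>w\<close> in this column.\<close>
definition bidet :: "(nat \<Rightarrow> nat) \<Rightarrow> (cell \<Rightarrow> nat) \<Rightarrow> (nat \<times> nat \<Rightarrow> 'k::field) \<Rightarrow> 'k" where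
  "bidet \<mu> w X =
    (\<Sum>\<sigma> \<in> col_stab \<mu>. of_int (sign \<sigma>) * (\<Prod>c \<in> diagram \<mu>. X (w (\<sigma> c), fst c - 1)))"

lemma col_wedge_act:
  assumes "finite (diagram \<mu>)"
  shows "col_wedge \<mu> (act n (diagram \<mu>) X t) = act n (diagram \<mu>) X (col_wedge \<mu> t)"
proof
  fix w
  let ?D = "diagram \<mu>"
  have wd: "w \<circ> \<sigma> \<in> words n ?D \<longleftrightarrow> w \<in> words n ?D" if "\<sigma> \<in> col_stab \<mu>" for \<sigma>
  proof
    assume "w \<circ> \<sigma> \<in> words n ?D"
    then have "(w \<circ> \<sigma>) \<circ> pinv \<sigma> \<in> words n ?D"
      by (rule words_comp) (rule col_stabD(1)[OF col_stab_inv[OF that]])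
    then show "w \<in> words n ?D"
      using permutes_inv_o(1)[OF col_stabD(1)[OF that]] by (simp add: comp_assoc)
  qed (rule words_comp[OF _ col_stabD(1)[OF that]])
  show "col_wedge \<mu> (act n ?D X t) w = act n ?D X (col_wedge \<mu> t) w"
  proof (cases "w \<in> words n ?D")
    case True
    have "(\<Sum>u\<in>words n ?D. (\<Prod>c\<in>?D. X ((w \<circ> \<sigma>) c, u c)) * t u) =
        (\<Sum>u\<in>words n ?D. (\<Prod>c\<in>?D. X (w c, u c)) * t (u \<circ> \<sigma>))" if "\<sigma> \<in> col_stab \<mu>" for \<sigma>
    proof (rule sum.reindex_bij_witness[of _ "\<lambda>u. u \<circ> \<sigma>" "\<lambda>u. u \<circ> pinv \<sigma>"])
      note p = col_stabD(1)[OF that] and pi = col_stabD(1)[OF col_stab_inv[OF that]]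
      fix u assume u: "u \<in> words n ?D"
      show "u \<circ> pinv \<sigma> \<circ> \<sigma> = u" "u \<circ> \<sigma> \<circ> pinv \<sigma> = u"
        using permutes_inv_o[OF p] by (simp_all add: comp_assoc)
      show "u \<circ> pinv \<sigma> \<in> words n ?D" "u \<circ> \<sigma> \<in> words n ?D" using u words_comp p pi by blast+
      have "(\<Prod>c\<in>?D. X (w c, (u \<circ> pinv \<sigma>) c)) = (\<Prod>c\<in>?D. X (w (\<sigma> c), (u \<circ> pinv \<sigma>) (\<sigma> c)))"
        by (rule prod.permute[OF p, unfolded comp_def])
      then show "(\<Prod>c\<in>?D. X (w c, (u \<circ> pinv \<sigma>) c)) * t (u \<circ> pinv \<sigma> \<circ> \<sigma>) =
          (\<Prod>c\<in>?D. X ((w \<circ> \<sigma>) c, u c)) * t u"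
        using permutes_inv_o[OF p] permutes_inverses[OF p] by (simp add: comp_assoc)
    qed
    then have "col_wedge \<mu> (act n ?D X t) w = (\<Sum>\<sigma>\<in>col_stab \<mu>. of_int (sign \<sigma>) *
        (\<Sum>u\<in>words n ?D. (\<Prod>c\<in>?D. X (w c, u c)) * t (u \<circ> \<sigma>)))"
      using True wd by (simp add: col_wedge_def act_def)
    also have "\<dots> = (\<Sum>u\<in>words n ?D. \<Sum>\<sigma>\<in>col_stab \<mu>.
        (\<Prod>c\<in>?D. X (w c, u c)) * (of_int (sign \<sigma>) * t (u \<circ> \<sigma>)))"
      by (subst sum.swap) (simp add: sum_distrib_left mult_ac)
    also have "\<dots> = act n ?D X (col_wedge \<mu> t) w"
      using True by (simp add: act_def col_wedge_def sum_distrib_left)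
    finally show ?thesis .
  qed (simp add: col_wedge_def act_def wd)
qed

lemma act_row_word:
  assumes "\<mu> \<in> sequences n" and "w \<in> words n (diagram \<mu>)"
  shows "act n (diagram \<mu>) X (\<lambda>w. if w = row_word \<mu> then 1 else 0) w =
    (\<Prod>c\<in>diagram \<mu>. X (w c, fst c - 1))"
proof -
  have "act n (diagram \<mu>) X (\<lambda>w. if w = row_word \<mu> then 1 else 0) w =
    (\<Prod>c\<in>diagram \<mu>. X (w c, row_word \<mu> c))"
    using assms row_word_in_words[OF assms(1)] finite_words[OF finite_diagram[OF assms(1)]]
    by (simp add: act_def if_distrib cong: if_cong)
  also have "\<dots> = (\<Prod>c\<in>diagram \<mu>. X (w c, fst c - 1))"
    by (intro prod.cong) (auto simp: row_word_def)
  finally show ?thesis .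
qed

lemma act_hwv:
  assumes "\<mu> \<in> sequences n" and "w \<in> words n (diagram \<mu>)"
  shows "act n (diagram \<mu>) X (hwv \<mu>) w = bidet \<mu> w X"
proof -
  have "act n (diagram \<mu>) X (\<lambda>w. if w = row_word \<mu> then 1 else 0) (w \<circ> \<sigma>) =
    (\<Prod>c\<in>diagram \<mu>. X (w (\<sigma> c), fst c - 1))" if "\<sigma> \<in> col_stab \<mu>" for \<sigma>
    using act_row_word[OF assms(1) words_comp[OF assms(2) col_stabD(1)[OF that]]] by simp
  then show ?thesis
    unfolding hwv_def col_wedge_act[OF finite_diagram[OF assms(1)], symmetric]
    by (simp add: col_wedge_def bidet_def)
qed

lemma permutation_col_stab: "finite (diagram \<mu>) \<Longrightarrow> \<sigma> \<in> col_stab \<mu> \<Longrightarrow> permutation \<sigma>"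
  using permutation_permutes col_stabD(1) by blast

lemma bidet_alt:
  assumes "finite (diagram \<mu>)"
  shows "bidet \<mu> w X =
    (\<Sum>\<sigma> \<in> col_stab \<mu>. of_int (sign \<sigma>) * (\<Prod>c \<in> diagram \<mu>. X (w c, fst (\<sigma> c) - 1)))"
  unfolding bidet_def
proof (rule sum.reindex_bij_witness[of _ pinv pinv])
  fix \<sigma> assume \<sigma>: "\<sigma> \<in> col_stab \<mu>"
  note p = col_stabD(1)[OF \<sigma>]
  show "pinv (pinv \<sigma>) = \<sigma>" using p by (simp add: inv_inv_eq permutes_bij)
  then show "pinv (pinv \<sigma>) = \<sigma>" .
  show "pinv \<sigma> \<in> col_stab \<mu>" by (rule col_stab_inv[OF \<sigma>])
  then show "pinv \<sigma> \<in> col_stab \<mu>" .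
  have "(\<Prod>c \<in> diagram \<mu>. X (w c, fst (pinv \<sigma> c) - 1)) =
      (\<Prod>c \<in> diagram \<mu>. X (w (\<sigma> c), fst (pinv \<sigma> (\<sigma> c)) - 1))"
    by (rule prod.permute[OF p, unfolded comp_def])
  then show "of_int (sign (pinv \<sigma>)) * (\<Prod>c \<in> diagram \<mu>. X (w c, fst (pinv \<sigma> c) - 1)) =
      of_int (sign \<sigma>) * (\<Prod>c \<in> diagram \<mu>. X (w (\<sigma> c), fst c - 1))"
    using permutes_inverses[OF p] sign_inverse[OF permutation_col_stab[OF assms \<sigma>]] by simp
qed

text \<open>A form of the Cauchy-Binet formula for products of minors.\<close>
lemma bidet_left:
  assumes "\<mu> \<in> sequences n" and "w \<in> words n (diagram \<mu>)"
  shows "bidet \<mu> w (mmul n b X) =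
    (\<Sum>u\<in>words n (diagram \<mu>). (\<Prod>c\<in>diagram \<mu>. b (w c, u c)) * bidet \<mu> u X)"
proof -
  have "bidet \<mu> w (mmul n b X) = act n (diagram \<mu>) b (act n (diagram \<mu>) X (hwv \<mu>)) w"
    by (simp only: act_hwv[OF assms, symmetric] act_mmul[OF finite_diagram[OF assms(1)]])
  also have "\<dots> = (\<Sum>u\<in>words n (diagram \<mu>). (\<Prod>c\<in>diagram \<mu>. b (w c, u c)) *
      act n (diagram \<mu>) X (hwv \<mu>) u)"
    using assms(2) by (simp add: act_def[of n "diagram \<mu>" b])
  also have "\<dots> = (\<Sum>u\<in>words n (diagram \<mu>). (\<Prod>c\<in>diagram \<mu>. b (w c, u c)) * bidet \<mu> u X)"
    using act_hwv[OF assms(1)] by (intro sum.cong) auto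
  finally show ?thesis .
qed

lemma polynomial_on_bidet:
  assumes "\<mu> \<in> sequences n" and "w \<in> words n (diagram \<mu>)"
  shows "polynomial_on (square n) (bidet \<mu> w)"
proof -
  have "polynomial_on (square n) (\<lambda>X. bidet \<mu> w X)"
    unfolding bidet_def
  proof (intro polynomial_on_sum polynomial_on_scale polynomial_on_prod polynomial_on_var)
    fix \<sigma> c assume "\<sigma> \<in> col_stab \<mu>" "c \<in> diagram \<mu>"
    then have "\<sigma> c \<in> diagram \<mu>" using col_stabD(1) permutes_in_image by metis
    then show "(w (\<sigma> c), fst c - 1) \<in> square n"
      using words_less[OF assms(2)] diagram_row_bounds[OF assms(1) \<open>c \<in> _\<close>] by auto
  qed simp
  then show ?thesis by simp
qed

definition upper :: "nat \<Rightarrow> (nat \<times> nat \<Rightarrow> 'k::field) \<Rightarrow> bool" where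
  "upper n b \<longleftrightarrow> (\<forall>i<n. \<forall>j<i. b (i, j) = 0) \<and> (\<forall>i<n. b (i, i) \<noteq> 0)"

definition wt :: "nat \<Rightarrow> (nat \<Rightarrow> nat) \<Rightarrow> (nat \<times> nat \<Rightarrow> 'k::field) \<Rightarrow> 'k" where
  "wt n \<mu> b = (\<Prod>i<n. b (i, i) ^ \<mu> (Suc i))"

lemma diagram_prod_rows:
  assumes "\<mu> \<in> sequences n"
  shows "(\<Prod>c\<in>diagram \<mu>. g (fst c - 1)) = (\<Prod>i<n. g i ^ \<mu> (Suc i) :: 'k::field)"
proof -
  have "(\<lambda>c. fst c - 1) ` diagram \<mu> \<subseteq> {..<n}" using diagram_row_bounds[OF assms] by auto
  then have "(\<Prod>c\<in>diagram \<mu>. g (fst c - 1)) =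
      (\<Prod>i<n. \<Prod>c\<in>{c\<in>diagram \<mu>. fst c - 1 = i}. g (fst c - 1))"
    by (intro prod.group[symmetric] finite_diagram[OF assms]) auto
  also have "\<dots> = (\<Prod>i<n. g i ^ card {c\<in>diagram \<mu>. fst c - 1 = i})"
    by (intro prod.cong) auto
  also have "\<dots> = (\<Prod>i<n. g i ^ \<mu> (Suc i))"
  proof (intro prod.cong refl)
    fix i
    have "{c\<in>diagram \<mu>. fst c - 1 = i} = Pair (Suc i) ` {1..\<mu> (Suc i)}"
      by (force simp: diagram_def)
    then show "g i ^ card {c\<in>diagram \<mu>. fst c - 1 = i} = g i ^ \<mu> (Suc i)"
      by (simp add: card_image inj_on_def)
  qed
  finally show ?thesis .
qed

text \<open>Composition with the transposition of the two cells exchanges the even and the odd terms.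
  Comparing the two partial sums, rather than the total with its negative, covers characteristic
  two.\<close>
lemma bidet_column_repeat:
  assumes "finite (diagram \<mu>)" and "c \<in> diagram \<mu>" "c' \<in> diagram \<mu>" "snd c = snd c'" "c \<noteq> c'" "w c = w c'"
  shows "bidet \<mu> w X = (0 :: 'k::field)"
proof -
  let ?S = "col_stab \<mu>"
  let ?\<tau> = "transpose c c'"
  define f where "f \<sigma> = (\<Prod>c \<in> diagram \<mu>. X (w (\<sigma> c), fst c - 1))" for \<sigma>
  have fin: "finite ?S" by (rule finite_col_stab[OF assms(1)])
  have \<tau>: "?\<tau> \<in> ?S"
    using assms permutes_swap_id[of c "diagram \<mu>" c'] by (auto simp: col_stab_def transpose_def)
  have f\<tau>: "f (?\<tau> \<circ> \<sigma>) = f \<sigma>" for \<sigma>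
    using assms(6) unfolding f_def by (intro prod.cong) (auto simp: transpose_def)
  have sgn: "sign (?\<tau> \<circ> \<sigma>) = - sign \<sigma>" if "\<sigma> \<in> ?S" for \<sigma>
    using that assms(5) permutation_col_stab[OF assms(1)] \<tau> by (simp add: sign_compose sign_swap_id)
  have "(\<Sum>\<sigma>\<in>{\<sigma>\<in>?S. sign \<sigma> = 1}. f \<sigma>) = (\<Sum>\<sigma>\<in>{\<sigma>\<in>?S. sign \<sigma> \<noteq> 1}. f \<sigma>)"
  proof (rule sum.reindex_bij_witness[of _ "(\<circ>) ?\<tau>" "(\<circ>) ?\<tau>"])
    fix \<sigma> assume "\<sigma> \<in> {\<sigma>\<in>?S. sign \<sigma> = 1}"
    then show "?\<tau> \<circ> (?\<tau> \<circ> \<sigma>) = \<sigma>" "?\<tau> \<circ> \<sigma> \<in> {\<sigma>\<in>?S. sign \<sigma> \<noteq> 1}" "f (?\<tau> \<circ> \<sigma>) = f \<sigma>"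
      using col_stab_compose[OF \<tau>] sgn f\<tau> by (auto simp: comp_assoc[symmetric])
  next
    fix \<sigma> assume "\<sigma> \<in> {\<sigma>\<in>?S. sign \<sigma> \<noteq> 1}"
    then show "?\<tau> \<circ> (?\<tau> \<circ> \<sigma>) = \<sigma>" "?\<tau> \<circ> \<sigma> \<in> {\<sigma>\<in>?S. sign \<sigma> = 1}"
      using col_stab_compose[OF \<tau>] sgn by (auto simp: comp_assoc[symmetric] sign_def split: if_splits)
  qed
  moreover have "bidet \<mu> w X =
      (\<Sum>\<sigma>\<in>{\<sigma>\<in>?S. sign \<sigma> = 1} \<union> {\<sigma>\<in>?S. sign \<sigma> \<noteq> 1}. of_int (sign \<sigma>) * f \<sigma>)"
    unfolding bidet_def f_def by (intro sum.cong) auto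
  moreover have "\<dots> = (\<Sum>\<sigma>\<in>{\<sigma>\<in>?S. sign \<sigma> = 1}. of_int (sign \<sigma>) * f \<sigma>) +
      (\<Sum>\<sigma>\<in>{\<sigma>\<in>?S. sign \<sigma> \<noteq> 1}. of_int (sign \<sigma>) * f \<sigma>)"
    using fin by (intro sum.union_disjoint) auto
  moreover have "(\<Sum>\<sigma>\<in>{\<sigma>\<in>?S. sign \<sigma> = 1}. of_int (sign \<sigma>) * f \<sigma>) = (\<Sum>\<sigma>\<in>{\<sigma>\<in>?S. sign \<sigma> = 1}. f \<sigma>)"
    by (intro sum.cong) auto
  moreover have "(\<Sum>\<sigma>\<in>{\<sigma>\<in>?S. sign \<sigma> \<noteq> 1}. of_int (sign \<sigma>) * f \<sigma>) = - (\<Sum>\<sigma>\<in>{\<sigma>\<in>?S. sign \<sigma> \<noteq> 1}. f \<sigma>)"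
    unfolding sum_negf[symmetric] by (intro sum.cong) (auto simp: sign_def split: if_splits)
  ultimately show ?thesis by simp
qed

text \<open>A word with a repetition in a column gives \<open>0\<close> on both sides. Otherwise a nonzero term needs
  entries that are at most the row index and distinct in each column, which leaves only
  the row word.\<close>
lemma act_upper_hwv:
  assumes \<mu>: "\<mu> \<in> partitions n" and b: "upper n b"
  shows "act n (diagram \<mu>) b (hwv \<mu>) = tensor_scale (wt n \<mu> b) (hwv \<mu>)"
proof
  fix w
  let ?D = "diagram \<mu>"
  have seq: "\<mu> \<in> sequences n" using \<mu> by (rule partitions_sequences)
  have fin: "finite ?D" by (rule finite_diagram[OF seq])
  have hw: "hwv \<mu> w = (\<Sum>\<sigma>\<in>col_stab \<mu>. of_int (sign \<sigma>) * (if w \<circ> \<sigma> = row_word \<mu> then 1 else 0))"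
    by (simp add: hwv_def col_wedge_def)
  show "act n ?D b (hwv \<mu>) w = tensor_scale (wt n \<mu> b) (hwv \<mu>) w"
  proof (cases "w \<in> words n ?D")
    case False
    have "w \<circ> \<sigma> \<noteq> row_word \<mu>" if "\<sigma> \<in> col_stab \<mu>" for \<sigma>
    proof
      assume "w \<circ> \<sigma> = row_word \<mu>"
      then have "(w \<circ> \<sigma>) \<circ> pinv \<sigma> \<in> words n ?D"
        using row_word_in_words[OF seq] words_comp col_stabD(1)[OF col_stab_inv[OF that]] by metis
      then show False using False permutes_inv_o(1)[OF col_stabD(1)[OF that]] by (simp add: comp_assoc)
    qed
    then show ?thesis using False by (simp add: act_def hw tensor_scale_def)
  next
    case True
    then have eq: "act n ?D b (hwv \<mu>) w = bidet \<mu> w b" by (rule act_hwv[OF seq])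
    show ?thesis
    proof (cases "\<exists>c\<in>?D. \<exists>c'\<in>?D. snd c = snd c' \<and> c \<noteq> c' \<and> w c = w c'")
      case True
      then obtain c c' where c: "c\<in>?D" "c'\<in>?D" "snd c = snd c'" "c \<noteq> c'" "w c = w c'" by blast
      have "w \<circ> \<sigma> \<noteq> row_word \<mu>" if "\<sigma> \<in> col_stab \<mu>" for \<sigma>
      proof
        assume w: "w \<circ> \<sigma> = row_word \<mu>"
        note \<sigma>' = col_stab_inv[OF that] and p = col_stabD(1)[OF that]
        have val: "w d = fst (pinv \<sigma> d) - 1 \<and> 1 \<le> fst (pinv \<sigma> d)" if "d \<in> ?D" for d
        proof -
          have "pinv \<sigma> d \<in> ?D" using that permutes_in_image[OF col_stabD(1)[OF \<sigma>']] by blast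
          moreover have "w d = (w \<circ> \<sigma>) (pinv \<sigma> d)" using permutes_inverses[OF p] by simp
          ultimately show ?thesis using diagram_row_bounds[OF seq] by (simp add: w row_word_def)
        qed
        have "fst (pinv \<sigma> c) = fst (pinv \<sigma> c')" using val[OF c(1)] val[OF c(2)] c(5) by linarith
        then have "pinv \<sigma> c = pinv \<sigma> c'"
          using col_stabD(2)[OF \<sigma>', of c] col_stabD(2)[OF \<sigma>', of c'] c(3) by (simp add: prod_eq_iff)
        then show False using c(4) injD[OF permutes_inj[OF permutes_inv[OF p]]] by blast
      qed
      then show ?thesis
        using bidet_column_repeat[OF fin c] by (simp add: eq hw tensor_scale_def)
    next
      case norep: False
      have "(\<Prod>c\<in>?D. b (w (\<sigma> c), fst c - 1)) = wt n \<mu> b * (if w \<circ> \<sigma> = row_word \<mu> then 1 else 0)"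
        if \<sigma>: "\<sigma> \<in> col_stab \<mu>" for \<sigma>
      proof (cases "w \<circ> \<sigma> = row_word \<mu>")
        case True
        have "(\<Prod>c\<in>?D. b (w (\<sigma> c), fst c - 1)) = (\<Prod>c\<in>?D. (\<lambda>i. b (i, i)) (fst c - 1))"
          using fun_cong[OF True] by (intro prod.cong) (auto simp: row_word_def)
        also have "\<dots> = wt n \<mu> b" unfolding wt_def by (rule diagram_prod_rows[OF seq])
        finally show ?thesis using True by simp
      next
        case neq: False
        note p = col_stabD(1)[OF \<sigma>]
        have "\<exists>c\<in>?D. fst c - 1 < w (\<sigma> c)"
        proof (rule ccontr)
          assume "\<not> ?thesis"
          then have le: "w (\<sigma> c) \<le> fst c - 1" if "c \<in> ?D" for c
            using that by (metis not_le_imp_less)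
          have "(i, j) \<in> ?D \<Longrightarrow> w (\<sigma> (i, j)) = i - 1" for i j
          proof (induction i rule: less_induct)
            case (less i)
            have "w (\<sigma> (i, j)) \<noteq> i' - 1" if "1 \<le> i'" "i' < i" for i'
            proof
              assume *: "w (\<sigma> (i, j)) = i' - 1"
              have "j \<le> \<mu> i'" using less.prems partitions_antimono[OF \<mu>, of i' i] that
                by (auto simp: diagram_def)
              then have D': "(i', j) \<in> ?D" using less.prems that by (auto simp: diagram_def)
              then have "w (\<sigma> (i', j)) = w (\<sigma> (i, j))" using less.IH[OF \<open>i' < i\<close>] * by simp
              moreover have "\<sigma> (i', j) \<noteq> \<sigma> (i, j)"
                using injD[OF permutes_inj[OF p], of "(i', j)" "(i, j)"] that by auto
              moreover have "\<sigma> (i', j) \<in> ?D" "\<sigma> (i, j) \<in> ?D"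
                using D' less.prems permutes_in_image[OF p] by blast+
              moreover have "snd (\<sigma> (i', j)) = snd (\<sigma> (i, j))"
                by (simp add: col_stabD(2)[OF \<sigma>])
              ultimately show False using norep by blast
            qed
            from this[of "Suc (w (\<sigma> (i, j)))"] have "\<not> Suc (w (\<sigma> (i, j))) < i" by auto
            moreover have "w (\<sigma> (i, j)) \<le> i - 1" "1 \<le> i"
              using le[OF less.prems] diagram_row_bounds(1)[OF seq less.prems] by simp_all
            ultimately show ?case by linarith
          qed
          then have "w \<circ> \<sigma> = row_word \<mu>"
            using words_comp[OF \<open>w \<in> words n ?D\<close> p]
            by (auto simp: fun_eq_iff row_word_def words_def PiE_def extensional_def)
          then show False using neq by simp
        qed
        then obtain c where c: "c \<in> ?D" "fst c - 1 < w (\<sigma> c)" by blast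
        have "w (\<sigma> c) < n" using words_less[OF \<open>w \<in> words n ?D\<close>] permutes_in_image[OF p] c by blast
        then have "b (w (\<sigma> c), fst c - 1) = 0" using b c(2) by (simp add: upper_def)
        then have "(\<Prod>c\<in>?D. b (w (\<sigma> c), fst c - 1)) = 0" using fin c(1) by (meson prod_zero)
        then show ?thesis using neq by simp
      qed
      then have "bidet \<mu> w b = (\<Sum>\<sigma>\<in>col_stab \<mu>. wt n \<mu> b *
          (of_int (sign \<sigma>) * (if w \<circ> \<sigma> = row_word \<mu> then 1 else 0)))"
        unfolding bidet_def by (intro sum.cong) auto
      then show ?thesis by (simp add: eq hw tensor_scale_def sum_distrib_left)
    qed
  qed
qed

text \<open>These are the sections of a line bundle on the flag variety that extend to
  polynomial functions on all matrices.\<close>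
definition semi_invariant :: "nat \<Rightarrow> (nat \<Rightarrow> nat) \<Rightarrow> ((nat \<times> nat \<Rightarrow> 'k::field) \<Rightarrow> 'k) \<Rightarrow> bool" where
  "semi_invariant n \<mu> F \<longleftrightarrow> polynomial_on (square n) F \<and>
    (\<forall>X b. upper n b \<longrightarrow> F (mmul n X b) = wt n \<mu> b * F X)"

lemma semi_invariant_bidet:
  assumes "\<mu> \<in> partitions n" and "w \<in> words n (diagram \<mu>)"
  shows "semi_invariant n \<mu> (bidet \<mu> w)"
proof -
  have seq: "\<mu> \<in> sequences n" using assms(1) by (rule partitions_sequences)
  have "bidet \<mu> w (mmul n X b) = wt n \<mu> b * bidet \<mu> w X" if "upper n b" for X b
  proof -
    have "bidet \<mu> w (mmul n X b) = act n (diagram \<mu>) X (act n (diagram \<mu>) b (hwv \<mu>)) w"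
      by (simp only: act_hwv[OF seq assms(2), symmetric] act_mmul[OF finite_diagram[OF seq]])
    also have "\<dots> = wt n \<mu> b * act n (diagram \<mu>) X (hwv \<mu>) w"
      by (simp add: act_upper_hwv[OF assms(1) that] act_scale) (simp add: tensor_scale_def)
    finally show ?thesis by (simp add: act_hwv[OF seq assms(2)])
  qed
  then show ?thesis using polynomial_on_bidet[OF seq assms(2)] unfolding semi_invariant_def by blast
qed

section \<open>Dense sets of matrices\<close>

lemma invertible_mat_if_det_nonzero:
  fixes A :: "'k::field mat"
  assumes A: "A \<in> carrier_mat n n" and "det A \<noteq> 0"
  shows "invertible_mat A"
proof -
  have "A \<in> Units (ring_mat TYPE('k) n undefined)"
    by (rule det_non_zero_imp_unit[OF A assms(2)])
  then obtain B where "B \<in> carrier_mat n n" "B * A = 1\<^sub>m n" "A * B = 1\<^sub>m n"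
    by (auto simp: Units_def ring_mat_def)
  then show ?thesis using A by (auto simp: invertible_mat_def inverts_mat_def)
qed

text \<open>Adding a scalar matrix makes a matrix invertible except for finitely many values of the scalar.\<close>
lemma polynomial_zero_if_zero_on_GL:
  fixes F :: "(nat \<times> nat \<Rightarrow> 'k::field) \<Rightarrow> 'k"
  assumes inf: "infinite (UNIV :: 'k set)" and F: "polynomial_on (square n) F"
    and zero: "\<And>A. A \<in> GL n \<Longrightarrow> F (($$) A) = 0"
  shows "F X = 0"
proof -
  define M where "M = mat n n X"
  define Z where "Z i = [:X i, if fst i = snd i then 1 else 0:]" for i :: "nat \<times> nat"
  define B where "B = uminus ` {t. poly (char_poly M) t = 0}"
  have M: "M \<in> carrier_mat n n" by (simp add: M_def)
  have "char_poly M \<noteq> 0" using degree_monic_char_poly[OF M] by auto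
  then have "finite B" by (simp add: B_def poly_roots_finite)
  have "F (\<lambda>i. poly (Z i) t) = 0" if "t \<notin> B" for t
  proof -
    let ?A = "char_matrix M (- t)"
    have A: "?A \<in> carrier_mat n n" using M by (simp add: char_matrix_def)
    have "poly (char_poly M) (- t) \<noteq> 0"
    proof
      assume "poly (char_poly M) (- t) = 0"
      then have "- (- t) \<in> B" unfolding B_def by blast
      then show False using that by simp
    qed
    then have "det ?A \<noteq> 0"
      using eigenvalue_root_char_poly[OF M] eigenvalue_det[OF M] by blast
    then have "?A \<in> GL n" using A invertible_mat_if_det_nonzero[OF A] by (simp add: GL_def)
    then have "F (($$) ?A) = 0" by (rule zero)
    moreover have "F (($$) ?A) = F (\<lambda>i. poly (Z i) t)"
    proof (rule polynomial_on_cong[OF F])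
      fix i assume "i \<in> square n"
      then show "?A $$ i = poly (Z i) t"
        by (cases i) (simp add: M_def Z_def char_matrix_def)
    qed
    ultimately show ?thesis by simp
  qed
  then have "F (\<lambda>i. poly (Z i) 0) = 0"
    by (rule polynomial_on_curve_zero[OF inf F \<open>finite B\<close>])
  then show ?thesis by (simp add: Z_def)
qed

definition lower_unitriangular :: "nat \<Rightarrow> (nat \<times> nat \<Rightarrow> 'k::field) \<Rightarrow> bool" where
  "lower_unitriangular n u \<longleftrightarrow> (\<forall>i<n. u (i, i) = 1 \<and> (\<forall>j<n. i < j \<longrightarrow> u (i, j) = 0))"

lemma semi_invariant_cong:
  assumes "semi_invariant n \<mu> F" and "\<And>i j. i < n \<Longrightarrow> j < n \<Longrightarrow> X (i, j) = Y (i, j)"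
  shows "F X = F Y"
  using assms polynomial_on_cong[of "square n" F X Y] by (auto simp: semi_invariant_def)

lemma wt_nonzero: "upper n b \<Longrightarrow> wt n \<mu> b \<noteq> 0"
  by (simp add: upper_def wt_def)

text \<open>Column operations by upper triangular matrices clear the entries to the right of a nonzero
  diagonal entry, one row at a time; a zero diagonal entry is reached along a line.\<close>
lemma semi_invariant_zero_if_zero_on_lower_unitriangular:
  fixes F :: "(nat \<times> nat \<Rightarrow> 'k::field) \<Rightarrow> 'k"
  assumes inf: "infinite (UNIV :: 'k set)" and F: "semi_invariant n \<mu> F"
    and zero: "\<And>u. lower_unitriangular n u \<Longrightarrow> F u = 0"
  shows "F X = 0"
proof -
  define Z where "Z k A \<longleftrightarrow> (\<forall>i<k. A (i, i) = 1 \<and> (\<forall>j<n. i < j \<longrightarrow> A (i, j) = 0))"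
    for k and A :: "nat \<times> nat \<Rightarrow> 'k"
  have poly: "polynomial_on (square n) F" using F by (simp add: semi_invariant_def)
  have main: "\<forall>A. Z k A \<longrightarrow> F A = 0" if "k \<le> n" for k
    using that
  proof (induction rule: inc_induct)
    case base
    show ?case using zero unfolding Z_def lower_unitriangular_def by blast
  next
    case (step k)
    have nz: "F A = 0" if Z: "Z k A" and a: "A (k, k) \<noteq> 0" for A
    proof -
      define b where "b = (\<lambda>(i, j). if i = k then (if j = k then 1 / A (k, k)
        else if k < j then - A (k, j) / A (k, k) else 0) else if i = j then 1 else 0)"
      have up: "upper n b" using a by (auto simp: upper_def b_def)
      have Ab: "mmul n A b (i, j) = (if j = k then A (i, k) / A (k, k)
          else if k < j then A (i, j) - A (i, k) * A (k, j) / A (k, k) else A (i, j))"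
        if "i < n" "j < n" for i j
      proof -
        have "mmul n A b (i, j) = (\<Sum>l<n. (if l = k then A (i, k) * b (k, j) else 0) +
            (if l = j \<and> j \<noteq> k then A (i, j) else 0))"
          unfolding mmul_def prod.case by (intro sum.cong) (auto simp: b_def)
        also have "\<dots> = A (i, k) * b (k, j) + (if j \<noteq> k then A (i, j) else 0)"
          using \<open>k < n\<close> that by (cases "j = k") (simp_all add: sum.distrib)
        finally show ?thesis using a by (auto simp: b_def)
      qed
      have "Z (Suc k) (mmul n A b)"
        using Z a \<open>k < n\<close> unfolding Z_def by (auto simp: Ab less_Suc_eq)
      then have "F (mmul n A b) = 0" using step.IH by blast
      moreover have "F (mmul n A b) = wt n \<mu> b * F A"
        using F up by (simp add: semi_invariant_def)
      ultimately show ?thesis using wt_nonzero[OF up] by simp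
    qed
    show ?case
    proof (intro allI impI)
      fix A assume Z: "Z k A"
      show "F A = 0"
      proof (cases "A (k, k) = 0")
        case True
        define C where "C i = (if i = (k, k) then [:0, 1:] else [:A i:])" for i
        have "F (\<lambda>i. poly (C i) t) = 0" if "t \<notin> {0}" for t
        proof (rule nz)
          show "Z k (\<lambda>i. poly (C i) t)" using Z by (auto simp: Z_def C_def)
          show "poly (C (k, k)) t \<noteq> 0" using that by (simp add: C_def)
        qed
        then have "F (\<lambda>i. poly (C i) 0) = 0"
          by (rule polynomial_on_curve_zero[OF inf poly finite.insertI[OF finite.emptyI]])
        moreover have "(\<lambda>i. poly (C i) 0) = A" using True by (auto simp: C_def fun_eq_iff)
        ultimately show ?thesis by simp
      qed (rule nz[OF Z])
    qed
  qed
  have "Z 0 X" by (simp add: Z_def)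
  then show ?thesis using main[of 0] by blast
qed

lemma monomial_square: "monomial (square n) m X = (\<Prod>a<n. \<Prod>b<n. X (a, b) ^ m (a, b))"
  unfolding monomial_def by (simp add: prod.cartesian_product)

lemma semi_invariant_column_degree:
  fixes F :: "(nat \<times> nat \<Rightarrow> 'k::field) \<Rightarrow> 'k"
  assumes inf: "infinite (UNIV :: 'k set)" and F: "semi_invariant n \<mu> F"
    and h: "expansion (square n) h F" and m: "h m \<noteq> 0" and b: "b < n"
  shows "(\<Sum>a<n. m (a, b)) = \<mu> (Suc b)"
proof (rule infinite_field_power_eq[OF inf])
  fix t :: 'k assume "t \<noteq> 0"
  define d where "d = (\<lambda>(i, j). if i = j then if i = b then t else 1 else 0 :: 'k)"
  have up: "upper n d" using \<open>t \<noteq> 0\<close> by (auto simp: upper_def d_def)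
  have wt: "wt n \<mu> d = t ^ \<mu> (Suc b)"
  proof -
    have "wt n \<mu> d = (\<Prod>i<n. if i = b then t ^ \<mu> (Suc b) else 1)"
      unfolding wt_def d_def by (intro prod.cong) auto
    then show ?thesis using b by simp
  qed
  have Xd: "mmul n X d (i, j) = X (i, j) * (if j = b then t else 1)" if "i < n" "j < n" for X i j
  proof -
    have "mmul n X d (i, j) = (\<Sum>l<n. if l = j then X (i, j) * (if j = b then t else 1) else 0)"
      unfolding mmul_def prod.case by (intro sum.cong) (auto simp: d_def)
    then show ?thesis using that by simp
  qed
  let ?s = "\<lambda>i. if snd i = b then t else 1"
  have "F (\<lambda>i. ?s i * X i) = t ^ \<mu> (Suc b) * F X" for X
  proof -
    have "F (\<lambda>i. ?s i * X i) = F (mmul n X d)"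
      by (rule semi_invariant_cong[OF F]) (simp add: Xd mult.commute)
    then show ?thesis using F up wt by (simp add: semi_invariant_def)
  qed
  then have "monomial (square n) m ?s = t ^ \<mu> (Suc b)"
    by (rule expansion_scaling[OF inf _ h _ m, rotated]) simp
  moreover have "monomial (square n) m ?s = (\<Prod>a<n. t ^ m (a, b))"
    unfolding monomial_square
  proof (intro prod.cong refl)
    fix a
    have "(\<Prod>c<n. (if snd (a, c) = b then t else 1) ^ m (a, c)) =
        (\<Prod>c<n. if c = b then t ^ m (a, b) else 1)"
      by (intro prod.cong) auto
    then show "(\<Prod>c<n. (if snd (a, c) = b then t else 1) ^ m (a, c)) = t ^ m (a, b)"
      using b by simp
  qed
  ultimately show "t ^ (\<Sum>a<n. m (a, b)) = t ^ \<mu> (Suc b)" by (simp add: power_sum)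
qed

text \<open>The weights are so far apart that the weighted sum compares sequences lexicographically.\<close>
lemma lex_le_if_weighted_sum_le:
  fixes x y :: "nat \<Rightarrow> nat"
  assumes le: "(\<Sum>a<n. x a * B ^ (n - a)) \<le> (\<Sum>a<n. y a * B ^ (n - a))"
    and B: "\<And>a. a < n \<Longrightarrow> y a < B" and c: "c < n" and eq: "\<And>a. a < c \<Longrightarrow> y a = x a"
  shows "x c \<le> y c"
proof (rule ccontr)
  assume "\<not> x c \<le> y c"
  then have lt: "Suc (y c) \<le> x c" by simp
  have tail: "(\<Sum>a\<in>{d..<n}. y a * B ^ (n - a)) < B ^ (Suc n - d)" if "d \<le> n" for d
    using that
  proof (induction rule: inc_induct)
    case base
    then show ?case using B[OF c] by simp
  next
    case (step d)
    have "(\<Sum>a\<in>{d..<n}. y a * B ^ (n - a)) = y d * B ^ (n - d) + (\<Sum>a\<in>{Suc d..<n}. y a * B ^ (n - a))"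
      using step by (simp add: sum.atLeast_Suc_lessThan)
    also have "\<dots> < y d * B ^ (n - d) + B ^ (n - d)" using step by simp
    also have "\<dots> = Suc (y d) * B ^ (n - d)" by simp
    also have "\<dots> \<le> B * B ^ (n - d)" using B[of d] step by (intro mult_right_mono) auto
    finally show ?case using step by (simp add: Suc_diff_le)
  qed
  have split: "(\<Sum>a<n. f a) = (\<Sum>a<c. f a) + f c + (\<Sum>a\<in>{Suc c..<n}. f a)" for f :: "nat \<Rightarrow> nat"
  proof -
    have "(\<Sum>a<n. f a) = (\<Sum>a\<in>{0..<c}. f a) + (\<Sum>a\<in>{c..<n}. f a)"
      using c by (simp add: sum.atLeastLessThan_concat lessThan_atLeast0)
    then show ?thesis using c by (simp add: sum.atLeast_Suc_lessThan lessThan_atLeast0)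
  qed
  have "Suc (y c) * B ^ (n - c) \<le> x c * B ^ (n - c)" using lt by (rule mult_right_mono) simp
  moreover have "(\<Sum>a<c. x a * B ^ (n - a)) = (\<Sum>a<c. y a * B ^ (n - a))"
    using eq by (intro sum.cong) auto
  moreover have "(\<Sum>a\<in>{Suc c..<n}. y a * B ^ (n - a)) < B ^ (n - c)"
    using tail[of "Suc c"] c by simp
  ultimately show False
    using le unfolding split[of "\<lambda>a. x a * B ^ (n - a)"] split[of "\<lambda>a. y a * B ^ (n - a)"] by simp
qed

section \<open>Lowest monomials of semi-invariants\<close>

text \<open>A weight whose minimum selects lowest monomials: columns further to the right are more expensive,
  and earlier rows outweigh later ones, as \<open>B\<close> exceeds all degrees that occur. The
  main diagonal of a minor is its cheapest term.\<close>
definition cost :: "nat \<Rightarrow> nat \<Rightarrow> (nat \<times> nat \<Rightarrow> nat) \<Rightarrow> nat" where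
  "cost n B m = (\<Sum>a<n. (\<Sum>b<n. m (a, b) * b) * B ^ (n - a))"

text \<open>Freeze the entries outside the columns \<open>b\<close> and \<open>b + 1\<close> and the total degree of these
  two columns in each row. The corresponding part of \<open>F\<close> is a polynomial in the quotients of the
  entries of the two columns, and adding a multiple of column \<open>b\<close> to column \<open>b + 1\<close>
  translates all these quotients. The cost orders the exponents of the quotients
  lexicographically.\<close>
lemma min_cost_semistandard:
  fixes F :: "(nat \<times> nat \<Rightarrow> 'k::field) \<Rightarrow> 'k"
  assumes inf: "infinite (UNIV :: 'k set)" and F: "semi_invariant n \<mu> F"
    and h: "expansion (square n) h F" and m0: "h m0 \<noteq> 0"
    and B: "\<And>i. \<mu> i < B"
    and min: "\<And>m. h m \<noteq> 0 \<Longrightarrow> cost n B m0 \<le> cost n B m"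
    and b: "Suc b < n" and c: "c < n"
  shows "(\<Sum>a\<le>c. m0 (a, Suc b)) \<le> (\<Sum>a<c. m0 (a, b))"
proof -
  define e where "e a = m0 (a, b) + m0 (a, Suc b)" for a
  \<comment> \<open>The class of \<open>m0\<close> under \<open>\<kappa>\<close> is parametrized by the exponents \<open>v\<close> in column \<open>b + 1\<close>.\<close>
  define rec where "rec v = (\<lambda>(a, j). if j = b then e a - v a else if j = Suc b then v a else m0 (a, j))"
    for v :: "nat \<Rightarrow> nat"
  define V where "V = {v. (\<forall>a. v a \<le> e a) \<and> h (rec v) \<noteq> 0}"
  define v0 where "v0 a = m0 (a, Suc b)" for a
  define \<kappa> where "\<kappa> m = (\<lambda>(a, j). if j = b then m (a, b) + m (a, Suc b) else if j = Suc b then 0 else m (a, j))"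
    for m :: "nat \<times> nat \<Rightarrow> nat"
  let ?S = "{m. h m \<noteq> 0}"
  have finS: "finite ?S" and supp: "\<And>m i. h m \<noteq> 0 \<Longrightarrow> i \<notin> square n \<Longrightarrow> m i = 0"
    using h unfolding expansion_def by blast+
  have e0: "e a = 0" if "n \<le> a" for a using supp[OF m0, of "(a, b)"] supp[OF m0, of "(a, Suc b)"] that
    by (auto simp: e_def)
  have recv: "rec v (a, Suc b) = v a" for v a by (simp add: rec_def)
  have inj: "inj rec" by (rule injI) (metis recv ext)
  have finV: "finite V"
  proof (rule finite_imageD)
    show "finite (rec ` V)" by (rule finite_subset[OF _ finS]) (auto simp: V_def)
  qed (rule inj_on_subset[OF inj subset_UNIV])
  have rec0: "rec v0 = m0" by (auto simp: rec_def v0_def e_def fun_eq_iff)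
  have v0V: "v0 \<in> V" using m0 by (simp add: V_def rec0) (simp add: v0_def e_def)
  have recV: "{m \<in> ?S. \<forall>i\<in>square n. \<kappa> m i = \<kappa> m0 i} = rec ` V"
  proof (rule Set.set_eqI, rule iffI)
    fix m assume m: "m \<in> {m \<in> ?S. \<forall>i\<in>square n. \<kappa> m i = \<kappa> m0 i}"
    have \<kappa>: "\<kappa> m i = \<kappa> m0 i" for i
    proof (cases "i \<in> square n")
      case False
      have "\<kappa> m' i = 0" if "h m' \<noteq> 0" for m'
        using False b supp[OF that] by (cases i) (auto simp: \<kappa>_def)
      then show ?thesis using m m0 by simp
    qed (use m in auto)
    have s: "m (a, b) + m (a, Suc b) = e a" for a using \<kappa>[of "(a, b)"] by (simp add: \<kappa>_def e_def)
    have o: "m (a, j) = m0 (a, j)" if "j \<noteq> b" "j \<noteq> Suc b" for a j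
      using \<kappa>[of "(a, j)"] that by (simp add: \<kappa>_def)
    have eq: "m = rec (\<lambda>a. m (a, Suc b))"
      using o by (auto simp: rec_def fun_eq_iff s[symmetric])
    have "m (a, Suc b) \<le> e a" for a using s[of a] by simp
    moreover have "h (rec (\<lambda>a. m (a, Suc b))) \<noteq> 0" using m eq by simp
    ultimately have "(\<lambda>a. m (a, Suc b)) \<in> V" by (simp add: V_def)
    then show "m \<in> rec ` V" by (subst eq) (rule imageI)
  next
    fix m assume "m \<in> rec ` V"
    then obtain v where v: "v \<in> V" "m = rec v" by blast
    have "\<kappa> m i = \<kappa> m0 i" for i
      using v by (cases i) (auto simp: V_def \<kappa>_def rec_def e_def)
    then show "m \<in> {m \<in> ?S. \<forall>i\<in>square n. \<kappa> m i = \<kappa> m0 i}" using v by (auto simp: V_def)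
  qed
  have inv: "(\<Sum>v\<in>V. h (rec v) * (\<Prod>a<n. (z a + s) ^ v a)) =
      (\<Sum>v\<in>V. h (rec v) * (\<Prod>a<n. z a ^ v a))" for z s
  proof -
    \<comment> \<open>\<open>z\<close> holds the quotients of the entries of the two columns.\<close>
    define X where "X z T = (\<lambda>(a, j). if j = Suc b then T (a, b) * z a else T (a, j))"
      for z :: "nat \<Rightarrow> 'k" and T :: "nat \<times> nat \<Rightarrow> 'k"
    define d where "d = (\<lambda>(i, j). if i = j then 1 else if i = b \<and> j = Suc b then s else 0)"
    have up: "upper n d" by (auto simp: upper_def d_def)
    have wt: "wt n \<mu> d = 1" by (simp add: wt_def d_def)
    have Xd: "mmul n (X z T) d (i, j) = X (\<lambda>a. z a + s) T (i, j)" if "i < n" "j < n" for z T i j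
    proof -
      have "mmul n (X z T) d (i, j) = (\<Sum>l<n. (if l = j then X z T (i, j) else 0) +
          (if l = b then if j = Suc b then X z T (i, b) * s else 0 else 0))"
        unfolding mmul_def prod.case by (intro sum.cong) (auto simp: d_def)
      also have "\<dots> = X z T (i, j) + (if j = Suc b then X z T (i, b) * s else 0)"
        using that b by (simp add: sum.distrib)
      finally show ?thesis by (auto simp: X_def algebra_simps)
    qed
    have FX: "F (X (\<lambda>a. z a + s) T) = F (X z T)" for T
    proof -
      have "F (mmul n (X z T) d) = F (X (\<lambda>a. z a + s) T)"
        by (rule semi_invariant_cong[OF F]) (rule Xd)
      then show ?thesis using F up wt by (simp add: semi_invariant_def)
    qed
    have monomial: "monomial (square n) m (X z T) = monomial (square n) (\<kappa> m) T * (\<Prod>a<n. z a ^ m (a, Suc b))" for m z T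
      unfolding monomial_square prod.distrib[symmetric]
    proof (intro prod.cong refl)
      fix a assume "a \<in> {..<n}"
      have "(\<Prod>j<n. X z T (a, j) ^ m (a, j)) =
          (\<Prod>j<n. T (a, j) ^ (if j = b \<or> j = Suc b then 0 else m (a, j)) *
            ((if j = b then T (a, b) ^ m (a, b) else 1) *
             (if j = Suc b then (T (a, b) * z a) ^ m (a, Suc b) else 1)))"
        by (intro prod.cong) (auto simp: X_def)
      moreover have "(\<Prod>j<n. T (a, j) ^ \<kappa> m (a, j)) =
          (\<Prod>j<n. T (a, j) ^ (if j = b \<or> j = Suc b then 0 else m (a, j)) *
            (if j = b then T (a, b) ^ (m (a, b) + m (a, Suc b)) else 1))"
        by (intro prod.cong) (auto simp: \<kappa>_def)
      ultimately show "(\<Prod>j<n. X z T (a, j) ^ m (a, j)) =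
          (\<Prod>j<n. T (a, j) ^ \<kappa> m (a, j)) * z a ^ m (a, Suc b)"
        using b by (simp add: prod.distrib power_add power_mult_distrib)
    qed
    define q where "q z m = (\<Prod>a<n. z a ^ m (a, Suc b))" for z :: "nat \<Rightarrow> 'k" and m :: "nat \<times> nat \<Rightarrow> nat"
    have "(\<Sum>m\<in>?S. (h m * (q (\<lambda>a. z a + s) m - q z m)) * monomial (square n) (\<kappa> m) T) = 0" for T
    proof -
      have FXm: "F (X z' T) = (\<Sum>m\<in>?S. h m * q z' m * monomial (square n) (\<kappa> m) T)" for z'
        using h unfolding expansion_def q_def by (simp add: monomial mult_ac)
      show ?thesis using FX[of T] unfolding FXm
        by (simp add: algebra_simps sum_subtractf)
    qed
    then have "(\<Sum>m \<in> {m\<in>?S. \<forall>i\<in>square n. \<kappa> m i = \<kappa> m0 i}. h m * (q (\<lambda>a. z a + s) m - q z m)) = 0"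
      by (intro monomial_linear_independent[OF inf]) (auto intro: finS)
    then have "(\<Sum>v\<in>V. h (rec v) * (q (\<lambda>a. z a + s) (rec v) - q z (rec v))) = 0"
      unfolding recV sum.reindex[OF inj_on_subset[OF inj subset_UNIV]] comp_def .
    then show ?thesis by (simp add: q_def recv algebra_simps sum_subtractf)
  qed
  have "(\<Sum>a\<le>c. v0 a) \<le> (\<Sum>a<c. e a - v0 a)"
  proof (rule translation_invariant_lexmin_exponent[OF inf finV, where h = "\<lambda>v. h (rec v)" and n = n])
    show "h (rec v) \<noteq> 0" if "v \<in> V" for v using that by (simp add: V_def)
    show "v a \<le> e a" if "v \<in> V" for v a using that by (simp add: V_def)
    show "v a = 0" if "v \<in> V" "n \<le> a" for v a
      using that e0[of a] by (auto simp: V_def) (metis le_zero_eq)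
    show "v0 c \<le> v c" if v: "v \<in> V" and "c < n" and eq: "\<And>a. a < c \<Longrightarrow> v a = v0 a" for v c
    proof (rule lex_le_if_weighted_sum_le[where n = n and B = B and x = v0 and y = v])
      have h': "h (rec v) \<noteq> 0" and le: "\<And>a. v a \<le> e a" using v by (auto simp: V_def)
      have row: "(\<Sum>j<n. rec v (a, j) * j) + v0 a = (\<Sum>j<n. m0 (a, j) * j) + v a" for a
      proof -
        have "(\<Sum>j<n. rec v (a, j) * j) + (\<Sum>j<n. if j = b then b * m0 (a, b) else if j = Suc b then Suc b * m0 (a, Suc b) else 0)
          = (\<Sum>j<n. m0 (a, j) * j) + (\<Sum>j<n. if j = b then b * (e a - v a) else if j = Suc b then Suc b * v a else 0)"
          unfolding sum.distrib[symmetric] by (intro sum.cong) (auto simp: rec_def)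
        moreover have two: "(\<Sum>j<n. if j = b then x else if j = Suc b then y else 0) = x + y" for x y :: nat
        proof -
          have "(\<Sum>j<n. if j = b then x else if j = Suc b then y else 0) =
              (\<Sum>j<n. (if j = b then x else 0) + (if j = Suc b then y else 0))"
            by (intro sum.cong) auto
          then show ?thesis using b by (simp add: sum.distrib)
        qed
        moreover have "b * (e a - v a) + b * v a = b * m0 (a, b) + b * m0 (a, Suc b)"
          using le[of a] by (simp add: e_def add_mult_distrib2[symmetric])
        ultimately show ?thesis unfolding two by (simp add: v0_def)
      qed
      have "cost n B (rec v) + (\<Sum>a<n. v0 a * B ^ (n - a)) = cost n B m0 + (\<Sum>a<n. v a * B ^ (n - a))"
        unfolding cost_def sum.distrib[symmetric] add_mult_distrib[symmetric] row ..
      then show "(\<Sum>a<n. v0 a * B ^ (n - a)) \<le> (\<Sum>a<n. v a * B ^ (n - a))"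
        using min[OF h'] by simp
      show "v a < B" if "a < n" for a
      proof -
        have "rec v (a, Suc b) \<le> (\<Sum>a<n. rec v (a, Suc b))"
          using that by (intro member_le_sum) auto
        also have "\<dots> = \<mu> (Suc (Suc b))"
          by (rule semi_invariant_column_degree[OF inf F h h' b])
        finally show ?thesis using B[of "Suc (Suc b)"] by (simp add: recv)
      qed
    qed (use that in auto)
  qed (use inv v0V c in auto)
  then show ?thesis by (simp add: v0_def e_def)
qed

section \<open>Semistandard fillings\<close>

text \<open>The \<open>j\<close>-th smallest element of the multiset in which \<open>a\<close> has multiplicity
  \<open>k a\<close>.\<close>
definition entry :: "(nat \<Rightarrow> nat) \<Rightarrow> nat \<Rightarrow> nat" where
  "entry k j = (LEAST a. j \<le> (\<Sum>i\<le>a. k i))"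

lemma entry_eq_iff:
  assumes "1 \<le> j" and "j \<le> (\<Sum>i<n. k i)"
  shows "entry k j = a \<longleftrightarrow> (\<Sum>i<a. k i) < j \<and> j \<le> (\<Sum>i\<le>a. k i)"
proof -
  have "n \<noteq> 0" using assms by (cases n) auto
  then have ex: "j \<le> (\<Sum>i\<le>n - 1. k i)"
    using assms(2) by (cases n) (simp_all add: lessThan_Suc_atMost)
  have le: "j \<le> (\<Sum>i\<le>entry k j. k i)" unfolding entry_def by (rule LeastI[where P = "\<lambda>a. j \<le> (\<Sum>i\<le>a. k i)", OF ex])
  have lt: "(\<Sum>i<entry k j. k i) < j"
  proof (cases "entry k j")
    case 0 then show ?thesis using assms(1) by simp
  next
    case (Suc a)
    then have "\<not> j \<le> (\<Sum>i\<le>a. k i)" using not_less_Least[of a "\<lambda>a. j \<le> (\<Sum>i\<le>a. k i)"]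
      by (simp add: entry_def)
    then show ?thesis using Suc by (simp add: lessThan_Suc_atMost)
  qed
  have uniq: "a' \<le> a" if "(\<Sum>i<a'. k i) < j" "j \<le> (\<Sum>i\<le>a. k i)" for a a'
  proof (rule ccontr)
    assume "\<not> a' \<le> a"
    then have "(\<Sum>i\<le>a. k i) \<le> (\<Sum>i<a'. k i)" by (intro sum_mono2) auto
    then show False using that by simp
  qed
  show ?thesis
  proof
    assume "(\<Sum>i<a. k i) < j \<and> j \<le> (\<Sum>i\<le>a. k i)"
    then show "entry k j = a" using uniq[OF lt, of a] uniq[OF _ le, of a] by simp
  qed (use le lt in auto)
qed

lemma entry_less:
  assumes "1 \<le> j" and "j \<le> (\<Sum>i<n. k i)"
  shows "entry k j < n"
proof (rule ccontr)
  assume "\<not> entry k j < n"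
  then have "(\<Sum>i<n. k i) \<le> (\<Sum>i<entry k j. k i)" by (intro sum_mono2) auto
  then show False using entry_eq_iff[OF assms, of "entry k j"] assms(2) by simp
qed

lemma card_entry:
  assumes "a < n"
  shows "card {j \<in> {1..\<Sum>i<n. k i}. entry k j = a} = k a"
proof -
  have le: "(\<Sum>i\<le>a. k i) \<le> (\<Sum>i<n. k i)" using assms by (intro sum_mono2) auto
  have "{j \<in> {1..\<Sum>i<n. k i}. entry k j = a} = {(\<Sum>i<a. k i)<..(\<Sum>i\<le>a. k i)}"
  proof (rule Set.set_eqI, rule iffI)
    fix j assume "j \<in> {j \<in> {1..\<Sum>i<n. k i}. entry k j = a}"
    then show "j \<in> {(\<Sum>i<a. k i)<..(\<Sum>i\<le>a. k i)}" using entry_eq_iff[of j k n a] by simp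
  next
    fix j assume "j \<in> {(\<Sum>i<a. k i)<..(\<Sum>i\<le>a. k i)}"
    then have "1 \<le> j" "j \<le> (\<Sum>i<n. k i)" "(\<Sum>i<a. k i) < j" "j \<le> (\<Sum>i\<le>a. k i)"
      using le by auto
    then show "j \<in> {j \<in> {1..\<Sum>i<n. k i}. entry k j = a}" using entry_eq_iff[of j k n a] by simp
  qed
  then show ?thesis by (simp add: lessThan_Suc_atMost[symmetric])
qed

text \<open>The tableau with weakly increasing rows in which row \<open>b + 1\<close> contains \<open>m (a, b)\<close> entries
  \<open>a\<close>.\<close>
definition filling :: "(nat \<Rightarrow> nat) \<Rightarrow> (nat \<times> nat \<Rightarrow> nat) \<Rightarrow> cell \<Rightarrow> nat" where
  "filling \<mu> m =
    (\<lambda>c. if c \<in> diagram \<mu> then entry (\<lambda>a. m (a, fst c - 1)) (snd c) else undefined)"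

definition column_sums :: "nat \<Rightarrow> (nat \<Rightarrow> nat) \<Rightarrow> (nat \<times> nat \<Rightarrow> nat) \<Rightarrow> bool" where
  "column_sums n \<mu> m \<longleftrightarrow> (\<forall>b<n. (\<Sum>a<n. m (a, b)) = \<mu> (Suc b))"

lemma diagram_cell:
  assumes "\<mu> \<in> sequences n" and "column_sums n \<mu> m" and "c \<in> diagram \<mu>"
  shows "1 \<le> snd c" and "snd c \<le> (\<Sum>a<n. m (a, fst c - 1))"
proof -
  have "(\<Sum>a<n. m (a, fst c - 1)) = \<mu> (Suc (fst c - 1))"
    using assms(2) diagram_row_bounds[OF assms(1,3)] by (simp add: column_sums_def)
  then show "1 \<le> snd c" and "snd c \<le> (\<Sum>a<n. m (a, fst c - 1))"
    using assms(3) by (auto simp: diagram_def)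
qed

lemma filling_in_words:
  assumes "\<mu> \<in> sequences n" and "column_sums n \<mu> m"
  shows "filling \<mu> m \<in> words n (diagram \<mu>)"
  using entry_less[OF diagram_cell[OF assms]] by (auto simp: words_def filling_def)

text \<open>The exponents of the product of the variables \<open>X (w c, f c)\<close> over all cells.\<close>
definition word_exponents :: "cell set \<Rightarrow> (cell \<Rightarrow> nat) \<Rightarrow> (cell \<Rightarrow> nat) \<Rightarrow> nat \<times> nat \<Rightarrow> nat" where
  "word_exponents D w f = (\<lambda>i. card {c \<in> D. (w c, f c) = i})"

lemma word_exponents_filling:
  assumes "\<mu> \<in> sequences n" and "column_sums n \<mu> m" and supp: "\<And>i. i \<notin> square n \<Longrightarrow> m i = 0"
  shows "word_exponents (diagram \<mu>) (filling \<mu> m) (\<lambda>c. fst c - 1) = m"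
proof
  fix i :: "nat \<times> nat"
  obtain a b where i: "i = (a, b)" by fastforce
  show "word_exponents (diagram \<mu>) (filling \<mu> m) (\<lambda>c. fst c - 1) i = m i"
  proof (cases "i \<in> square n")
    case True
    then have ab: "a < n" "b < n" using i by auto
    have cs: "\<mu> (Suc b) = (\<Sum>a<n. m (a, b))" using assms(2) ab by (simp add: column_sums_def)
    have "{c \<in> diagram \<mu>. (filling \<mu> m c, fst c - 1) = i} =
        Pair (Suc b) ` {j \<in> {1..\<mu> (Suc b)}. entry (\<lambda>a. m (a, b)) j = a}"
      unfolding i by (force simp: filling_def diagram_def)
    then show ?thesis
      using card_entry[OF ab(1), of "\<lambda>a. m (a, b)"]
      by (simp add: word_exponents_def card_image inj_on_def cs i)
  next
    case False
    have emp: "{c \<in> diagram \<mu>. (filling \<mu> m c, fst c - 1) = i} = {}"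
    proof -
      have "(filling \<mu> m c, fst c - 1) \<in> square n" if "c \<in> diagram \<mu>" for c
        using words_less[OF filling_in_words[OF assms(1,2)] that] diagram_row_bounds[OF assms(1) that] by simp
      then show ?thesis using False by blast
    qed
    show ?thesis unfolding word_exponents_def emp using supp[OF False] by simp
  qed
qed

text \<open>In terms of the tableau: the number of entries up to \<open>c\<close> in a row is at most the number of
  entries below \<open>c\<close> in the row above it.\<close>
definition semistandard :: "nat \<Rightarrow> (nat \<times> nat \<Rightarrow> nat) \<Rightarrow> bool" where
  "semistandard n m \<longleftrightarrow>
    (\<forall>b c. Suc b < n \<longrightarrow> c < n \<longrightarrow> (\<Sum>a\<le>c. m (a, Suc b)) \<le> (\<Sum>a<c. m (a, b)))"

lemma filling_column_strict:
  assumes \<mu>: "\<mu> \<in> partitions n" and cs: "column_sums n \<mu> m" and ss: "semistandard n m"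
    and D: "(i, j) \<in> diagram \<mu>" "(i', j) \<in> diagram \<mu>" and "i < i'"
  shows "filling \<mu> m (i, j) < filling \<mu> m (i', j)"
  using \<open>i < i'\<close> D(2)
proof (induction i' rule: less_induct)
  case (less i')
  note seq = partitions_sequences[OF \<mu>]
  obtain k where k: "i' = Suc k" "i \<le> k" using less.prems(1) by (cases i') auto
  have "1 \<le> i" using diagram_row_bounds[OF seq D(1)] by simp
  then have "1 \<le> k" using k by simp
  have Dk: "(k, j) \<in> diagram \<mu>"
    using less.prems(2) k \<open>1 \<le> k\<close> partitions_antimono[OF \<mu> \<open>1 \<le> k\<close>, of i'] by (auto simp: diagram_def)
  have step: "filling \<mu> m (k, j) < filling \<mu> m (i', j)"
  proof -
    define a where "a = filling \<mu> m (i', j)"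
    have "a < n" unfolding a_def by (rule words_less[OF filling_in_words[OF seq cs] less.prems(2)])
    have bnd: "1 \<le> j" "j \<le> (\<Sum>a<n. m (a, k))"
      using diagram_cell[OF seq cs less.prems(2)] k by simp_all
    have "entry (\<lambda>a. m (a, k)) j = a" using less.prems(2) k by (simp add: a_def filling_def)
    then have "j \<le> (\<Sum>i\<le>a. m (i, k))" using entry_eq_iff[OF bnd] by blast
    also have "\<dots> \<le> (\<Sum>i<a. m (i, k - 1))"
    proof -
      have Suc: "Suc (k - 1) = k" using \<open>1 \<le> k\<close> by simp
      moreover have "k < n" using diagram_row_bounds(2)[OF seq less.prems(2)] k by simp
      ultimately have "(\<Sum>i\<le>a. m (i, Suc (k - 1))) \<le> (\<Sum>i<a. m (i, k - 1))"
        using ss \<open>a < n\<close> unfolding semistandard_def by metis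
      then show ?thesis by (simp only: Suc)
    qed
    finally have j: "j \<le> (\<Sum>i<a. m (i, k - 1))" .
    then obtain a' where a': "a = Suc a'" using bnd(1) by (cases a) auto
    have "entry (\<lambda>a. m (a, k - 1)) j \<le> a'"
      unfolding entry_def by (rule Least_le) (use j a' in \<open>simp add: lessThan_Suc_atMost\<close>)
    then show ?thesis using Dk a' by (simp add: a_def[symmetric]) (simp add: filling_def)
  qed
  show ?case
  proof (cases "i = k")
    case False
    then show ?thesis using less.IH[of k] k Dk step by simp
  qed (use step in simp)
qed

lemma word_exponents_sum:
  assumes "finite D" and "\<And>c. c \<in> D \<Longrightarrow> (w c, f c) \<in> square n"
  shows "(\<Sum>i\<in>square n. word_exponents D w f i * g i) = (\<Sum>c\<in>D. g (w c, f c) :: nat)"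
proof -
  have "(\<Sum>c\<in>D. g (w c, f c)) = (\<Sum>i\<in>square n. \<Sum>c\<in>{c\<in>D. (w c, f c) = i}. g (w c, f c))"
    using assms by (intro sum.group[symmetric]) auto
  also have "\<dots> = (\<Sum>i\<in>square n. word_exponents D w f i * g i)"
    by (intro sum.cong) (auto simp: word_exponents_def)
  finally show ?thesis by simp
qed

lemma word_exponents_monomial:
  assumes "finite D" and "\<And>c. c \<in> D \<Longrightarrow> (w c, f c) \<in> square n"
  shows "monomial (square n) (word_exponents D w f) X = (\<Prod>c\<in>D. X (w c, f c))"
proof -
  have "(\<Prod>c\<in>D. X (w c, f c)) = (\<Prod>i\<in>square n. \<Prod>c\<in>{c\<in>D. (w c, f c) = i}. X (w c, f c))"
    using assms by (intro prod.group[symmetric]) auto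
  also have "\<dots> = monomial (square n) (word_exponents D w f) X"
    unfolding monomial_def by (intro prod.cong) (auto simp: word_exponents_def)
  finally show ?thesis by simp
qed

lemma cost_word_exponents:
  assumes "finite D" and "\<And>c. c \<in> D \<Longrightarrow> (w c, f c) \<in> square n"
  shows "cost n B (word_exponents D w f) = (\<Sum>c\<in>D. f c * B ^ (n - w c))"
proof -
  have "cost n B (word_exponents D w f) =
      (\<Sum>i\<in>square n. word_exponents D w f i * (snd i * B ^ (n - fst i)))"
    by (simp add: cost_def sum.cartesian_product sum_distrib_right mult.assoc case_prod_unfold)
  then show ?thesis by (simp add: word_exponents_sum[OF assms, where g = "\<lambda>i. snd i * B ^ (n - fst i)"])
qed

lemma col_stab_id_if_rows_le:
  assumes "finite (diagram \<mu>)" and "\<sigma> \<in> col_stab \<mu>"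
    and le: "\<And>c. c \<in> diagram \<mu> \<Longrightarrow> fst (\<sigma> c) \<le> fst c"
  shows "\<sigma> = id"
proof
  fix c
  note p = col_stabD(1)[OF assms(2)]
  show "\<sigma> c = id c"
  proof (cases "c \<in> diagram \<mu>")
    case True
    have "(\<Sum>c\<in>diagram \<mu>. fst c) = (\<Sum>c\<in>diagram \<mu>. fst (\<sigma> c))"
      by (rule sum.permute[OF p, unfolded comp_def])
    then have "\<forall>c\<in>diagram \<mu>. fst (\<sigma> c) = fst c"
      using sum_mono_inv[of "\<lambda>c. fst (\<sigma> c)" "diagram \<mu>" fst] le assms(1) by simp
    then show ?thesis using True col_stabD(2)[OF assms(2), of c] by (simp add: prod_eq_iff)
  qed (simp add: permutes_not_in[OF p])
qed

text \<open>The sums of \<open>g\<close> down the columns form a concave potential \<open>\<Phi>\<close>, whose increments lie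
  below the tangents. A permutation does not change the sum of \<open>\<Phi>\<close>, and the inequality is
  strict at a cell that moves down.\<close>
lemma column_rearrangement:
  fixes g :: "cell \<Rightarrow> nat"
  assumes \<mu>: "\<mu> \<in> partitions n" and \<sigma>: "\<sigma> \<in> col_stab \<mu>" and "\<sigma> \<noteq> id"
    and g: "\<And>i i' j. (i, j) \<in> diagram \<mu> \<Longrightarrow> (i', j) \<in> diagram \<mu> \<Longrightarrow> i < i' \<Longrightarrow> g (i', j) < g (i, j)"
  shows "(\<Sum>c\<in>diagram \<mu>. fst c * g c) < (\<Sum>c\<in>diagram \<mu>. fst (\<sigma> c) * g c)"
proof -
  let ?D = "diagram \<mu>"
  note seq = partitions_sequences[OF \<mu>] and p = col_stabD(1)[OF \<sigma>]
  have fin: "finite ?D" by (rule finite_diagram[OF seq])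
  define \<Phi> where "\<Phi> c = (\<Sum>k\<in>{1..fst c}. int (g (k, snd c)))" for c
  have col: "(k, j) \<in> ?D" if "(i, j) \<in> ?D" "1 \<le> k" "k \<le> i" for i j k
    using that partitions_antimono[OF \<mu>, of k i] by (auto simp: diagram_def)
  have up: "\<Phi> (i', j) - \<Phi> (i, j) < int (g (i, j)) * (int i' - int i)"
    if "(i, j) \<in> ?D" "(i', j) \<in> ?D" "i < i'" for i i' j
  proof -
    have "{1..i'} = {1..i} \<union> {i<..i'}" using that by auto
    then have "\<Phi> (i', j) = (\<Sum>k\<in>{1..i} \<union> {i<..i'}. int (g (k, j)))" by (simp add: \<Phi>_def)
    also have "\<dots> = \<Phi> (i, j) + (\<Sum>k\<in>{i<..i'}. int (g (k, j)))"
      unfolding \<Phi>_def fst_conv snd_conv by (rule sum.union_disjoint) auto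
    also have "(\<Sum>k\<in>{i<..i'}. int (g (k, j))) < (\<Sum>k\<in>{i<..i'}. int (g (i, j)))"
    proof (rule sum_strict_mono)
      fix k assume k: "k \<in> {i<..i'}"
      then have "(k, j) \<in> ?D" by (intro col[OF that(2)]) auto
      then show "int (g (k, j)) < int (g (i, j))" using g[OF that(1)] k by simp
    qed (use that in auto)
    finally show ?thesis using that(3) by (simp add: of_nat_diff mult.commute)
  qed
  have down: "\<Phi> (i', j) - \<Phi> (i, j) \<le> int (g (i, j)) * (int i' - int i)"
    if "(i, j) \<in> ?D" "(i', j) \<in> ?D" "i' \<le> i" for i i' j
  proof -
    have "{1..i} = {1..i'} \<union> {i'<..i}" using that by auto
    then have "\<Phi> (i, j) = (\<Sum>k\<in>{1..i'} \<union> {i'<..i}. int (g (k, j)))" by (simp add: \<Phi>_def)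
    also have "\<dots> = \<Phi> (i', j) + (\<Sum>k\<in>{i'<..i}. int (g (k, j)))"
      unfolding \<Phi>_def fst_conv snd_conv by (rule sum.union_disjoint) auto
    finally have "\<Phi> (i, j) = \<Phi> (i', j) + (\<Sum>k\<in>{i'<..i}. int (g (k, j)))" .
    moreover have "(\<Sum>k\<in>{i'<..i}. int (g (i, j))) \<le> (\<Sum>k\<in>{i'<..i}. int (g (k, j)))"
    proof (rule sum_mono)
      fix k assume k: "k \<in> {i'<..i}"
      then have "(k, j) \<in> ?D" by (intro col[OF that(1)]) auto
      then show "int (g (i, j)) \<le> int (g (k, j))"
        using g[of k j i] that(1) k by (cases "k = i") (auto simp: less_imp_le)
    qed
    ultimately show ?thesis using that(3) by (simp add: of_nat_diff algebra_simps)
  qed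
  have \<sigma>c: "\<sigma> c = (fst (\<sigma> c), snd c)" for c using col_stabD(2)[OF \<sigma>, of c] by (simp add: prod_eq_iff)
  have inD: "(fst (\<sigma> c), snd c) \<in> ?D" if "c \<in> ?D" for c
    using permutes_in_image[OF p, of c] that \<sigma>c[of c] by simp
  have "\<exists>c\<in>?D. fst c < fst (\<sigma> c)"
    using col_stab_id_if_rows_le[OF fin \<sigma>] \<open>\<sigma> \<noteq> id\<close> not_le_imp_less by blast
  moreover have "\<Phi> (\<sigma> c) - \<Phi> c \<le> int (g c) * (int (fst (\<sigma> c)) - int (fst c))" if "c \<in> ?D" for c
    using up[of "fst c" "snd c" "fst (\<sigma> c)"] down[of "fst c" "snd c" "fst (\<sigma> c)"] inD[OF that] that
    by (subst \<sigma>c) (cases "fst c < fst (\<sigma> c)"; simp)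
  moreover have "\<Phi> (\<sigma> c) - \<Phi> c < int (g c) * (int (fst (\<sigma> c)) - int (fst c))"
    if "c \<in> ?D" "fst c < fst (\<sigma> c)" for c
    using up[of "fst c" "snd c" "fst (\<sigma> c)"] inD[OF that(1)] that by (subst \<sigma>c) simp
  ultimately have "(\<Sum>c\<in>?D. \<Phi> (\<sigma> c) - \<Phi> c) < (\<Sum>c\<in>?D. int (g c) * (int (fst (\<sigma> c)) - int (fst c)))"
    by (intro sum_strict_mono_ex1[OF fin]) blast+
  moreover have "(\<Sum>c\<in>?D. \<Phi> c) = (\<Sum>c\<in>?D. \<Phi> (\<sigma> c))"
    by (rule sum.permute[OF p, unfolded comp_def])
  ultimately have "int (\<Sum>c\<in>?D. fst c * g c) < int (\<Sum>c\<in>?D. fst (\<sigma> c) * g c)"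
    by (simp add: sum_subtractf algebra_simps)
  then show ?thesis by (simp only: of_nat_less_iff)
qed

section \<open>Semi-invariants are combinations of bideterminants\<close>

lemma word_cells_in_square:
  assumes "\<mu> \<in> sequences n" and "w \<in> words n (diagram \<mu>)" and "\<sigma> \<in> col_stab \<mu>" and "c \<in> diagram \<mu>"
  shows "(w c, fst (\<sigma> c) - 1) \<in> square n"
proof -
  have "\<sigma> c \<in> diagram \<mu>" using permutes_in_image[OF col_stabD(1)[OF assms(3)], of c] assms(4) by simp
  then show ?thesis using diagram_row_bounds(3)[OF assms(1)] words_less[OF assms(2,4)] by simp
qed

definition bidet_coeffs :: "(nat \<Rightarrow> nat) \<Rightarrow> (cell \<Rightarrow> nat) \<Rightarrow> (nat \<times> nat \<Rightarrow> nat) \<Rightarrow> 'k::field" where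
  "bidet_coeffs \<mu> w m = (\<Sum>\<sigma>\<in>col_stab \<mu>.
     if m = word_exponents (diagram \<mu>) w (\<lambda>c. fst (\<sigma> c) - 1) then of_int (sign \<sigma>) else 0)"

lemma expansion_bidet:
  assumes "\<mu> \<in> sequences n" and "w \<in> words n (diagram \<mu>)"
  shows "expansion (square n) (bidet_coeffs \<mu> w) (bidet \<mu> w :: (nat \<times> nat \<Rightarrow> 'k::field) \<Rightarrow> 'k)"
proof -
  let ?e = "\<lambda>\<sigma>. word_exponents (diagram \<mu>) w (\<lambda>c. fst (\<sigma> c) - 1)"
  have fin: "finite (diagram \<mu>)" by (rule finite_diagram[OF assms(1)])
  have "bidet \<mu> w X = (\<Sum>\<sigma>\<in>col_stab \<mu>. of_int (sign \<sigma>) * monomial (square n) (?e \<sigma>) X)" for X :: "nat \<times> nat \<Rightarrow> 'k"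
    unfolding bidet_alt[OF fin]
  proof (intro sum.cong refl)
    fix \<sigma> assume \<sigma>: "\<sigma> \<in> col_stab \<mu>"
    show "of_int (sign \<sigma>) * (\<Prod>c\<in>diagram \<mu>. X (w c, fst (\<sigma> c) - 1)) =
        of_int (sign \<sigma>) * monomial (square n) (?e \<sigma>) X"
      by (simp only: word_exponents_monomial[OF fin word_cells_in_square[OF assms \<sigma>]])
  qed
  then have eq: "bidet \<mu> w = (\<lambda>X :: nat \<times> nat \<Rightarrow> 'k.
      \<Sum>\<sigma>\<in>col_stab \<mu>. of_int (sign \<sigma>) * monomial (square n) (?e \<sigma>) X)" by (rule ext)
  have "bidet_coeffs \<mu> w = (\<lambda>m. \<Sum>\<sigma>\<in>col_stab \<mu>. if m = ?e \<sigma> then of_int (sign \<sigma>) else 0 :: 'k)"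
    by (simp add: bidet_coeffs_def fun_eq_iff)
  moreover have "expansion (square n)
      (\<lambda>m. \<Sum>\<sigma>\<in>col_stab \<mu>. if m = ?e \<sigma> then of_int (sign \<sigma>) else 0 :: 'k) (bidet \<mu> w)"
    unfolding eq
  proof (intro expansion_sum expansion_monomial)
    fix \<sigma> i assume "\<sigma> \<in> col_stab \<mu>" "i \<notin> square n"
    then have emp: "{c \<in> diagram \<mu>. (w c, fst (\<sigma> c) - 1) = i} = {}"
      using word_cells_in_square[OF assms \<open>\<sigma> \<in> _\<close>] by blast
    show "?e \<sigma> i = 0" unfolding word_exponents_def emp by simp
  qed
  ultimately show ?thesis by simp
qed

text \<open>The rearrangement inequality makes the identity the only cheapest term of the bideterminant.\<close>
lemma bidet_coeffs_filling:
  assumes \<mu>: "\<mu> \<in> partitions n" and cs: "column_sums n \<mu> m" and ss: "semistandard n m"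
    and supp: "\<And>i. i \<notin> square n \<Longrightarrow> m i = 0" and "2 \<le> B"
    and le: "cost n B m' \<le> cost n B m"
  shows "bidet_coeffs \<mu> (filling \<mu> m) m' = (if m' = m then 1 else 0 :: 'k::field)"
proof -
  let ?w = "filling \<mu> m"
  let ?e = "\<lambda>\<sigma>. word_exponents (diagram \<mu>) ?w (\<lambda>c. fst (\<sigma> c) - 1)"
  note seq = partitions_sequences[OF \<mu>]
  have fin: "finite (diagram \<mu>)" by (rule finite_diagram[OF seq])
  note w = filling_in_words[OF seq cs]
  have e_id: "?e id = m" using word_exponents_filling[OF seq cs supp] by simp
  have pos: "1 \<le> fst (\<sigma> c)" if "\<sigma> \<in> col_stab \<mu>" "c \<in> diagram \<mu>" for \<sigma> c
    using that(2) permutes_in_image[OF col_stabD(1)[OF that(1)], of c]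
    by (intro diagram_row_bounds(1)[OF seq]) simp
  have cost: "cost n B (?e \<sigma>) + (\<Sum>c\<in>diagram \<mu>. B ^ (n - ?w c)) =
      (\<Sum>c\<in>diagram \<mu>. fst (\<sigma> c) * B ^ (n - ?w c))" if "\<sigma> \<in> col_stab \<mu>" for \<sigma>
  proof -
    have eq: "cost n B (?e \<sigma>) = (\<Sum>c\<in>diagram \<mu>. (fst (\<sigma> c) - 1) * B ^ (n - ?w c))"
      by (rule cost_word_exponents[OF fin word_cells_in_square[OF seq w that]])
    show ?thesis
      unfolding eq sum.distrib[symmetric]
    proof (intro sum.cong refl)
      fix c assume "c \<in> diagram \<mu>"
      then show "(fst (\<sigma> c) - 1) * B ^ (n - ?w c) + B ^ (n - ?w c) = fst (\<sigma> c) * B ^ (n - ?w c)"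
        using pos[OF that, of c] by (cases "fst (\<sigma> c)") simp_all
    qed
  qed
  have "?e \<sigma> \<noteq> m'" if \<sigma>: "\<sigma> \<in> col_stab \<mu>" and "\<sigma> \<noteq> id" for \<sigma>
  proof -
    have "(\<Sum>c\<in>diagram \<mu>. fst c * B ^ (n - ?w c)) < (\<Sum>c\<in>diagram \<mu>. fst (\<sigma> c) * B ^ (n - ?w c))"
    proof (rule column_rearrangement[OF \<mu> that, where g = "\<lambda>c. B ^ (n - ?w c)"])
      fix i i' j assume D: "(i, j) \<in> diagram \<mu>" "(i', j) \<in> diagram \<mu>" "i < i'"
      have "?w (i, j) < ?w (i', j)" by (rule filling_column_strict[OF \<mu> cs ss D])
      moreover have "?w (i', j) < n" by (rule words_less[OF w D(2)])
      ultimately show "B ^ (n - ?w (i', j)) < B ^ (n - ?w (i, j))"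
        using \<open>2 \<le> B\<close> by (intro power_strict_increasing) auto
    qed
    then have "cost n B m < cost n B (?e \<sigma>)"
      using cost[OF \<sigma>] cost[OF col_stab_id, unfolded e_id, unfolded id_apply] by linarith
    then show ?thesis using le by auto
  qed
  then have "bidet_coeffs \<mu> ?w m' = (\<Sum>\<sigma>\<in>col_stab \<mu>. if \<sigma> = id then if m' = m then 1 else 0 else 0 :: 'k)"
    unfolding bidet_coeffs_def
  proof (intro sum.cong refl)
    fix \<sigma> assume \<sigma>: "\<sigma> \<in> col_stab \<mu>" and ne: "\<And>\<sigma>. \<sigma> \<in> col_stab \<mu> \<Longrightarrow> \<sigma> \<noteq> id \<Longrightarrow> ?e \<sigma> \<noteq> m'"
    show "(if m' = ?e \<sigma> then of_int (sign \<sigma>) else 0) = (if \<sigma> = id then if m' = m then 1 else 0 else 0 :: 'k)"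
    proof (cases "\<sigma> = id")
      case True
      show ?thesis unfolding True e_id by (simp add: sign_id)
    next
      case False
      then show ?thesis using ne[OF \<sigma> False] by auto
    qed
  qed
  then show ?thesis using finite_col_stab[OF fin] col_stab_id by simp
qed

definition bidet_span :: "nat \<Rightarrow> (nat \<Rightarrow> nat) \<Rightarrow> ((nat \<times> nat \<Rightarrow> 'k::field) \<Rightarrow> 'k) set" where
  "bidet_span n \<mu> = {F. \<exists>c. \<forall>X. F X = (\<Sum>w\<in>words n (diagram \<mu>). c w * bidet \<mu> w X)}"

lemma bidet_span_0: "(\<lambda>X. 0) \<in> bidet_span n \<mu>"
  unfolding bidet_span_def by (rule CollectI, rule exI[of _ "\<lambda>_. 0"]) simp

lemma bidet_span_add:
  assumes "F \<in> bidet_span n \<mu>" and "F' \<in> bidet_span n \<mu>"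
  shows "(\<lambda>X. F X + F' X) \<in> bidet_span n \<mu>"
proof -
  obtain c c' where "\<And>X. F X = (\<Sum>w\<in>words n (diagram \<mu>). c w * bidet \<mu> w X)"
    "\<And>X. F' X = (\<Sum>w\<in>words n (diagram \<mu>). c' w * bidet \<mu> w X)"
    using assms unfolding bidet_span_def by blast
  then have *: "F X + F' X = (\<Sum>w\<in>words n (diagram \<mu>). (c w + c' w) * bidet \<mu> w X)" for X
    by (simp add: sum.distrib distrib_right)
  show ?thesis
    unfolding bidet_span_def by (intro CollectI exI[of _ "\<lambda>w. c w + c' w"] allI) (rule *)
qed

lemma bidet_span_scale:
  assumes "F \<in> bidet_span n \<mu>"
  shows "(\<lambda>X. a * F X) \<in> bidet_span n \<mu>"
proof -
  obtain c where "\<And>X. F X = (\<Sum>w\<in>words n (diagram \<mu>). c w * bidet \<mu> w X)"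
    using assms unfolding bidet_span_def by blast
  then have *: "a * F X = (\<Sum>w\<in>words n (diagram \<mu>). (a * c w) * bidet \<mu> w X)" for X
    by (simp add: sum_distrib_left mult.assoc)
  show ?thesis
    unfolding bidet_span_def by (intro CollectI exI[of _ "\<lambda>w. a * c w"] allI) (rule *)
qed

lemma bidet_span_sum:
  "(\<And>j. j \<in> J \<Longrightarrow> F j \<in> bidet_span n \<mu>) \<Longrightarrow> (\<lambda>X. \<Sum>j\<in>J. F j X) \<in> bidet_span n \<mu>"
  by (induction J rule: infinite_finite_induct) (auto intro: bidet_span_0 bidet_span_add)

lemma bidet_in_bidet_span:
  assumes "finite (diagram \<mu>)" and "w \<in> words n (diagram \<mu>)"
  shows "bidet \<mu> w \<in> bidet_span n \<mu>"
proof -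
  have "(\<Sum>u\<in>words n (diagram \<mu>). (if u = w then 1 else 0) * bidet \<mu> u X) =
      (\<Sum>u\<in>words n (diagram \<mu>). if u = w then bidet \<mu> w X else 0)" for X :: "nat \<times> nat \<Rightarrow> 'a"
    by (intro sum.cong) auto
  then have *: "bidet \<mu> w X = (\<Sum>u\<in>words n (diagram \<mu>). (if u = w then 1 else 0) * bidet \<mu> u X)" for X :: "nat \<times> nat \<Rightarrow> 'a"
    using assms(2) finite_words[OF assms(1), of n] by simp
  show ?thesis
    unfolding bidet_span_def by (intro CollectI exI[of _ "\<lambda>u. if u = w then 1 else 0"] allI) (rule *)
qed

lemma semi_invariant_add:
  "semi_invariant n \<mu> F \<Longrightarrow> semi_invariant n \<mu> F' \<Longrightarrow> semi_invariant n \<mu> (\<lambda>X. F X + F' X)"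
  by (simp add: semi_invariant_def polynomial_on_add distrib_left)

lemma semi_invariant_scale:
  "semi_invariant n \<mu> F \<Longrightarrow> semi_invariant n \<mu> (\<lambda>X. a * F X)"
  by (simp add: semi_invariant_def polynomial_on_scale mult.left_commute)

lemma semi_invariant_0: "semi_invariant n \<mu> (\<lambda>X. 0)"
  by (simp add: semi_invariant_def polynomial_on_0)

lemma semi_invariant_sum:
  "(\<And>j. j \<in> J \<Longrightarrow> semi_invariant n \<mu> (F j)) \<Longrightarrow> semi_invariant n \<mu> (\<lambda>X. \<Sum>j\<in>J. F j X)"
  by (induction J rule: infinite_finite_induct) (auto intro: semi_invariant_0 semi_invariant_add)

text \<open>Cheapest monomials are semistandard by \<open>min_cost_semistandard\<close>, and the bideterminants of the
  corresponding tableaux have exactly these as cheapest monomials. Subtracting them raises the minimal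
  cost, which is bounded because the column degrees are fixed.\<close>
theorem semi_invariant_in_bidet_span:
  fixes F :: "(nat \<times> nat \<Rightarrow> 'k::field) \<Rightarrow> 'k"
  assumes inf: "infinite (UNIV :: 'k set)" and \<mu>: "\<mu> \<in> partitions n" and F: "semi_invariant n \<mu> F"
  shows "F \<in> bidet_span n \<mu>"
proof -
  note seq = partitions_sequences[OF \<mu>]
  have fin: "finite (diagram \<mu>)" by (rule finite_diagram[OF seq])
  \<comment> \<open>Larger than all degrees, and at least \<open>2\<close> for the powers to be strictly increasing.\<close>
  define B where "B = 2 + (\<Sum>i\<in>{1..n}. \<mu> i)"
  have B: "\<mu> i < B" for i
  proof (cases "i \<in> {1..n}")
    case True
    then have "\<mu> i \<le> (\<Sum>i\<in>{1..n}. \<mu> i)" by (intro member_le_sum) auto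
    then show ?thesis by (simp add: B_def)
  next
    case False
    then show ?thesis using seq by (auto simp: sequences_def B_def)
  qed
  \<comment> \<open>A bound for the cost of all monomials with the column degrees of \<open>\<mu>\<close>.\<close>
  define M where "M = (\<Sum>a<n. (\<Sum>b<n. B * b) * B ^ (n - a))"
  have costM: "cost n B m \<le> M" if "column_sums n \<mu> m" for m
    unfolding cost_def M_def
  proof (intro sum_mono mult_right_mono)
    fix a b assume "a \<in> {..<n}" "b \<in> {..<n}"
    then have "m (a, b) \<le> (\<Sum>a<n. m (a, b))" by (intro member_le_sum) auto
    also have "\<dots> = \<mu> (Suc b)" using that \<open>b \<in> _\<close> by (simp add: column_sums_def)
    finally show "m (a, b) \<le> B" using B[of "Suc b"] by simp
  qed simp_all
  have main: "F \<in> bidet_span n \<mu>"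
    if "semi_invariant n \<mu> F" "expansion (square n) h F" "\<And>m. h m \<noteq> 0 \<Longrightarrow> M < cost n B m + N"
    for N and F :: "(nat \<times> nat \<Rightarrow> 'k) \<Rightarrow> 'k" and h
    using that
  proof (induction N arbitrary: F h)
    case 0
    have "h m = 0" for m
    proof (rule ccontr)
      assume m: "h m \<noteq> 0"
      have "column_sums n \<mu> m"
        using semi_invariant_column_degree[OF inf 0(1,2) m] by (simp add: column_sums_def)
      then show False using 0(3)[OF m] costM[of m] by simp
    qed
    then have "F = (\<lambda>X. 0)" using 0(2) by (simp add: expansion_def fun_eq_iff)
    then show ?case by (simp add: bidet_span_0)
  next
    case (Suc N)
    note F = Suc.prems(1) and h = Suc.prems(2)
    define S where "S = {m. h m \<noteq> 0 \<and> cost n B m + N = M}"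
    have S_h: "h m \<noteq> 0" if "m \<in> S" for m using that by (simp add: S_def)
    have cs: "column_sums n \<mu> m" if "m \<in> S" for m
      using semi_invariant_column_degree[OF inf F h S_h[OF that]] by (simp add: column_sums_def)
    have supp: "m i = 0" if "m \<in> S" "i \<notin> square n" for m i
      using h S_h[OF that(1)] that(2) unfolding expansion_def by blast
    have min: "cost n B m \<le> cost n B m'" if "m \<in> S" "h m' \<noteq> 0" for m m'
      using Suc.prems(3)[OF that(2)] that(1) by (simp add: S_def)
    have ss: "semistandard n m" if "m \<in> S" for m
      using min_cost_semistandard[OF inf F h S_h[OF that] B min[OF that]]
      unfolding semistandard_def by (intro allI impI)
    have finS: "finite S"
      by (rule finite_subset[of _ "{m. h m \<noteq> 0}"]) (use h in \<open>auto simp: S_def expansion_def\<close>)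
    note w = filling_in_words[OF seq cs]
    define G where "G X = (\<Sum>m\<in>S. h m * bidet \<mu> (filling \<mu> m) X)" for X :: "nat \<times> nat \<Rightarrow> 'k"
    define h' where "h' m' = h m' + (-1) * (\<Sum>m\<in>S. h m * bidet_coeffs \<mu> (filling \<mu> m) m')" for m'
    have semiG: "semi_invariant n \<mu> G"
      unfolding G_def by (intro semi_invariant_sum semi_invariant_scale semi_invariant_bidet[OF \<mu>] w)
    have G: "G \<in> bidet_span n \<mu>"
      unfolding G_def by (intro bidet_span_sum bidet_span_scale bidet_in_bidet_span[OF fin] w)
    have "(\<lambda>X. F X + (-1) * G X) \<in> bidet_span n \<mu>"
    proof (rule Suc.IH)
      show "semi_invariant n \<mu> (\<lambda>X. F X + (-1) * G X)"
        by (rule semi_invariant_add[OF F semi_invariant_scale[OF semiG]])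
      show "expansion (square n) h' (\<lambda>X. F X + (-1) * G X)"
        unfolding G_def h'_def
        by (intro expansion_add[OF h] expansion_scale expansion_sum expansion_bidet[OF seq] w)
      show "M < cost n B m' + N" if "h' m' \<noteq> 0" for m'
      proof (rule ccontr)
        assume "\<not> M < cost n B m' + N"
        then have le: "cost n B m' + N \<le> M" by simp
        have "(\<Sum>m\<in>S. h m * bidet_coeffs \<mu> (filling \<mu> m) m') = (\<Sum>m\<in>S. h m * (if m' = m then 1 else 0))"
        proof (intro sum.cong refl)
          fix m assume m: "m \<in> S"
          have "cost n B m' \<le> cost n B m" using le m by (simp add: S_def)
          moreover have "2 \<le> B" by (simp add: B_def)
          ultimately have "bidet_coeffs \<mu> (filling \<mu> m) m' = (if m' = m then 1 else 0 :: 'k)"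
            using bidet_coeffs_filling[OF \<mu> cs[OF m] ss[OF m] supp[OF m]] by blast
          then show "h m * bidet_coeffs \<mu> (filling \<mu> m) m' = h m * (if m' = m then 1 else 0)" by simp
        qed
        also have "\<dots> = (if m' \<in> S then h m' else 0)"
          using finS by (simp add: if_distrib cong: if_cong)
        finally have h'eq: "h' m' = (if m' \<in> S then 0 else h m')" by (simp add: h'_def)
        then have "m' \<notin> S" "h m' \<noteq> 0" using that by (auto split: if_splits)
        then show False using Suc.prems(3)[of m'] le by (simp add: S_def)
      qed
    qed
    from bidet_span_add[OF this G] show ?case by simp
  qed
  obtain h where h: "expansion (square n) h F"
    using F unfolding semi_invariant_def polynomial_on_def by blast
  show ?thesis by (rule main[OF F h, of "Suc M"]) simp
qed

section \<open>Weyl modules as spans\<close>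

interpretation tensor_space: vector_space "tensor_scale :: 'k::field \<Rightarrow> 'k tensor \<Rightarrow> 'k tensor"
  by unfold_locales (simp_all add: tensor_scale_def fun_eq_iff algebra_simps)

text \<open>The map is only required to be linear on the subspace, as for the restriction of functions that
  are defined on larger sets.\<close>
lemma dim_eq_if_linear_bij:
  assumes "vector_space s1" and "vector_space s2"
    and V1: "module.subspace s1 V1"
    and add: "\<And>x y. x \<in> V1 \<Longrightarrow> y \<in> V1 \<Longrightarrow> T (x + y) = T x + T y"
    and scale: "\<And>c x. x \<in> V1 \<Longrightarrow> T (s1 c x) = s2 c (T x)"
    and bij: "bij_betw T V1 V2"
  shows "vector_space.dim s1 V1 = vector_space.dim s2 V2"
proof -
  interpret vs1: vector_space s1 by fact
  interpret vs2: vector_space s2 by fact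
  interpret vp: vector_space_pair s1 s2 by unfold_locales
  obtain B where B: "B \<subseteq> V1" "vs1.independent B" "V1 \<subseteq> vs1.span B" "card B = vs1.dim V1"
    using vs1.basis_exists by blast
  have span: "vs1.span B = V1" using B(1,3) vs1.span_minimal[OF B(1) V1] by blast
  obtain g where g: "Vector_Spaces.linear s1 s2 g" and gB: "\<And>x. x \<in> B \<Longrightarrow> g x = T x"
    using vp.linear_independent_extend[OF B(2), of T] by blast
  interpret g: Vector_Spaces.linear s1 s2 g by fact
  have T0: "T 0 = 0" using scale[OF vs1.subspace_0[OF V1], of 0] by simp
  have gT: "g x = T x" if "x \<in> V1" for x
  proof -
    have "x \<in> V1 \<and> g x = T x"
      using \<open>x \<in> V1\<close>[folded span]
    proof (induction rule: vs1.span_induct_alt)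
      case base
      show ?case using vs1.subspace_0[OF V1] T0 g.zero by simp
    next
      case (step c x y)
      then have "x \<in> V1" using B(1) by blast
      then show ?case
        using step gB vs1.subspace_scale[OF V1, of x c] vs1.subspace_add[OF V1, of "s1 c x" y]
        by (simp add: g.add g.scale add scale)
    qed
    then show ?thesis by blast
  qed
  have inj: "inj_on g (vs1.span B)"
    unfolding span using bij gT by (simp add: bij_betw_def inj_on_def)
  have "vs2.independent (g ` B)" by (rule g.independent_injective_image[OF B(2) inj])
  moreover have "vs2.span (g ` B) = V2"
    unfolding g.span_image span using bij gT by (simp add: bij_betw_def cong: image_cong)
  moreover have "vs2.span V2 = V2"
    using \<open>vs2.span (g ` B) = V2\<close> vs2.span_span by metis
  ultimately have "vs2.dim V2 = card (g ` B)" using vs2.dim_eq_card by metis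
  also have "\<dots> = card B" by (rule card_image[OF inj_on_subset[OF inj vs1.span_superset]])
  finally show ?thesis using B(4) by simp
qed

lemma fun_sum_apply: "(\<Sum>j\<in>J. f j) x = (\<Sum>j\<in>J. f j x :: 'b::comm_monoid_add)"
  by (induction J rule: infinite_finite_induct) auto

lemma subspace_tensors: "tensor_space.subspace (tensors n D :: 'k::field tensor set)"
  by (auto simp: tensor_space.subspace_def tensors_def tensor_scale_def)

text \<open>A subspace of a space of finite dimension is the annihilator of its annihilator.\<close>
lemma in_span_if_annihilated:
  fixes x :: "'k::field tensor"
  assumes fin: "finite D" and Y: "Y \<subseteq> tensors n D" and x: "x \<in> tensors n D"
    and ann: "\<And>c. (\<And>y. y \<in> Y \<Longrightarrow> (\<Sum>w\<in>words n D. c w * y w) = 0) \<Longrightarrow> (\<Sum>w\<in>words n D. c w * x w) = 0"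
  shows "x \<in> tensor_space.span Y"
proof (rule ccontr)
  assume nx: "x \<notin> tensor_space.span Y"
  interpret kv: vector_space "(*) :: 'k \<Rightarrow> 'k \<Rightarrow> 'k"
    by unfold_locales (simp_all add: algebra_simps)
  interpret vp: vector_space_pair "tensor_scale :: 'k \<Rightarrow> _" "(*) :: 'k \<Rightarrow> 'k \<Rightarrow> 'k"
    by unfold_locales
  obtain B where B: "B \<subseteq> Y" "tensor_space.independent B" "Y \<subseteq> tensor_space.span B"
    using tensor_space.maximal_independent_subset by blast
  have "x \<notin> tensor_space.span B" using nx tensor_space.span_mono[OF B(1)] by blast
  then have "tensor_space.independent (insert x B)"
    by (rule tensor_space.independent_insertI[OF _ B(2)])
  then obtain \<phi> where \<phi>: "Vector_Spaces.linear tensor_scale (*) \<phi>"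
    and \<phi>v: "\<And>b. b \<in> insert x B \<Longrightarrow> \<phi> b = (if b = x then 1 else 0)"
    using vp.linear_independent_extend[of "insert x B" "\<lambda>b. if b = x then 1 else 0"] by blast
  interpret \<phi>: Vector_Spaces.linear tensor_scale "(*)" \<phi> by fact
  define \<delta> :: "(cell \<Rightarrow> nat) \<Rightarrow> 'k tensor" where "\<delta> u = (\<lambda>w. if w = u then 1 else 0)" for u
  have expand: "\<phi> t = (\<Sum>w\<in>words n D. \<phi> (\<delta> w) * t w)" if "t \<in> tensors n D" for t
  proof -
    have "t = (\<Sum>w\<in>words n D. tensor_scale (t w) (\<delta> w))"
    proof
      fix v
      show "t v = (\<Sum>w\<in>words n D. tensor_scale (t w) (\<delta> w)) v"
        using that finite_words[OF fin, of n]
        by (cases "v \<in> words n D") (simp_all add: fun_sum_apply tensor_scale_def \<delta>_def tensors_def if_distrib cong: if_cong)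
    qed
    then have "\<phi> t = \<phi> (\<Sum>w\<in>words n D. tensor_scale (t w) (\<delta> w))" by simp
    also have "\<dots> = (\<Sum>w\<in>words n D. \<phi> (\<delta> w) * t w)"
      by (simp add: \<phi>.sum \<phi>.scale mult.commute)
    finally show ?thesis .
  qed
  have "\<phi> y = 0" if "y \<in> Y" for y
  proof -
    have "y \<in> tensor_space.span B" using B(3) that by blast
    then show ?thesis
    proof (induction rule: tensor_space.span_induct_alt)
      case (step c b y)
      then have "b \<noteq> x" using \<open>x \<notin> tensor_space.span B\<close> tensor_space.span_base by blast
      then have "\<phi> b = 0" using step \<phi>v[of b] by simp
      then show ?case by (simp only: \<phi>.add \<phi>.scale step.IH) simp
    qed (rule \<phi>.zero)
  qed
  then have "(\<Sum>w\<in>words n D. \<phi> (\<delta> w) * x w) = 0"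
    using Y expand by (intro ann) (metis subsetD)
  then show False using expand[OF x] \<phi>v[of x] by simp
qed

lemma col_wedge_add: "col_wedge \<mu> (s + t) = col_wedge \<mu> s + col_wedge \<mu> t"
  by (simp add: col_wedge_def fun_eq_iff sum.distrib distrib_left)

lemma col_wedge_scale: "col_wedge \<mu> (tensor_scale c t) = tensor_scale c (col_wedge \<mu> t)"
  by (simp add: col_wedge_def fun_eq_iff tensor_scale_def sum_distrib_left mult.left_commute)

lemma col_wedge_0: "col_wedge \<mu> 0 = 0"
  by (simp add: col_wedge_def fun_eq_iff)

lemma subspace_row_divided_powers:
  "tensor_space.subspace (row_divided_powers n \<mu> :: 'k::field tensor set)"
  by (auto simp: tensor_space.subspace_def row_divided_powers_def tensors_def tensor_scale_def)

lemma subspace_weyl: "tensor_space.subspace (weyl n \<mu> :: 'k::field tensor set)"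
  unfolding tensor_space.subspace_def weyl_def
proof (intro conjI ballI allI)
  note sub = subspace_row_divided_powers[where ?'k = 'k, of n \<mu>]
  show "0 \<in> col_wedge \<mu> ` (row_divided_powers n \<mu> :: 'k tensor set)"
    using tensor_space.subspace_0[OF sub] col_wedge_0 by (metis image_eqI)
  show "x + y \<in> col_wedge \<mu> ` (row_divided_powers n \<mu> :: 'k tensor set)"
    if "x \<in> col_wedge \<mu> ` (row_divided_powers n \<mu>)" "y \<in> col_wedge \<mu> ` (row_divided_powers n \<mu>)"
    for x y :: "'k tensor"
    using that tensor_space.subspace_add[OF sub] col_wedge_add by (smt (verit) image_iff)
  show "tensor_scale c x \<in> col_wedge \<mu> ` (row_divided_powers n \<mu> :: 'k tensor set)"
    if "x \<in> col_wedge \<mu> ` (row_divided_powers n \<mu>)" for c and x :: "'k tensor"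
    using that tensor_space.subspace_scale[OF sub] col_wedge_scale by (smt (verit) image_iff)
qed

lemma words_outside: "w \<in> words n D \<Longrightarrow> c \<notin> D \<Longrightarrow> w c = undefined"
  unfolding words_def by (rule PiE_arb)

text \<open>The exponents count the occurrences of each letter in each row, and these determine the word up to
  permutations of the rows.\<close>
lemma row_stab_orbit:
  assumes \<mu>: "\<mu> \<in> sequences n" and w: "w \<in> words n (diagram \<mu>)" and w': "w' \<in> words n (diagram \<mu>)"
    and eq: "word_exponents (diagram \<mu>) w (\<lambda>c. fst c - 1) = word_exponents (diagram \<mu>) w' (\<lambda>c. fst c - 1)"
  shows "\<exists>\<sigma>\<in>row_stab \<mu>. w' = w \<circ> \<sigma>"
proof -
  let ?D = "diagram \<mu>"
  have fin: "finite ?D" by (rule finite_diagram[OF \<mu>])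
  have count: "count (image_mset (\<lambda>c. (w c, fst c - 1)) (mset_set ?D)) i =
      word_exponents ?D w (\<lambda>c. fst c - 1) i" for w i
  proof -
    have "{c \<in> ?D. (w c, fst c - 1) = i} = (\<lambda>c. (w c, fst c - 1)) -` {i} \<inter> ?D" by blast
    then show ?thesis using fin by (simp add: count_image_mset word_exponents_def)
  qed
  have "image_mset (\<lambda>c. (w' c, fst c - 1)) (mset_set ?D) = image_mset (\<lambda>c. (w c, fst c - 1)) (mset_set ?D)"
    by (rule multiset_eqI) (simp only: count eq)
  from image_mset_eq_implies_permutes[OF fin this] obtain p where
    p: "p permutes ?D" and pc: "\<forall>c\<in>?D. (w' c, fst c - 1) = (w (p c), fst (p c) - 1)" by blast
  have "fst (p c) = fst c" if "c \<in> ?D" for c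
  proof -
    have "p c \<in> ?D" using permutes_in_image[OF p, of c] that by simp
    then show ?thesis using diagram_row_bounds(1)[OF \<mu> that] diagram_row_bounds(1)[OF \<mu>, of "p c"] pc that
      by fastforce
  qed
  then have "p \<in> row_stab \<mu>" using p by (simp add: row_stab_def)
  moreover have "w' = w \<circ> p"
  proof
    fix c
    show "w' c = (w \<circ> p) c"
    proof (cases "c \<in> ?D")
      case False
      then show ?thesis
        using words_outside[OF w False] words_outside[OF w' False] permutes_not_in[OF p False] by simp
    qed (use pc in simp)
  qed
  ultimately show ?thesis by blast
qed

abbreviation row_tensor :: "(nat \<Rightarrow> nat) \<Rightarrow> 'k::field tensor" where
  "row_tensor \<mu> \<equiv> (\<lambda>w. if w = row_word \<mu> then 1 else 0)"

lemma act_row_tensor_in_row_divided_powers: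
  assumes "\<mu> \<in> sequences n"
  shows "act n (diagram \<mu>) X (row_tensor \<mu>) \<in> row_divided_powers n \<mu>"
  unfolding row_divided_powers_def
proof (intro CollectI conjI ballI)
  fix \<sigma> w assume \<sigma>: "\<sigma> \<in> row_stab \<mu>" and w: "w \<in> words n (diagram \<mu>)"
  have p: "\<sigma> permutes diagram \<mu>" using \<sigma> by (simp add: row_stab_def)
  have "(\<Prod>c\<in>diagram \<mu>. X (w c, fst c - 1)) = (\<Prod>c\<in>diagram \<mu>. X (w (\<sigma> c), fst (\<sigma> c) - 1))"
    by (rule prod.permute[OF p, unfolded comp_def])
  also have "\<dots> = (\<Prod>c\<in>diagram \<mu>. X ((w \<circ> \<sigma>) c, fst c - 1))"
    using \<sigma> by (intro prod.cong) (auto simp: row_stab_def)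
  finally show "act n (diagram \<mu>) X (row_tensor \<mu>) (w \<circ> \<sigma>) = act n (diagram \<mu>) X (row_tensor \<mu>) w"
    by (simp add: act_row_word[OF assms w] act_row_word[OF assms words_comp[OF w p]])
qed (rule act_in_tensors)

text \<open>A functional that vanishes on all translates is a polynomial function of the translating matrix
  that vanishes. Its coefficients are the sums of the functional over the orbits of the row
  stabilizer, and symmetric tensors are constant on these orbits.\<close>
lemma row_divided_powers_span:
  fixes t :: "'k::field tensor"
  assumes inf: "infinite (UNIV :: 'k set)" and \<mu>: "\<mu> \<in> sequences n" and t: "t \<in> row_divided_powers n \<mu>"
  shows "t \<in> tensor_space.span ((\<lambda>A. act n (diagram \<mu>) (($$) A) (row_tensor \<mu>)) ` GL n)"
proof (rule in_span_if_annihilated[OF finite_diagram[OF \<mu>]])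
  let ?D = "diagram \<mu>"
  have fin: "finite ?D" by (rule finite_diagram[OF \<mu>])
  show "t \<in> tensors n ?D" using t by (simp add: row_divided_powers_def)
  show "(\<lambda>A. act n ?D (($$) A) (row_tensor \<mu>)) ` GL n \<subseteq> tensors n ?D" using act_in_tensors by blast
  fix c :: "(cell \<Rightarrow> nat) \<Rightarrow> 'k"
  assume ann: "\<And>y. y \<in> (\<lambda>A. act n ?D (($$) A) (row_tensor \<mu>)) ` GL n \<Longrightarrow> (\<Sum>w\<in>words n ?D. c w * y w) = 0"
  let ?e = "\<lambda>w. word_exponents ?D w (\<lambda>c. fst c - 1)"
  have sq: "(w c, fst c - 1) \<in> square n" if "w \<in> words n ?D" "c \<in> ?D" for w c
    using words_less[OF that] diagram_row_bounds(3)[OF \<mu> that(2)] by simp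
  define F where "F X = (\<Sum>w\<in>words n ?D. c w * monomial (square n) (?e w) X)" for X :: "nat \<times> nat \<Rightarrow> 'k"
  have supp: "?e w i = 0" if "w \<in> words n ?D" "i \<notin> square n" for w i
  proof -
    have emp: "{c \<in> ?D. (w c, fst c - 1) = i} = {}" using sq that by blast
    show ?thesis unfolding word_exponents_def emp by simp
  qed
  have "polynomial_on (square n) F"
    unfolding F_def by (intro polynomial_on_sum polynomial_on_monomial supp)
  moreover have "F (($$) A) = 0" if "A \<in> GL n" for A
  proof -
    have "F (($$) A) = (\<Sum>w\<in>words n ?D. c w * act n ?D (($$) A) (row_tensor \<mu>) w)"
      unfolding F_def
    proof (intro sum.cong refl)
      fix w assume w: "w \<in> words n ?D"
      show "c w * monomial (square n) (?e w) (($$) A) = c w * act n ?D (($$) A) (row_tensor \<mu>) w"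
        by (simp only: act_row_word[OF \<mu> w]
            word_exponents_monomial[where w = w and f = "\<lambda>c. fst c - 1", OF fin sq[OF w]])
    qed
    also have "\<dots> = 0" using that by (intro ann) blast
    finally show ?thesis .
  qed
  ultimately have "F X = 0" for X by (rule polynomial_zero_if_zero_on_GL[OF inf])
  then have F0: "(\<Sum>w\<in>words n ?D. c w * monomial (square n) (?e w) X) = 0" for X by (simp add: F_def)
  have classes: "(\<Sum>w\<in>{w\<in>words n ?D. ?e w = m}. c w) = 0" if "m \<in> ?e ` words n ?D" for m
  proof -
    have "{w\<in>words n ?D. ?e w = m} = {w\<in>words n ?D. \<forall>i\<in>square n. ?e w i = m i}"
    proof -
      have "?e w = m" if "w \<in> words n ?D" "\<forall>i\<in>square n. ?e w i = m i" for w
      proof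
        fix i show "?e w i = m i"
          using that supp[OF that(1), of i] supp[of _ i] \<open>m \<in> _\<close> by (cases "i \<in> square n") auto
      qed
      then show ?thesis by blast
    qed
    then show ?thesis
      using monomial_linear_independent[OF inf _ finite_words[OF fin] F0, of m] by simp
  qed
  have const: "t w = t w'" if ww: "w \<in> words n ?D" "w' \<in> words n ?D" "?e w = ?e w'" for w w'
  proof -
    obtain \<sigma> where "\<sigma> \<in> row_stab \<mu>" "w' = w \<circ> \<sigma>" using row_stab_orbit[OF \<mu> ww] by blast
    then show ?thesis using t ww(1) unfolding row_divided_powers_def by simp
  qed
  have "(\<Sum>w\<in>words n ?D. c w * t w) =
      (\<Sum>m\<in>?e ` words n ?D. \<Sum>w\<in>{w\<in>words n ?D. ?e w = m}. c w * t w)"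
    by (rule sum.image_gen[OF finite_words[OF fin]])
  also have "\<dots> = 0"
  proof (rule sum.neutral, rule ballI)
    fix m assume m: "m \<in> ?e ` words n ?D"
    then obtain w0 where w0: "w0 \<in> words n ?D" "m = ?e w0" by blast
    have "(\<Sum>w\<in>{w\<in>words n ?D. ?e w = m}. c w * t w) = (\<Sum>w\<in>{w\<in>words n ?D. ?e w = m}. c w * t w0)"
    proof (intro sum.cong refl)
      fix w assume "w \<in> {w\<in>words n ?D. ?e w = m}"
      then have "t w = t w0" using w0 by (intro const) simp_all
      then show "c w * t w = c w * t w0" by simp
    qed
    then show "(\<Sum>w\<in>{w\<in>words n ?D. ?e w = m}. c w * t w) = 0"
      using classes[OF m] by (simp add: sum_distrib_right[symmetric])
  qed
  finally show "(\<Sum>w\<in>words n ?D. c w * t w) = 0" .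
qed

theorem weyl_eq_span:
  assumes inf: "infinite (UNIV :: 'k::field set)" and \<mu>: "\<mu> \<in> sequences n"
  shows "weyl n \<mu> = tensor_space.span ((\<lambda>A :: 'k mat. act n (diagram \<mu>) (($$) A) (hwv \<mu>)) ` GL n)"
    (is "_ = tensor_space.span ?Y")
proof (rule equalityI; rule subsetI)
  have hw: "act n (diagram \<mu>) X (hwv \<mu>) = col_wedge \<mu> (act n (diagram \<mu>) X (row_tensor \<mu>))"
    for X :: "nat \<times> nat \<Rightarrow> 'k"
    unfolding hwv_def by (rule col_wedge_act[OF finite_diagram[OF \<mu>], symmetric])
  fix x :: "'k tensor"
  assume "x \<in> tensor_space.span ?Y"
  moreover have "?Y \<subseteq> weyl n \<mu>"
    unfolding hw weyl_def using act_row_tensor_in_row_divided_powers[OF \<mu>] by blast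
  ultimately show "x \<in> weyl n \<mu>" using tensor_space.span_minimal[OF _ subspace_weyl] by blast
next
  have hw: "act n (diagram \<mu>) X (hwv \<mu>) = col_wedge \<mu> (act n (diagram \<mu>) X (row_tensor \<mu>))"
    for X :: "nat \<times> nat \<Rightarrow> 'k"
    unfolding hwv_def by (rule col_wedge_act[OF finite_diagram[OF \<mu>], symmetric])
  fix x :: "'k tensor"
  assume "x \<in> weyl n \<mu>"
  then obtain t :: "'k tensor" where t: "t \<in> row_divided_powers n \<mu>" "x = col_wedge \<mu> t"
    by (auto simp: weyl_def)
  have "col_wedge \<mu> t \<in> tensor_space.span ?Y"
    using row_divided_powers_span[OF inf \<mu> t(1)]
  proof (induction rule: tensor_space.span_induct_alt)
    case base
    show ?case unfolding col_wedge_0 by (rule tensor_space.span_zero)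
  next
    case (step c x y)
    then obtain A where A: "A \<in> GL n" "x = act n (diagram \<mu>) (($$) A) (row_tensor \<mu>)" by blast
    have "col_wedge \<mu> x \<in> ?Y" unfolding A(2) hw[symmetric] by (rule imageI) (rule A(1))
    then show ?case unfolding col_wedge_add col_wedge_scale
      by (intro tensor_space.span_add tensor_space.span_scale step.IH) (rule tensor_space.span_base)
  qed
  then show "x \<in> tensor_space.span ?Y" by (simp add: t)
qed

section \<open>Weyl modules as duals and their primitive vectors\<close>

lemma mmul_mat:
  assumes "A \<in> carrier_mat n n" and "B \<in> carrier_mat n n" and "i < n" and "j < n"
  shows "(A * B) $$ (i, j) = mmul n (($$) A) (($$) B) (i, j)"
  using assms by (simp add: mmul_def scalar_prod_def lessThan_atLeast0)

lemma GL_carrier: "A \<in> GL n \<Longrightarrow> A \<in> carrier_mat n n"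
  by (simp add: GL_def)

lemma GL_mult:
  assumes "A \<in> GL n" and "B \<in> GL n"
  shows "A * B \<in> GL n"
proof -
  have inverse: "\<exists>C'\<in>carrier_mat n n. C * C' = 1\<^sub>m n \<and> C' * C = 1\<^sub>m n" if CG: "C \<in> GL n" for C :: "'a mat"
  proof -
    have C: "C \<in> carrier_mat n n" using CG by (rule GL_carrier)
    obtain C' where C': "C * C' = 1\<^sub>m (dim_row C)" "C' * C = 1\<^sub>m (dim_row C')"
      using CG unfolding GL_def invertible_mat_def inverts_mat_def by blast
    have "dim_row (C' * C) = dim_col (C' * C)" "dim_row (C * C') = dim_col (C * C')"
      unfolding C' by simp_all
    then have "C' \<in> carrier_mat n n" using C by (intro carrier_matI) auto
    then show ?thesis using C C' by auto
  qed
  obtain A' where A': "A' \<in> carrier_mat n n" "A * A' = 1\<^sub>m n" "A' * A = 1\<^sub>m n" using inverse[OF assms(1)] by blast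
  obtain B' where B': "B' \<in> carrier_mat n n" "B * B' = 1\<^sub>m n" "B' * B = 1\<^sub>m n" using inverse[OF assms(2)] by blast
  note A = GL_carrier[OF assms(1)] and B = GL_carrier[OF assms(2)]
  have "(A * B) * (B' * A') = A * ((B * B') * A')"
    using A B A'(1) B'(1) by (simp add: assoc_mult_mat[of _ n n _ n _ n])
  then have 1: "(A * B) * (B' * A') = 1\<^sub>m n" using A'(1,2) B'(2) by simp
  have "(B' * A') * (A * B) = B' * ((A' * A) * B)"
    using A B A'(1) B'(1) by (simp add: assoc_mult_mat[of _ n n _ n _ n])
  then have 2: "(B' * A') * (A * B) = 1\<^sub>m n" using A'(3) B B'(3) by simp
  show ?thesis
    unfolding GL_def invertible_mat_def inverts_mat_def square_mat.simps
    using A B A'(1) B'(1) 1 2 by (intro CollectI conjI exI[of _ "B' * A'"]) auto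
qed

lemma one_in_GL: "1\<^sub>m n \<in> GL n"
  by (auto simp: GL_def invertible_mat_def inverts_mat_def intro: exI[of _ "1\<^sub>m n"])

lemma act_one:
  assumes "finite D" and "t \<in> tensors n D"
  shows "act n D (($$) (1\<^sub>m n)) t = t"
proof
  fix w
  show "act n D (($$) (1\<^sub>m n)) t w = t w"
  proof (cases "w \<in> words n D")
    case True
    have "(\<Prod>c\<in>D. 1\<^sub>m n $$ (w c, u c)) * t u = (if u = w then t w else 0)" if u: "u \<in> words n D" for u
    proof (cases "u = w")
      case True
      have "(\<Prod>c\<in>D. 1\<^sub>m n $$ (w c, u c)) = (\<Prod>c\<in>D. 1 :: 'a)"
        using words_less[OF \<open>w \<in> words n D\<close>] True by (intro prod.cong) auto
      then show ?thesis using True by simp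
    next
      case False
      then obtain c where "w c \<noteq> u c" by (metis ext)
      then have "c \<in> D" using words_outside[OF True] words_outside[OF u] by metis
      then have "1\<^sub>m n $$ (w c, u c) = (0 :: 'a)"
        using \<open>w c \<noteq> u c\<close> words_less[OF True] words_less[OF u] by simp
      then have "(\<Prod>c\<in>D. 1\<^sub>m n $$ (w c, u c)) = (0 :: 'a)" using assms(1) \<open>c \<in> D\<close> by (meson prod_zero)
      then show ?thesis using False by simp
    qed
    then have "act n D (($$) (1\<^sub>m n)) t w = (\<Sum>u\<in>words n D. if u = w then t w else 0)"
      using True unfolding act_def by (simp cong: sum.cong)
    then show ?thesis using True finite_words[OF assms(1), of n] by simp
  next
    case False
    then show ?thesis using assms(2) by (simp add: act_def tensors_def)
  qed
qed

lemma upper_mat_in_GL: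
  assumes "upper n b"
  shows "mat n n b \<in> GL n"
proof -
  have ut: "upper_triangular (mat n n b)" using assms by (auto simp: upper_def upper_triangular_def)
  have M: "mat n n b \<in> carrier_mat n n" by simp
  have "0 \<notin> set (diag_mat (mat n n b))" using assms by (auto simp: upper_def diag_mat_def)
  then have "det (mat n n b) \<noteq> 0"
    unfolding det_upper_triangular[OF ut M] by (simp add: prod_list_zero_iff)
  then show ?thesis using invertible_mat_if_det_nonzero[OF M] by (simp add: GL_def)
qed

lemma act_mat: "act n D (($$) (mat n n b)) t = act n D b t"
  by (rule act_cong) simp

lemma act_mult_mat:
  assumes "finite D" and "A \<in> carrier_mat n n" and "B \<in> carrier_mat n n"
  shows "act n D (($$) (A * B)) t = act n D (($$) A) (act n D (($$) B) t)"
  unfolding act_mmul[OF assms(1), symmetric]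
  by (rule act_cong) (rule mmul_mat[OF assms(2,3)])

lemma act_0: "act n D X 0 = 0"
  by (simp add: act_def fun_eq_iff)

text \<open>Vectors on which the upper triangular matrices act by the character \<open>lam\<close>. They are fixed
  by the unitriangular ones.\<close>
definition primitives :: "nat \<Rightarrow> (nat \<Rightarrow> nat) \<Rightarrow> (nat \<Rightarrow> nat) \<Rightarrow> 'k::field tensor set" where
  "primitives n \<mu> lam = {x \<in> weyl n \<mu>.
     \<forall>b. upper n b \<longrightarrow> act n (diagram \<mu>) b x = tensor_scale (wt n lam b) x}"

lemma subspace_primitives: "tensor_space.subspace (primitives n \<mu> lam :: 'k::field tensor set)"
  unfolding tensor_space.subspace_def primitives_def
proof (intro conjI ballI allI CollectI impI)
  note sub = subspace_weyl[where ?'k = 'k, of n \<mu>]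
  let ?P = "{x \<in> weyl n \<mu>. \<forall>b. upper n b \<longrightarrow> act n (diagram \<mu>) b x = tensor_scale (wt n lam b) x}"
  show "(0 :: 'k tensor) \<in> weyl n \<mu>" by (rule tensor_space.subspace_0[OF sub])
  show "act n (diagram \<mu>) b 0 = tensor_scale (wt n lam b) 0" for b :: "nat \<times> nat \<Rightarrow> 'k"
    unfolding act_0 by (simp add: tensor_scale_def fun_eq_iff)
  show "x + y \<in> weyl n \<mu>" if "x \<in> ?P" "y \<in> ?P" for x y :: "'k tensor"
    using that tensor_space.subspace_add[OF sub] by blast
  show "act n (diagram \<mu>) b (x + y) = tensor_scale (wt n lam b) (x + y)"
    if "x \<in> ?P" "y \<in> ?P" "upper n b" for x y :: "'k tensor" and b
    using that by (simp only: mem_Collect_eq act_add tensor_space.scale_right_distrib)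
  show "tensor_scale c x \<in> weyl n \<mu>" if "x \<in> ?P" for c and x :: "'k tensor"
    using that tensor_space.subspace_scale[OF sub] by blast
  show "act n (diagram \<mu>) b (tensor_scale c x) = tensor_scale (wt n lam b) (tensor_scale c x)"
    if "x \<in> ?P" "upper n b" for c b and x :: "'k tensor"
    using that by (simp only: mem_Collect_eq act_scale tensor_space.scale_left_commute)
qed

context
  fixes K :: "'k::field itself" and n :: nat
  assumes inf: "infinite (UNIV :: 'k set)"
begin

lemma act_hwv_in_weyl:
  assumes "\<mu> \<in> sequences n" and "A \<in> GL n"
  shows "act n (diagram \<mu>) (($$) A) (hwv \<mu> :: 'k tensor) \<in> weyl n \<mu>"
  unfolding weyl_eq_span[OF inf assms(1)] using assms(2) by (intro tensor_space.span_base imageI)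

lemma weyl_induct [consumes 2, case_names zero step]:
  assumes "\<mu> \<in> sequences n" and "x \<in> (weyl n \<mu> :: 'k tensor set)" and "P 0"
    and "\<And>c A y. A \<in> GL n \<Longrightarrow> y \<in> weyl n \<mu> \<Longrightarrow> P y \<Longrightarrow>
      P (tensor_scale c (act n (diagram \<mu>) (($$) A) (hwv \<mu>)) + y)"
  shows "P x"
proof -
  note sub = subspace_weyl[where ?'k = 'k, of n \<mu>]
  have "x \<in> weyl n \<mu> \<and> P x"
    using assms(2) unfolding weyl_eq_span[OF inf assms(1)]
  proof (induction rule: tensor_space.span_induct_alt)
    case base
    show ?case using assms(3) tensor_space.span_zero by blast
  next
    case (step c z y)
    then obtain A where A: "A \<in> GL n" "z = act n (diagram \<mu>) (($$) A) (hwv \<mu>)" by blast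
    have "y \<in> weyl n \<mu>" using step.IH unfolding weyl_eq_span[OF inf assms(1)] by blast
    then have "P (tensor_scale c z + y)" unfolding A(2) using A(1) step.IH by (intro assms(4)) blast+
    moreover have "tensor_scale c z + y \<in> weyl n \<mu>"
      using act_hwv_in_weyl[OF assms(1) A(1)] \<open>y \<in> weyl n \<mu>\<close> A(2)
        tensor_space.subspace_add[OF sub] tensor_space.subspace_scale[OF sub] by metis
    ultimately show ?case unfolding weyl_eq_span[OF inf assms(1)] by blast
  qed
  then show ?thesis by blast
qed

lemma weyl_subset_tensors:
  assumes "\<mu> \<in> sequences n"
  shows "(weyl n \<mu> :: 'k tensor set) \<subseteq> tensors n (diagram \<mu>)"
  unfolding weyl_eq_span[OF inf assms]
  by (intro tensor_space.span_minimal subspace_tensors) (use act_in_tensors in blast)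

lemma hwv_in_weyl:
  assumes "\<mu> \<in> sequences n"
  shows "(hwv \<mu> :: 'k tensor) \<in> weyl n \<mu>"
proof -
  have "hwv \<mu> w = 0" if w: "w \<notin> words n (diagram \<mu>)" for w
  proof -
    have "w \<circ> \<sigma> \<noteq> row_word \<mu>" if \<sigma>: "\<sigma> \<in> col_stab \<mu>" for \<sigma>
    proof
      assume "w \<circ> \<sigma> = row_word \<mu>"
      then have "(w \<circ> \<sigma>) \<circ> pinv \<sigma> \<in> words n (diagram \<mu>)"
        using row_word_in_words[OF assms] words_comp[OF _ col_stabD(1)[OF col_stab_inv[OF \<sigma>]]] by metis
      then show False using w permutes_inv_o(1)[OF col_stabD(1)[OF \<sigma>]] by (simp add: comp_assoc)
    qed
    then show ?thesis by (simp add: hwv_def col_wedge_def)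
  qed
  then have "(hwv \<mu> :: 'k tensor) \<in> tensors n (diagram \<mu>)" unfolding tensors_def by blast
  then show ?thesis
    using act_hwv_in_weyl[OF assms one_in_GL] act_one[OF finite_diagram[OF assms]] by metis
qed

lemma act_in_weyl:
  assumes \<mu>: "\<mu> \<in> sequences n" and "A \<in> GL n" and "x \<in> (weyl n \<mu> :: 'k tensor set)"
  shows "act n (diagram \<mu>) (($$) A) x \<in> weyl n \<mu>"
  using \<mu> assms(3)
proof (induction rule: weyl_induct)
  case zero
  show ?case unfolding act_0 by (rule tensor_space.subspace_0[OF subspace_weyl])
next
  case (step c B y)
  show ?case
    unfolding act_add act_scale
      act_mult_mat[OF finite_diagram[OF \<mu>] GL_carrier[OF assms(2)] GL_carrier[OF step(1)], symmetric]
    by (intro tensor_space.subspace_add[OF subspace_weyl] tensor_space.subspace_scale[OF subspace_weyl]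
        act_hwv_in_weyl[OF \<mu>] GL_mult assms(2) step)
qed

text \<open>Together with \<open>weylI\<close> this says that a Weyl module is the dual of the span of the
  bideterminants: \<open>x\<close> stands for the functional that takes the value \<open>x w\<close> on the
  bideterminant of \<open>w\<close>.\<close>
lemma weyl_annihilated:
  assumes \<mu>: "\<mu> \<in> sequences n" and "x \<in> (weyl n \<mu> :: 'k tensor set)"
    and c: "\<And>X. (\<Sum>w\<in>words n (diagram \<mu>). c w * bidet \<mu> w X) = 0"
  shows "(\<Sum>w\<in>words n (diagram \<mu>). c w * x w) = 0"
  using \<mu> assms(2)
proof (induction rule: weyl_induct)
  case (step a A y)
  have "(\<Sum>w\<in>words n (diagram \<mu>). c w * act n (diagram \<mu>) (($$) A) (hwv \<mu>) w) =
      (\<Sum>w\<in>words n (diagram \<mu>). c w * bidet \<mu> w (($$) A))"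
    by (intro sum.cong refl) (simp add: act_hwv[OF \<mu>])
  then have 0: "(\<Sum>w\<in>words n (diagram \<mu>). c w * act n (diagram \<mu>) (($$) A) (hwv \<mu>) w) = 0"
    using c by simp
  have "(\<Sum>w\<in>words n (diagram \<mu>). c w * (tensor_scale a (act n (diagram \<mu>) (($$) A) (hwv \<mu>)) + y) w) =
      a * (\<Sum>w\<in>words n (diagram \<mu>). c w * act n (diagram \<mu>) (($$) A) (hwv \<mu>) w) +
      (\<Sum>w\<in>words n (diagram \<mu>). c w * y w)"
    by (simp add: tensor_scale_def algebra_simps sum.distrib sum_distrib_left)
  then show ?case using 0 step by simp
qed simp

lemma weylI:
  assumes \<mu>: "\<mu> \<in> sequences n" and x: "x \<in> tensors n (diagram \<mu>)"
    and ann: "\<And>c. (\<And>X. (\<Sum>w\<in>words n (diagram \<mu>). c w * bidet \<mu> w X) = 0) \<Longrightarrow>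
      (\<Sum>w\<in>words n (diagram \<mu>). c w * x w) = 0"
  shows "x \<in> (weyl n \<mu> :: 'k tensor set)"
  unfolding weyl_eq_span[OF inf \<mu>]
proof (rule in_span_if_annihilated[OF finite_diagram[OF \<mu>] _ x])
  show "(\<lambda>A. act n (diagram \<mu>) (($$) A) (hwv \<mu>)) ` GL n \<subseteq> tensors n (diagram \<mu>)"
    using act_in_tensors by blast
  fix c :: "(cell \<Rightarrow> nat) \<Rightarrow> 'k"
  assume c: "\<And>y. y \<in> (\<lambda>A. act n (diagram \<mu>) (($$) A) (hwv \<mu>)) ` GL n \<Longrightarrow>
    (\<Sum>w\<in>words n (diagram \<mu>). c w * y w) = 0"
  have "(\<Sum>w\<in>words n (diagram \<mu>). c w * bidet \<mu> w X) = 0" for X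
  proof (rule polynomial_zero_if_zero_on_GL[OF inf, where n = n and
        F = "\<lambda>X. \<Sum>w\<in>words n (diagram \<mu>). c w * bidet \<mu> w X"])
    show "polynomial_on (square n) (\<lambda>X :: nat \<times> nat \<Rightarrow> 'k. \<Sum>w\<in>words n (diagram \<mu>). c w * bidet \<mu> w X)"
      by (intro polynomial_on_sum polynomial_on_scale polynomial_on_bidet[OF \<mu>])
    fix A :: "'k mat" assume A: "A \<in> GL n"
    have "(\<Sum>w\<in>words n (diagram \<mu>). c w * bidet \<mu> w (($$) A)) =
        (\<Sum>w\<in>words n (diagram \<mu>). c w * act n (diagram \<mu>) (($$) A) (hwv \<mu>) w)"
      by (intro sum.cong refl) (simp add: act_hwv[OF \<mu>])
    also have "\<dots> = 0" by (rule c) (rule imageI[OF A])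
    finally show "(\<Sum>w\<in>words n (diagram \<mu>). c w * bidet \<mu> w (($$) A)) = 0" .
  qed
  then show "(\<Sum>w\<in>words n (diagram \<mu>). c w * x w) = 0" by (rule ann)
qed

end

section \<open>Homomorphisms and primitive vectors\<close>

context
  fixes K :: "'k::field itself" and n :: nat
  assumes inf: "infinite (UNIV :: 'k set)"
begin

lemma weyl_hom_ext:
  assumes \<mu>: "\<mu> \<in> sequences n" and f: "f \<in> weyl_hom n \<mu> \<mu>'" and g: "g \<in> weyl_hom n \<mu> \<mu>'"
    and eq: "f (hwv \<mu>) = g (hwv \<mu> :: 'k tensor)"
  shows "f = g"
proof
  fix x :: "'k tensor"
  note sub = subspace_weyl[where ?'k = 'k, of n \<mu>]
  show "f x = g x"
  proof (cases "x \<in> weyl n \<mu>")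
    case False
    then show ?thesis using f g by (simp add: weyl_hom_def)
  next
    case True
    have f0: "h 0 = 0" if "h \<in> weyl_hom n \<mu> \<mu>'" for h :: "'k tensor \<Rightarrow> 'k tensor"
    proof -
      have "h (tensor_scale 0 0) = tensor_scale 0 (h 0)"
        using that tensor_space.subspace_0[OF sub] unfolding weyl_hom_def by blast
      then show ?thesis by simp
    qed
    have lin: "h (tensor_scale c (act n (diagram \<mu>) (($$) A) (hwv \<mu>)) + y) =
        tensor_scale c (act n (diagram \<mu>') (($$) A) (h (hwv \<mu>))) + h y"
      if h: "h \<in> weyl_hom n \<mu> \<mu>'" and A: "A \<in> GL n" and y: "y \<in> weyl n \<mu>"
      for h :: "'k tensor \<Rightarrow> 'k tensor" and c A y
    proof -
      let ?z = "act n (diagram \<mu>) (($$) A) (hwv \<mu>) :: 'k tensor"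
      have z: "?z \<in> weyl n \<mu>" by (rule act_hwv_in_weyl[OF inf \<mu> A])
      then have "tensor_scale c ?z \<in> weyl n \<mu>" by (rule tensor_space.subspace_scale[OF sub])
      then have "h (tensor_scale c ?z + y) = h (tensor_scale c ?z) + h y"
        using h y unfolding weyl_hom_def by blast
      also have "h (tensor_scale c ?z) = tensor_scale c (h ?z)"
        using h z unfolding weyl_hom_def by blast
      also have "h ?z = act n (diagram \<mu>') (($$) A) (h (hwv \<mu>))"
        using h A hwv_in_weyl[OF inf \<mu>] unfolding weyl_hom_def gl_act_eq_act by blast
      finally show ?thesis .
    qed
    from True show ?thesis
    proof (induction rule: weyl_induct[OF inf \<mu>, consumes 1, case_names zero step])
      case zero
      show ?case by (simp only: f0[OF f] f0[OF g])
    next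
      case (step c A y)
      then show ?case by (simp only: lin[OF f] lin[OF g] eq)
    qed
  qed
qed

lemma weyl_hom_hwv_primitive:
  assumes \<mu>: "\<mu> \<in> partitions n" and f: "f \<in> weyl_hom n \<mu> \<mu>'"
  shows "f (hwv \<mu> :: 'k tensor) \<in> primitives n \<mu>' \<mu>"
  unfolding primitives_def
proof (intro CollectI conjI allI impI)
  note seq = partitions_sequences[OF \<mu>]
  have hw: "(hwv \<mu> :: 'k tensor) \<in> weyl n \<mu>" by (rule hwv_in_weyl[OF inf seq])
  show "f (hwv \<mu>) \<in> weyl n \<mu>'" using f hw unfolding weyl_hom_def by blast
  fix b :: "nat \<times> nat \<Rightarrow> 'k" assume b: "upper n b"
  have "act n (diagram \<mu>') b (f (hwv \<mu>)) = f (act n (diagram \<mu>) b (hwv \<mu>))"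
    using f hw upper_mat_in_GL[OF b] unfolding weyl_hom_def gl_act_eq_act act_mat[symmetric, of _ _ b] by simp
  also have "\<dots> = tensor_scale (wt n \<mu> b) (f (hwv \<mu>))"
    using f hw unfolding act_upper_hwv[OF \<mu> b] weyl_hom_def by blast
  finally show "act n (diagram \<mu>') b (f (hwv \<mu>)) = tensor_scale (wt n \<mu> b) (f (hwv \<mu>))" .
qed

text \<open>The universal property of Weyl modules. The coordinates of the translates of a primitive vector are
  semi-invariants of weight \<open>\<mu>\<close>, hence combinations of the coordinates of the translates of the
  highest weight vector of \<open>\<Delta>(\<mu>)\<close>; the coefficients of these combinations define the
  homomorphism.\<close>
lemma weyl_hom_exists:
  assumes \<mu>: "\<mu> \<in> partitions n" and \<mu>': "\<mu>' \<in> sequences n" and x: "x \<in> primitives n \<mu>' \<mu>"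
  shows "\<exists>f\<in>weyl_hom n \<mu> \<mu>'. f (hwv \<mu> :: 'k tensor) = x"
proof -
  note seq = partitions_sequences[OF \<mu>]
  let ?D = "diagram \<mu>" and ?D' = "diagram \<mu>'"
  note sub = subspace_weyl[where ?'k = 'k, of n \<mu>] and sub' = subspace_weyl[where ?'k = 'k, of n \<mu>']
  have fin': "finite ?D'" by (rule finite_diagram[OF \<mu>'])
  have xw: "x \<in> weyl n \<mu>'" using x by (simp add: primitives_def)
  have semi: "semi_invariant n \<mu> (\<lambda>X. act n ?D' X x w)" if w: "w \<in> words n ?D'" for w
    unfolding semi_invariant_def
  proof (intro conjI allI impI)
    show "polynomial_on (square n) (\<lambda>X. act n ?D' X x w)"
    proof -
      have "polynomial_on (square n) (\<lambda>X. \<Sum>u\<in>words n ?D'. x u * (\<Prod>c\<in>?D'. X (w c, u c)))"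
        by (intro polynomial_on_sum polynomial_on_scale polynomial_on_prod polynomial_on_var)
          (auto simp: words_less[OF w] words_less)
      then show ?thesis using w by (simp add: act_def mult.commute)
    qed
    fix X b :: "nat \<times> nat \<Rightarrow> 'k" assume b: "upper n b"
    have "act n ?D' (mmul n X b) x = act n ?D' X (tensor_scale (wt n \<mu> b) x)"
      using x b unfolding act_mmul[OF fin'] primitives_def by simp
    then show "act n ?D' (mmul n X b) x w = wt n \<mu> b * act n ?D' X x w"
      unfolding act_scale by (simp add: tensor_scale_def)
  qed
  have "\<exists>c. \<forall>X. act n ?D' X x w = (\<Sum>u\<in>words n ?D. c u * bidet \<mu> u X)" if "w \<in> words n ?D'" for w
    using semi_invariant_in_bidet_span[OF inf \<mu> semi[OF that]] unfolding bidet_span_def by blast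
  then obtain C where C: "\<And>w X. w \<in> words n ?D' \<Longrightarrow>
      act n ?D' X x w = (\<Sum>u\<in>words n ?D. C w u * bidet \<mu> u X)" by metis
  define F where "F y = (\<lambda>w. if w \<in> words n ?D' then \<Sum>u\<in>words n ?D. C w u * y u else 0)"
    for y :: "'k tensor"
  have F0: "F 0 = 0" by (simp add: F_def fun_eq_iff)
  have Fadd: "F (y + z) = F y + F z" for y z
    by (simp add: F_def fun_eq_iff distrib_left sum.distrib)
  have Fscale: "F (tensor_scale c y) = tensor_scale c (F y)" for c y
    by (simp add: F_def fun_eq_iff tensor_scale_def sum_distrib_left mult.left_commute)
  have Fact: "F (act n ?D X (hwv \<mu>)) = act n ?D' X x" for X
  proof
    fix w
    show "F (act n ?D X (hwv \<mu>)) w = act n ?D' X x w"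
    proof (cases "w \<in> words n ?D'")
      case True
      have "F (act n ?D X (hwv \<mu>)) w = (\<Sum>u\<in>words n ?D. C w u * bidet \<mu> u X)"
        using True unfolding F_def by (simp add: act_hwv[OF seq] cong: sum.cong)
      then show ?thesis using C[OF True] by simp
    qed (simp add: F_def act_def)
  qed
  have Fweyl: "F y \<in> weyl n \<mu>'" if "y \<in> weyl n \<mu>" for y
    using that
  proof (induction rule: weyl_induct[OF inf seq, consumes 1, case_names zero step])
    case zero
    show ?case unfolding F0 by (rule tensor_space.subspace_0[OF sub'])
  next
    case (step c A y)
    show ?case unfolding Fadd Fscale Fact
      by (intro tensor_space.subspace_add[OF sub'] tensor_space.subspace_scale[OF sub']
          act_in_weyl[OF inf \<mu>'] step xw)
  qed
  have Fequi: "F (act n ?D (($$) A) y) = act n ?D' (($$) A) (F y)" if y: "y \<in> weyl n \<mu>" and A: "A \<in> GL n" for A y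
    using y
  proof (induction rule: weyl_induct[OF inf seq, consumes 1, case_names zero step])
    case zero
    show ?case by (simp only: F0 act_0)
  next
    case (step c B y)
    note AB = act_mult_mat[OF _ GL_carrier[OF A] GL_carrier[OF step(1)], symmetric]
    show ?case
      unfolding act_add act_scale Fadd Fscale AB[OF finite_diagram[OF seq]] Fact step.IH AB[OF fin'] ..
  qed
  define f where "f y = (if y \<in> weyl n \<mu> then F y else 0)" for y :: "'k tensor"
  have "f \<in> weyl_hom n \<mu> \<mu>'"
    unfolding weyl_hom_def gl_act_eq_act
  proof (intro CollectI conjI ballI allI impI)
    fix y :: "'k tensor" assume y: "y \<in> weyl n \<mu>"
    show "f y \<in> weyl n \<mu>'" using y Fweyl by (simp add: f_def)
    show "f (y + z) = f y + f z" if "z \<in> weyl n \<mu>" for z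
    proof -
      have "y + z \<in> weyl n \<mu>" by (rule tensor_space.subspace_add[OF sub y that])
      then show ?thesis using y that by (simp only: f_def if_True Fadd)
    qed
    show "f (tensor_scale c y) = tensor_scale c (f y)" for c
    proof -
      have "tensor_scale c y \<in> weyl n \<mu>" by (rule tensor_space.subspace_scale[OF sub y])
      then show ?thesis using y by (simp only: f_def if_True Fscale)
    qed
    show "f (act n ?D (($$) A) y) = act n ?D' (($$) A) (f y)" if "A \<in> GL n" for A
      using y act_in_weyl[OF inf seq that y] by (simp only: f_def if_True Fequi[OF y that])
  qed (simp add: f_def)
  moreover have "f (hwv \<mu>) = x"
  proof -
    have hw: "(hwv \<mu> :: 'k tensor) \<in> weyl n \<mu>" by (rule hwv_in_weyl[OF inf seq])
    then have "(hwv \<mu> :: 'k tensor) \<in> tensors n ?D" using weyl_subset_tensors[OF inf seq] by blast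
    then have "f (hwv \<mu>) = F (act n ?D (($$) (1\<^sub>m n)) (hwv \<mu>))"
      using hw by (simp only: f_def if_True act_one[OF finite_diagram[OF seq]])
    also have "\<dots> = x"
      unfolding Fact by (rule act_one[OF fin']) (use weyl_subset_tensors[OF inf \<mu>'] xw in blast)
    finally show ?thesis .
  qed
  ultimately show ?thesis by blast
qed

lemma dim_weyl_hom_eq_dim_primitives:
  assumes \<mu>: "\<mu> \<in> partitions n" and \<mu>': "\<mu>' \<in> sequences n"
  shows "dim_weyl_hom TYPE('k) n \<mu> \<mu>' =
    tensor_space.dim (primitives n \<mu>' \<mu> :: 'k tensor set)"
  unfolding dim_weyl_hom_def
proof (rule dim_eq_if_linear_bij[where T = "\<lambda>f. f (hwv \<mu>)"])
  let ?H = "weyl_hom n \<mu> \<mu>' :: ('k tensor \<Rightarrow> 'k tensor) set"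
  note sub' = subspace_weyl[where ?'k = 'k, of n \<mu>']
  show "bij_betw (\<lambda>f. f (hwv \<mu>)) ?H (primitives n \<mu>' \<mu>)"
  proof (rule bij_betwI')
    show "(f (hwv \<mu>) = g (hwv \<mu>)) = (f = g)" if "f \<in> ?H" "g \<in> ?H" for f g
      using weyl_hom_ext[OF partitions_sequences[OF \<mu>] that] by blast
    show "f (hwv \<mu>) \<in> primitives n \<mu>' \<mu>" if "f \<in> ?H" for f
      by (rule weyl_hom_hwv_primitive[OF \<mu> that])
    show "\<exists>f\<in>?H. x = f (hwv \<mu>)" if "x \<in> primitives n \<mu>' \<mu>" for x
      using weyl_hom_exists[OF \<mu> \<mu>' that] by blast
  qed
  show "hom_space.subspace ?H"
    unfolding hom_space.subspace_def
  proof (intro conjI ballI allI)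
    show "0 \<in> ?H"
      using tensor_space.subspace_0[OF sub']
      by (simp add: weyl_hom_def gl_act_eq_act act_0)
    fix f assume f: "f \<in> ?H"
    show "f + g \<in> ?H" if g: "g \<in> ?H" for g
      unfolding weyl_hom_def gl_act_eq_act
    proof (intro CollectI conjI ballI allI impI)
      fix x :: "'k tensor" assume x: "x \<in> weyl n \<mu>"
      show "(f + g) x \<in> weyl n \<mu>'"
        using f g x tensor_space.subspace_add[OF sub'] by (simp add: weyl_hom_def)
      show "(f + g) (x + y) = (f + g) x + (f + g) y" if "y \<in> weyl n \<mu>" for y
        using f g x that by (simp add: weyl_hom_def algebra_simps)
      show "(f + g) (tensor_scale c x) = tensor_scale c ((f + g) x)" for c
        using f g x by (simp add: weyl_hom_def tensor_space.scale_right_distrib)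
      show "(f + g) (act n (diagram \<mu>) (($$) A) x) = act n (diagram \<mu>') (($$) A) ((f + g) x)"
        if "A \<in> GL n" for A
        using f g x that by (simp add: weyl_hom_def gl_act_eq_act act_add)
    next
      fix x :: "'k tensor" assume "x \<notin> weyl n \<mu>"
      then show "(f + g) x = 0" using f g by (simp add: weyl_hom_def)
    qed
    show "hom_scale a f \<in> ?H" for a
      unfolding weyl_hom_def gl_act_eq_act hom_scale_def
    proof (intro CollectI conjI ballI allI impI)
      fix x :: "'k tensor" assume x: "x \<in> weyl n \<mu>"
      show "tensor_scale a (f x) \<in> weyl n \<mu>'"
        using f x tensor_space.subspace_scale[OF sub'] by (simp add: weyl_hom_def)
      show "tensor_scale a (f (x + y)) = tensor_scale a (f x) + tensor_scale a (f y)" if "y \<in> weyl n \<mu>" for y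
        using f x that by (simp add: weyl_hom_def tensor_space.scale_right_distrib)
      show "tensor_scale a (f (tensor_scale c x)) = tensor_scale c (tensor_scale a (f x))" for c
        using f x by (simp add: weyl_hom_def mult.commute)
      show "tensor_scale a (f (act n (diagram \<mu>) (($$) A) x)) = act n (diagram \<mu>') (($$) A) (tensor_scale a (f x))"
        if "A \<in> GL n" for A
        using f x that by (simp add: weyl_hom_def gl_act_eq_act act_scale)
    next
      fix x :: "'k tensor" assume "x \<notin> weyl n \<mu>"
      then show "tensor_scale a (f x) = 0" using f by (simp add: weyl_hom_def)
    qed
  qed
qed (unfold_locales, simp_all add: hom_scale_def)

end

section \<open>Row weights\<close>

definition row_scale :: "(nat \<Rightarrow> 'k::field) \<Rightarrow> (nat \<times> nat \<Rightarrow> 'k) \<Rightarrow> nat \<times> nat \<Rightarrow> 'k" where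
  "row_scale t X = (\<lambda>i. t (fst i) * X i)"

definition row_weight :: "nat \<Rightarrow> (nat \<Rightarrow> nat) \<Rightarrow> ((nat \<times> nat \<Rightarrow> 'k::field) \<Rightarrow> 'k) \<Rightarrow> bool" where
  "row_weight n \<rho> F \<longleftrightarrow> (\<forall>t X. F (row_scale t X) = (\<Prod>a<n. t a ^ \<rho> a) * F X)"

definition word_content :: "cell set \<Rightarrow> (cell \<Rightarrow> nat) \<Rightarrow> nat \<Rightarrow> nat" where
  "word_content D w a = card {c \<in> D. w c = a}"

lemma prod_word_content:
  assumes "finite D" and "w \<in> words n D"
  shows "(\<Prod>c\<in>D. t (w c)) = (\<Prod>a<n. t a ^ word_content D w a :: 'k::field)"
proof -
  have "(\<Prod>c\<in>D. t (w c)) = (\<Prod>a<n. \<Prod>c\<in>{c\<in>D. w c = a}. t (w c))"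
    using assms words_less[OF assms(2)] by (intro prod.group[symmetric]) auto
  also have "\<dots> = (\<Prod>a<n. t a ^ word_content D w a)"
    by (intro prod.cong) (auto simp: word_content_def)
  finally show ?thesis .
qed

lemma sum_word_content:
  assumes "finite D"
  shows "(\<Sum>a<i. word_content D w a) = card {c \<in> D. w c < i}"
proof -
  have "{c \<in> D. w c < i} = (\<Union>a<i. {c \<in> D. w c = a})" by auto
  also have "card \<dots> = (\<Sum>a<i. word_content D w a)"
    unfolding word_content_def using assms by (intro card_UN_disjoint) auto
  finally show ?thesis by simp
qed

lemma row_weight_bidet:
  assumes "\<mu> \<in> sequences n" and "w \<in> words n (diagram \<mu>)"
  shows "row_weight n (word_content (diagram \<mu>) w) (bidet \<mu> w)"
  unfolding row_weight_def
proof (intro allI)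
  fix t :: "nat \<Rightarrow> 'a" and X
  have "(\<Prod>c\<in>diagram \<mu>. row_scale t X (w (\<sigma> c), fst c - 1)) =
      (\<Prod>a<n. t a ^ word_content (diagram \<mu>) w a) * (\<Prod>c\<in>diagram \<mu>. X (w (\<sigma> c), fst c - 1))"
    if "\<sigma> \<in> col_stab \<mu>" for \<sigma>
  proof -
    have "(\<Prod>c\<in>diagram \<mu>. t (w (\<sigma> c))) = (\<Prod>c\<in>diagram \<mu>. t (w c))"
      by (rule prod.permute[OF col_stabD(1)[OF that], unfolded comp_def, symmetric])
    then show ?thesis
      using prod_word_content[OF finite_diagram[OF assms(1)] assms(2), of t]
      by (simp add: row_scale_def prod.distrib)
  qed
  then have "bidet \<mu> w (row_scale t X) = (\<Sum>\<sigma>\<in>col_stab \<mu>. (\<Prod>a<n. t a ^ word_content (diagram \<mu>) w a) *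
      (of_int (sign \<sigma>) * (\<Prod>c\<in>diagram \<mu>. X (w (\<sigma> c), fst c - 1))))"
    unfolding bidet_def by (intro sum.cong) (simp_all add: mult.left_commute)
  then show "bidet \<mu> w (row_scale t X) = (\<Prod>a<n. t a ^ word_content (diagram \<mu>) w a) * bidet \<mu> w X"
    by (simp add: bidet_def sum_distrib_left)
qed

lemma row_weight_mult_power:
  assumes "row_weight n \<rho> F" and "row_weight n \<rho>' G"
  shows "row_weight n (\<lambda>a. \<rho> a + q * \<rho>' a) (\<lambda>X. F X * G X ^ q)"
proof -
  have "(\<Prod>a<n. t a ^ \<rho>' a) ^ q = (\<Prod>a<n. t a ^ (q * \<rho>' a))" for t :: "nat \<Rightarrow> 'a"
    by (simp add: prod_power_distrib power_mult[symmetric] mult.commute)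
  then show ?thesis
    using assms unfolding row_weight_def
    by (simp add: power_mult_distrib power_add prod.distrib mult_ac)
qed

lemma row_weight_degree:
  fixes F :: "(nat \<times> nat \<Rightarrow> 'k::field) \<Rightarrow> 'k"
  assumes inf: "infinite (UNIV :: 'k set)" and F: "row_weight n \<rho> F"
    and h: "expansion (square n) h F" and m: "h m \<noteq> 0" and a: "a < n"
  shows "(\<Sum>b<n. m (a, b)) = \<rho> a"
proof (rule infinite_field_power_eq[OF inf])
  fix t :: 'k assume "t \<noteq> 0"
  define s where "s c = (if c = a then t else 1)" for c
  have "F (\<lambda>i. s (fst i) * X i) = (\<Prod>a<n. s a ^ \<rho> a) * F X" for X
    using F by (simp add: row_weight_def row_scale_def)
  then have "monomial (square n) m (\<lambda>i. s (fst i)) = (\<Prod>a<n. s a ^ \<rho> a)"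
    by (rule expansion_scaling[OF inf _ h _ m, rotated]) simp
  also have "\<dots> = (\<Prod>c<n. if c = a then t ^ \<rho> a else 1)"
    by (intro prod.cong) (auto simp: s_def)
  also have "\<dots> = t ^ \<rho> a" using a by simp
  finally have "monomial (square n) m (\<lambda>i. s (fst i)) = t ^ \<rho> a" .
  moreover have "monomial (square n) m (\<lambda>i. s (fst i)) = (\<Prod>c<n. if c = a then t ^ (\<Sum>b<n. m (a, b)) else 1)"
    unfolding monomial_square by (intro prod.cong) (auto simp: s_def power_sum)
  ultimately show "t ^ (\<Sum>b<n. m (a, b)) = t ^ \<rho> a" using a by simp
qed

text \<open>Rescaling the rows turns the relation into a polynomial identity in the scaling factors.\<close>
lemma row_weight_component_zero:
  fixes G :: "'j \<Rightarrow> (nat \<times> nat \<Rightarrow> 'k::field) \<Rightarrow> 'k"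
  assumes inf: "infinite (UNIV :: 'k set)" and fin: "finite J"
    and G: "\<And>j. j \<in> J \<Longrightarrow> row_weight n (\<rho> j) (G j)" and zero: "\<And>X. (\<Sum>j\<in>J. G j X) = 0"
  shows "(\<Sum>j\<in>{j\<in>J. \<forall>a<n. \<rho> j a = \<rho>' a}. G j X) = 0"
proof -
  have "(\<Sum>j\<in>{j\<in>J. \<forall>a\<in>{..<n}. \<rho> j a = \<rho>' a}. G j X) = 0"
  proof (rule monomial_linear_independent[OF inf _ fin])
    fix t :: "nat \<Rightarrow> 'k"
    have "(\<Sum>j\<in>J. G j X * monomial {..<n} (\<rho> j) t) = (\<Sum>j\<in>J. G j (row_scale t X))"
      using G by (intro sum.cong) (auto simp: row_weight_def monomial_def mult.commute)
    then show "(\<Sum>j\<in>J. G j X * monomial {..<n} (\<rho> j) t) = 0" using zero by simp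
  qed simp
  then show ?thesis unfolding Ball_def lessThan_iff .
qed

lemma row_weight_scale: "row_weight n \<rho> F \<Longrightarrow> row_weight n \<rho> (\<lambda>X. c * F X)"
  by (simp add: row_weight_def mult.left_commute)

text \<open>On lower unitriangular matrices only the monomials without entries above the diagonal survive.\<close>
lemma monomial_lower_unitriangular_zero:
  assumes "lower_unitriangular n u" and "a < n" "b < n" "a < b" and "m (a, b) \<noteq> 0"
  shows "monomial (square n) m u = 0"
proof -
  have "u (a, b) ^ m (a, b) = 0" using assms by (auto simp: lower_unitriangular_def)
  moreover have "(a, b) \<in> square n" using assms by simp
  ultimately show ?thesis unfolding monomial_def by (intro prod_zero) auto
qed

text \<open>In a monomial without entries above the diagonal, the first \<open>i\<close> rows only meet the first
  \<open>i\<close> columns.\<close>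
lemma row_weight_dominated:
  fixes F :: "(nat \<times> nat \<Rightarrow> 'k::field) \<Rightarrow> 'k"
  assumes inf: "infinite (UNIV :: 'k set)" and F: "semi_invariant n \<mu> F" "row_weight n \<rho> F"
    and nz: "F X \<noteq> 0" and i: "i \<le> n"
  shows "(\<Sum>a<i. \<rho> a) \<le> (\<Sum>b<i. \<mu> (Suc b))"
proof -
  obtain u where u: "lower_unitriangular n u" "F u \<noteq> 0"
    using semi_invariant_zero_if_zero_on_lower_unitriangular[OF inf F(1)] nz by blast
  obtain h where h: "expansion (square n) h F"
    using F(1) unfolding semi_invariant_def polynomial_on_def by blast
  have "F u = (\<Sum>m | h m \<noteq> 0. h m * monomial (square n) m u)" using h unfolding expansion_def by blast
  then obtain m where m: "h m \<noteq> 0" "monomial (square n) m u \<noteq> 0"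
    using u(2) by (metis (mono_tags, lifting) mem_Collect_eq mult_zero_right sum.neutral)
  have low: "m (a, b) = 0" if "a < b" "b < n" for a b
    using monomial_lower_unitriangular_zero[OF u(1), of a b m] m(2) that by auto
  have "(\<Sum>a<i. \<rho> a) = (\<Sum>a<i. \<Sum>b<n. m (a, b))"
    using row_weight_degree[OF inf F(2) h m(1)] i by (intro sum.cong) auto
  also have "\<dots> = (\<Sum>a<i. \<Sum>b<i. m (a, b))"
    using low i by (intro sum.cong sum.mono_neutral_right) auto
  also have "\<dots> = (\<Sum>b<i. \<Sum>a<i. m (a, b))" by (rule sum.swap)
  also have "\<dots> \<le> (\<Sum>b<i. \<Sum>a<n. m (a, b))"
    using i by (intro sum_mono sum_mono2) auto
  also have "\<dots> = (\<Sum>b<i. \<mu> (Suc b))"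
    using semi_invariant_column_degree[OF inf F(1) h m(1)] i by (intro sum.cong) auto
  finally show ?thesis .
qed

lemma semi_invariant_mult_power:
  assumes "semi_invariant n \<mu> F" and "semi_invariant n \<nu> G"
  shows "semi_invariant n (\<mu> + seq_scale q \<nu>) (\<lambda>X. F X * G X ^ q)"
proof -
  have "wt n (\<mu> + seq_scale q \<nu>) b = wt n \<mu> b * wt n \<nu> b ^ q" for b :: "nat \<times> nat \<Rightarrow> 'a"
    by (simp add: wt_def seq_scale_def power_add prod.distrib prod_power_distrib power_mult[symmetric] mult.commute)
  then show ?thesis
    using assms unfolding semi_invariant_def
    by (simp add: polynomial_on_mult polynomial_on_power power_mult_distrib mult_ac)
qed

text \<open>A permutation of the columns that is not the identity moves some cell down. Such a cell is not the
  bottom of its column, so its entry is the row number and the factor lies above the diagonal.\<close>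
lemma bidet_lower_unitriangular:
  assumes \<mu>: "\<mu> \<in> partitions n" and w: "w \<in> words n (diagram \<mu>)" and u: "lower_unitriangular n u"
    and inner: "\<And>i j. (i, j) \<in> diagram \<mu> \<Longrightarrow> (Suc i, j) \<in> diagram \<mu> \<Longrightarrow> w (i, j) = i - 1"
  shows "bidet \<mu> w u = (\<Prod>c\<in>diagram \<mu>. u (w c, fst c - 1))"
proof -
  let ?D = "diagram \<mu>"
  note seq = partitions_sequences[OF \<mu>]
  have fin: "finite ?D" by (rule finite_diagram[OF seq])
  have "(\<Prod>c\<in>?D. u (w c, fst (\<sigma> c) - 1)) = 0" if \<sigma>: "\<sigma> \<in> col_stab \<mu>" "\<sigma> \<noteq> id" for \<sigma>
  proof -
    obtain c where c: "c \<in> ?D" "fst c < fst (\<sigma> c)"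
      using col_stab_id_if_rows_le[OF fin \<sigma>(1)] \<sigma>(2) not_le_imp_less by blast
    have \<sigma>D: "\<sigma> c \<in> ?D" using permutes_in_image[OF col_stabD(1)[OF \<sigma>(1)], of c] c(1) by simp
    have "snd c \<le> \<mu> (fst (\<sigma> c))" using \<sigma>D col_stabD(2)[OF \<sigma>(1), of c] by (auto simp: diagram_def)
    also have "\<dots> \<le> \<mu> (Suc (fst c))" using c(2) by (intro partitions_antimono[OF \<mu>]) auto
    finally have "(Suc (fst c), snd c) \<in> ?D" using c(1) by (auto simp: diagram_def)
    then have "w c = fst c - 1" using inner[of "fst c" "snd c"] c(1) by simp
    then have "w c < fst (\<sigma> c) - 1" using c diagram_row_bounds(1)[OF seq c(1)] by simp
    moreover have "fst (\<sigma> c) - 1 < n" by (rule diagram_row_bounds(3)[OF seq \<sigma>D])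
    ultimately have "u (w c, fst (\<sigma> c) - 1) = 0" using u by (simp add: lower_unitriangular_def)
    then show ?thesis using fin c(1) by (intro prod_zero) auto
  qed
  then have "bidet \<mu> w u = (\<Sum>\<sigma>\<in>col_stab \<mu>. if \<sigma> = id then \<Prod>c\<in>?D. u (w c, fst c - 1) else 0)"
    unfolding bidet_alt[OF fin] by (intro sum.cong) (auto simp: sign_id)
  then show ?thesis using finite_col_stab[OF fin] col_stab_id by simp
qed

abbreviation flag_minors :: "(nat \<Rightarrow> nat) \<Rightarrow> (nat \<times> nat \<Rightarrow> 'k::field) \<Rightarrow> 'k" where
  "flag_minors \<nu> \<equiv> bidet \<nu> (row_word \<nu>)"

lemma flag_minors_lower_unitriangular:
  assumes \<nu>: "\<nu> \<in> partitions n" and u: "lower_unitriangular n u"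
  shows "flag_minors \<nu> u = 1"
proof -
  note seq = partitions_sequences[OF \<nu>]
  have "flag_minors \<nu> u = (\<Prod>c\<in>diagram \<nu>. u (row_word \<nu> c, fst c - 1))"
    by (rule bidet_lower_unitriangular[OF \<nu> row_word_in_words[OF seq] u]) (simp add: row_word_def)
  also have "\<dots> = (\<Prod>c\<in>diagram \<nu>. 1)"
    using u diagram_row_bounds(3)[OF seq]
    by (intro prod.cong) (auto simp: row_word_def lower_unitriangular_def)
  finally show ?thesis by simp
qed

section \<open>The pairing of a Weyl module with semi-invariants\<close>

text \<open>The value on a function \<open>F\<close> of the functional that belongs to \<open>x\<close>. The choice of the
  coefficients is immaterial for \<open>x\<close> in the Weyl module (\<open>pairing_eq\<close>).\<close>
definition pairing :: "nat \<Rightarrow> (nat \<Rightarrow> nat) \<Rightarrow> 'k::field tensor \<Rightarrow> ((nat \<times> nat \<Rightarrow> 'k) \<Rightarrow> 'k) \<Rightarrow> 'k" where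
  "pairing n \<mu> x F = (\<Sum>w\<in>words n (diagram \<mu>).
     (SOME c. \<forall>X. F X = (\<Sum>w\<in>words n (diagram \<mu>). c w * bidet \<mu> w X)) w * x w)"

lemma pairing_add: "pairing n \<mu> (x + y) F = pairing n \<mu> x F + pairing n \<mu> y F"
  by (simp add: pairing_def distrib_left sum.distrib)

lemma pairing_scale: "pairing n \<mu> (tensor_scale a x) F = a * pairing n \<mu> x F"
  by (simp add: pairing_def tensor_scale_def sum_distrib_left mult.left_commute)

lemma act_diagonal:
  assumes fin: "finite D" and w: "w \<in> words n D"
  shows "act n D (\<lambda>(i, j). if i = j then t i else 0) x w = (\<Prod>c\<in>D. t (w c)) * x w"
proof -
  have "(\<Prod>c\<in>D. (\<lambda>(i, j). if i = j then t i else 0) (w c, u c)) * x u =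
      (if u = w then (\<Prod>c\<in>D. t (w c)) * x w else 0)" if u: "u \<in> words n D" for u
  proof (cases "u = w")
    case False
    then obtain c where "w c \<noteq> u c" by (metis ext)
    then have "c \<in> D" using words_outside[OF w] words_outside[OF u] by metis
    then have "(\<Prod>c\<in>D. (\<lambda>(i, j). if i = j then t i else 0) (w c, u c)) = 0"
      using fin \<open>w c \<noteq> u c\<close> by (intro prod_zero) auto
    then show ?thesis using False by simp
  qed simp
  then have "act n D (\<lambda>(i, j). if i = j then t i else 0) x w =
      (\<Sum>u\<in>words n D. if u = w then (\<Prod>c\<in>D. t (w c)) * x w else 0)"
    using w unfolding act_def by (simp cong: sum.cong)
  then show ?thesis using w finite_words[OF fin, of n] by simp
qed

text \<open>The diagonal matrices act by the character \<open>lam\<close>, expressed in coordinates.\<close>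
definition torus_weight :: "nat \<Rightarrow> (nat \<Rightarrow> nat) \<Rightarrow> (nat \<Rightarrow> nat) \<Rightarrow> 'k::field tensor \<Rightarrow> bool" where
  "torus_weight n \<mu> lam x \<longleftrightarrow>
    (\<forall>w\<in>words n (diagram \<mu>). x w \<noteq> 0 \<longrightarrow> (\<forall>a<n. word_content (diagram \<mu>) w a = lam (Suc a)))"

lemma primitives_torus_weight:
  fixes x :: "'k::field tensor"
  assumes inf: "infinite (UNIV :: 'k set)" and \<mu>: "\<mu> \<in> sequences n" and x: "x \<in> primitives n \<mu> lam"
  shows "torus_weight n \<mu> lam x"
  unfolding torus_weight_def
proof (intro ballI impI allI)
  fix w a assume w: "w \<in> words n (diagram \<mu>)" and xw: "x w \<noteq> 0" and a: "a < n"
  note fin = finite_diagram[OF \<mu>]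
  show "word_content (diagram \<mu>) w a = lam (Suc a)"
  proof (rule infinite_field_power_eq[OF inf])
    fix t :: 'k assume t: "t \<noteq> 0"
    define s where "s c = (if c = a then t else 1)" for c
    let ?d = "\<lambda>(i, j). if i = j then s i else 0"
    have up: "upper n ?d" using t by (auto simp: upper_def s_def)
    have one: "(\<Prod>c<n. s c ^ e c) = t ^ e a" for e :: "nat \<Rightarrow> nat"
    proof -
      have "(\<Prod>c<n. s c ^ e c) = (\<Prod>c<n. if c = a then t ^ e a else 1)"
        by (intro prod.cong) (auto simp: s_def)
      then show ?thesis using a by simp
    qed
    have "act n (diagram \<mu>) ?d x w = wt n lam ?d * x w"
      using x up by (simp add: primitives_def tensor_scale_def)
    moreover have "wt n lam ?d = t ^ lam (Suc a)" using one[of "\<lambda>c. lam (Suc c)"] by (simp add: wt_def)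
    ultimately have "(\<Prod>c\<in>diagram \<mu>. s (w c)) * x w = t ^ lam (Suc a) * x w"
      by (simp add: act_diagonal[OF fin w])
    then have "(\<Prod>c\<in>diagram \<mu>. s (w c)) = t ^ lam (Suc a)" using xw by simp
    then show "t ^ word_content (diagram \<mu>) w a = t ^ lam (Suc a)"
      using prod_word_content[OF fin w, of s] one[of "word_content (diagram \<mu>) w"] by simp
  qed
qed

text \<open>Separate the function and the terms of its expansion into bideterminants by their row weights. The
  index \<open>None\<close> stands for the function itself.\<close>
lemma semi_invariant_weight_component:
  fixes F :: "(nat \<times> nat \<Rightarrow> 'k::field) \<Rightarrow> 'k"
  assumes inf: "infinite (UNIV :: 'k set)" and \<mu>: "\<mu> \<in> partitions n"
    and F: "semi_invariant n \<mu> F" "row_weight n \<rho> F"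
  shows "\<exists>c. (\<forall>w. c w \<noteq> 0 \<longrightarrow> (\<forall>a<n. word_content (diagram \<mu>) w a = \<rho> a)) \<and>
    (\<forall>X. F X = (\<Sum>w\<in>words n (diagram \<mu>). c w * bidet \<mu> w X))"
proof -
  note seq = partitions_sequences[OF \<mu>]
  let ?W = "words n (diagram \<mu>)"
  have finW: "finite ?W" by (rule finite_words[OF finite_diagram[OF seq]])
  obtain c where c: "\<And>X. F X = (\<Sum>w\<in>?W. c w * bidet \<mu> w X)"
    using semi_invariant_in_bidet_span[OF inf \<mu> F(1)] unfolding bidet_span_def by blast
  define J where "J = insert None (Some ` ?W)"
  define G where "G j = (case j of None \<Rightarrow> (\<lambda>X. - 1 * F X) | Some w \<Rightarrow> (\<lambda>X. c w * bidet \<mu> w X))" for j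
  define wtj where "wtj j = (case j of None \<Rightarrow> \<rho> | Some w \<Rightarrow> word_content (diagram \<mu>) w)" for j
  have finJ: "finite J" using finW by (simp add: J_def)
  have sumJ: "(\<Sum>j\<in>J'. G j X) = - F X + (\<Sum>w\<in>W'. c w * bidet \<mu> w X)"
    if "J' = insert None (Some ` W')" "W' \<subseteq> ?W" for J' W' X
    using finite_subset[OF that(2) finW] unfolding that(1)
    by (simp add: G_def sum.reindex inj_on_def)
  have "(\<Sum>j\<in>{j\<in>J. \<forall>a<n. wtj j a = \<rho> a}. G j X) = 0" for X
  proof (rule row_weight_component_zero[OF inf finJ])
    show "row_weight n (wtj j) (G j)" if "j \<in> J" for j
      using that row_weight_scale[OF F(2), of "- 1"] row_weight_scale[OF row_weight_bidet[OF seq]]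
      by (auto simp: J_def wtj_def G_def)
    show "(\<Sum>j\<in>J. G j X) = 0" for X
      using sumJ[OF J_def subset_refl] c[of X] by simp
  qed
  moreover have J': "{j\<in>J. \<forall>a<n. wtj j a = \<rho> a} =
      insert None (Some ` {w\<in>?W. \<forall>a<n. word_content (diagram \<mu>) w a = \<rho> a})"
    by (auto simp: J_def wtj_def)
  ultimately have "F X = (\<Sum>w\<in>{w\<in>?W. \<forall>a<n. word_content (diagram \<mu>) w a = \<rho> a}. c w * bidet \<mu> w X)" for X
    using sumJ[OF J', of X] by (simp add: subset_iff)
  also have "\<dots> X = (\<Sum>w\<in>?W. (if \<forall>a<n. word_content (diagram \<mu>) w a = \<rho> a then c w else 0) * bidet \<mu> w X)" for X
    unfolding sum.inter_filter[OF finW] by (intro sum.cong) auto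
  finally show ?thesis
    by (intro exI[of _ "\<lambda>w. if \<forall>a<n. word_content (diagram \<mu>) w a = \<rho> a then c w else 0"]) auto
qed

context
  fixes K :: "'k::field itself" and n :: nat and \<mu> :: "nat \<Rightarrow> nat"
  assumes inf: "infinite (UNIV :: 'k set)" and \<mu>: "\<mu> \<in> partitions n"
begin

lemma pairing_eq:
  assumes x: "x \<in> (weyl n \<mu> :: 'k tensor set)"
    and F: "\<And>X. F X = (\<Sum>w\<in>words n (diagram \<mu>). c w * bidet \<mu> w X)"
  shows "pairing n \<mu> x F = (\<Sum>w\<in>words n (diagram \<mu>). c w * x w)"
proof -
  let ?W = "words n (diagram \<mu>)"
  define c' where "c' = (SOME c. \<forall>X. F X = (\<Sum>w\<in>?W. c w * bidet \<mu> w X))"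
  have "\<forall>X. F X = (\<Sum>w\<in>?W. c' w * bidet \<mu> w X)"
    unfolding c'_def by (rule someI[of _ c]) (use F in blast)
  then have "(\<Sum>w\<in>?W. (c' w - c w) * bidet \<mu> w X) = 0" for X
    using F[of X] by (simp add: algebra_simps sum_subtractf)
  then have "(\<Sum>w\<in>?W. (c' w - c w) * x w) = 0"
    by (rule weyl_annihilated[OF inf partitions_sequences[OF \<mu>] x])
  then show ?thesis
    unfolding pairing_def c'_def[symmetric] by (simp add: algebra_simps sum_subtractf)
qed

lemma semi_invariant_coeffs:
  fixes F :: "(nat \<times> nat \<Rightarrow> 'k) \<Rightarrow> 'k"
  assumes "semi_invariant n \<mu> F"
  shows "\<exists>c. \<forall>X. F X = (\<Sum>w\<in>words n (diagram \<mu>). c w * bidet \<mu> w X)"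
  using semi_invariant_in_bidet_span[OF inf \<mu> assms] unfolding bidet_span_def by blast

lemma pairing_fun_add:
  assumes x: "x \<in> (weyl n \<mu> :: 'k tensor set)" and F: "semi_invariant n \<mu> F" and G: "semi_invariant n \<mu> G"
  shows "pairing n \<mu> x (\<lambda>X. F X + G X) = pairing n \<mu> x F + pairing n \<mu> x G"
proof -
  obtain c where c: "\<And>X. F X = (\<Sum>w\<in>words n (diagram \<mu>). c w * bidet \<mu> w X)" using semi_invariant_coeffs[OF F] by blast
  obtain d where d: "\<And>X. G X = (\<Sum>w\<in>words n (diagram \<mu>). d w * bidet \<mu> w X)" using semi_invariant_coeffs[OF G] by blast
  have "F X + G X = (\<Sum>w\<in>words n (diagram \<mu>). (c w + d w) * bidet \<mu> w X)" for X
    by (simp add: c d distrib_right sum.distrib)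
  from pairing_eq[OF x this] show ?thesis
    unfolding pairing_eq[OF x c] pairing_eq[OF x d] by (simp add: distrib_right sum.distrib)
qed

lemma pairing_fun_scale:
  assumes x: "x \<in> (weyl n \<mu> :: 'k tensor set)" and F: "semi_invariant n \<mu> F"
  shows "pairing n \<mu> x (\<lambda>X. a * F X) = a * pairing n \<mu> x F"
proof -
  obtain c where c: "\<And>X. F X = (\<Sum>w\<in>words n (diagram \<mu>). c w * bidet \<mu> w X)" using semi_invariant_coeffs[OF F] by blast
  have "a * F X = (\<Sum>w\<in>words n (diagram \<mu>). (a * c w) * bidet \<mu> w X)" for X
    by (simp add: c sum_distrib_left mult.assoc)
  from pairing_eq[OF x this] show ?thesis
    unfolding pairing_eq[OF x c] by (simp add: sum_distrib_left mult.assoc)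
qed

lemma pairing_fun_0:
  assumes x: "x \<in> (weyl n \<mu> :: 'k tensor set)"
  shows "pairing n \<mu> x (\<lambda>X. 0) = 0"
  using pairing_eq[OF x, of "\<lambda>X. 0" "\<lambda>w. 0"] by simp

lemma pairing_fun_sum:
  assumes x: "x \<in> (weyl n \<mu> :: 'k tensor set)" and F: "\<And>j. j \<in> J \<Longrightarrow> semi_invariant n \<mu> (F j)"
  shows "pairing n \<mu> x (\<lambda>X. \<Sum>j\<in>J. F j X) = (\<Sum>j\<in>J. pairing n \<mu> x (F j))"
  using F
proof (induction J rule: infinite_finite_induct)
  case (insert j J)
  then show ?case
    by (simp add: pairing_fun_add[OF x] semi_invariant_sum)
qed (simp_all add: pairing_fun_0[OF x])

lemma pairing_bidet:
  assumes x: "x \<in> (weyl n \<mu> :: 'k tensor set)" and w: "w \<in> words n (diagram \<mu>)"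
  shows "pairing n \<mu> x (bidet \<mu> w) = x w"
proof -
  let ?W = "words n (diagram \<mu>)"
  have finW: "finite ?W" by (rule finite_words[OF finite_diagram[OF partitions_sequences[OF \<mu>]]])
  have delta: "(\<Sum>u\<in>?W. (if u = w then 1 else 0) * g u) = g w" for g :: "_ \<Rightarrow> 'k"
  proof -
    have "(\<Sum>u\<in>?W. (if u = w then 1 else 0) * g u) = (\<Sum>u\<in>?W. if u = w then g w else 0)"
      by (intro sum.cong) auto
    then show ?thesis using finW w by simp
  qed
  show ?thesis
    using pairing_eq[OF x, of "bidet \<mu> w" "\<lambda>u. if u = w then 1 else 0"] unfolding delta by blast
qed

text \<open>The action on a Weyl module is dual to left translation of functions.\<close>
lemma pairing_translate:
  assumes x: "x \<in> (weyl n \<mu> :: 'k tensor set)" and bx: "act n (diagram \<mu>) b x \<in> weyl n \<mu>"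
    and F: "semi_invariant n \<mu> F"
  shows "pairing n \<mu> x (\<lambda>X. F (mmul n b X)) = pairing n \<mu> (act n (diagram \<mu>) b x) F"
proof -
  let ?W = "words n (diagram \<mu>)"
  note seq = partitions_sequences[OF \<mu>]
  obtain c where c: "\<And>X. F X = (\<Sum>w\<in>?W. c w * bidet \<mu> w X)" using semi_invariant_coeffs[OF F] by blast
  define p where "p w u = (\<Prod>e\<in>diagram \<mu>. b (w e, u e))" for w u
  have rearrange: "(\<Sum>w\<in>?W. c w * (\<Sum>u\<in>?W. p w u * g u)) = (\<Sum>u\<in>?W. (\<Sum>w\<in>?W. c w * p w u) * g u)"
    for g :: "(cell \<Rightarrow> nat) \<Rightarrow> 'k"
    unfolding sum_distrib_left sum_distrib_right mult.assoc by (rule sum.swap)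
  have "F (mmul n b X) = (\<Sum>w\<in>?W. c w * (\<Sum>u\<in>?W. p w u * bidet \<mu> u X))" for X
    unfolding c p_def by (intro sum.cong refl) (simp add: bidet_left[OF seq])
  then have "pairing n \<mu> x (\<lambda>X. F (mmul n b X)) = (\<Sum>u\<in>?W. (\<Sum>w\<in>?W. c w * p w u) * x u)"
    unfolding rearrange by (rule pairing_eq[OF x])
  also have "\<dots> = (\<Sum>w\<in>?W. c w * (\<Sum>u\<in>?W. p w u * x u))" by (rule rearrange[symmetric])
  also have "\<dots> = (\<Sum>w\<in>?W. c w * act n (diagram \<mu>) b x w)"
    by (intro sum.cong refl) (simp add: act_def p_def)
  also have "\<dots> = pairing n \<mu> (act n (diagram \<mu>) b x) F" by (rule pairing_eq[OF bx c, symmetric])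
  finally show ?thesis .
qed

lemma semi_invariant_translate:
  fixes F :: "(nat \<times> nat \<Rightarrow> 'k) \<Rightarrow> 'k"
  assumes F: "semi_invariant n \<mu> F"
  shows "semi_invariant n \<mu> (\<lambda>X. F (mmul n b X))"
proof -
  let ?W = "words n (diagram \<mu>)"
  note seq = partitions_sequences[OF \<mu>]
  obtain c where c: "\<And>X. F X = (\<Sum>w\<in>?W. c w * bidet \<mu> w X)" using semi_invariant_coeffs[OF F] by blast
  have "(\<lambda>X. F (mmul n b X)) = (\<lambda>X. \<Sum>w\<in>?W. c w * (\<Sum>u\<in>?W. (\<Prod>e\<in>diagram \<mu>. b (w e, u e)) * bidet \<mu> u X))"
    unfolding c by (intro ext sum.cong refl) (simp add: bidet_left[OF seq])
  then show ?thesis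
    by (simp only:) (intro semi_invariant_sum semi_invariant_scale semi_invariant_bidet[OF \<mu>])
qed

text \<open>Components of different weights are orthogonal.\<close>
lemma pairing_weight_zero:
  assumes x: "x \<in> (weyl n \<mu> :: 'k tensor set)" and tw: "torus_weight n \<mu> lam x"
    and F: "semi_invariant n \<mu> F" "row_weight n \<rho> F" and a: "a < n" "\<rho> a \<noteq> lam (Suc a)"
  shows "pairing n \<mu> x F = 0"
proof -
  obtain c where c: "\<And>w. c w \<noteq> 0 \<Longrightarrow> \<forall>a<n. word_content (diagram \<mu>) w a = \<rho> a"
    and Fc: "\<And>X. F X = (\<Sum>w\<in>words n (diagram \<mu>). c w * bidet \<mu> w X)"
    using semi_invariant_weight_component[OF inf \<mu> F] by blast
  have "c w * x w = 0" if "w \<in> words n (diagram \<mu>)" for w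
  proof (cases "c w = 0")
    case False
    then have "word_content (diagram \<mu>) w a \<noteq> lam (Suc a)" using c[OF False] a by simp
    then show ?thesis using tw that a(1) unfolding torus_weight_def by auto
  qed simp
  then show ?thesis unfolding pairing_eq[OF x Fc] by (rule sum.neutral[OF ballI])
qed

lemma act_upper_in_weyl:
  assumes "x \<in> (weyl n \<mu> :: 'k tensor set)" and "upper n b"
  shows "act n (diagram \<mu>) b x \<in> weyl n \<mu>"
  using act_in_weyl[OF inf partitions_sequences[OF \<mu>] upper_mat_in_GL[OF assms(2)] assms(1)]
  unfolding act_mat .

end

section \<open>Multiplication by powers of flag minors\<close>

lemma partitions_shift:
  assumes \<mu>: "\<mu> \<in> partitions n" and \<nu>: "\<nu> \<in> partitions n"
  shows "\<mu> + seq_scale k \<nu> \<in> partitions n"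
proof -
  have "\<mu> j + k * \<nu> j \<le> \<mu> i + k * \<nu> i" if "i \<in> {1..n}" "j \<in> {1..n}" "i \<le> j" for i j
    using partitions_antimono[OF \<mu>, of i j] partitions_antimono[OF \<nu>, of i j] that
    by (intro add_mono mult_left_mono) simp_all
  then show ?thesis using \<mu> \<nu> by (simp add: partitions_def sequences_def seq_scale_def)
qed

text \<open>The hypotheses of the theorem for one pair of weights, with \<open>q\<close> as the shift. The assumption
  \<open>dominant\<close> is the condition of \<open>P(\<mu>)\<close>, with \<open>\<mu> (b + 1)\<close> added on both
  sides.\<close>
locale weight_shift =
  fixes n m q N :: nat and \<mu> \<nu> lam :: "nat \<Rightarrow> nat" and K :: "'k::field itself"
  assumes inf: "infinite (UNIV :: 'k set)"
    and prime_char: "prime CHAR('k)" and q: "q = CHAR('k) ^ N"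
    and \<mu>: "\<mu> \<in> partitions n" and \<nu>: "\<nu> \<in> partitions n"
    and \<nu>_len: "\<And>i. m \<le> i \<Longrightarrow> \<nu> i = 0" and \<mu>_len: "\<And>i. m < i \<Longrightarrow> \<mu> i = 0"
    and dominant: "\<And>b. Suc b < m \<Longrightarrow>
      (\<Sum>i\<le>b. \<mu> (Suc i)) + \<mu> (Suc (Suc b)) \<le> (\<Sum>i\<le>b. lam (Suc i)) + \<mu> (Suc b)"
    and q_large: "\<And>i. i \<le> n \<Longrightarrow> (\<Sum>a<i. \<mu> (Suc a)) < (\<Sum>a<i. lam (Suc a)) + q"
begin

abbreviation \<mu>' where "\<mu>' \<equiv> \<mu> + seq_scale q \<nu>"
abbreviation lam' where "lam' \<equiv> lam + seq_scale q \<nu>"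

abbreviation f :: "(nat \<times> nat \<Rightarrow> 'k) \<Rightarrow> 'k" where "f \<equiv> flag_minors \<nu>"

lemma \<mu>': "\<mu>' \<in> partitions n"
  by (rule partitions_shift[OF \<mu> \<nu>])

lemma seqs: "\<mu> \<in> sequences n" "\<nu> \<in> sequences n" "\<mu>' \<in> sequences n"
  using \<mu> \<nu> \<mu>' by (simp_all add: partitions_sequences)

lemma wt_shift: "wt n lam' b = wt n lam b * wt n \<nu> b ^ q" for b :: "nat \<times> nat \<Rightarrow> 'k"
  by (simp add: wt_def seq_scale_def power_add prod.distrib prod_power_distrib power_mult[symmetric] mult.commute)

lemma semi_invariant_f: "semi_invariant n \<nu> f"
  by (rule semi_invariant_bidet[OF \<nu> row_word_in_words[OF seqs(2)]])

lemma word_content_row_word: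
  assumes "a < n"
  shows "word_content (diagram \<nu>) (row_word \<nu>) a = \<nu> (Suc a)"
proof -
  have "{c \<in> diagram \<nu>. row_word \<nu> c = a} = Pair (Suc a) ` {1..\<nu> (Suc a)}"
    by (force simp: row_word_def diagram_def)
  then show ?thesis by (simp add: word_content_def card_image inj_on_def)
qed

text \<open>In a monomial without entries above the diagonal, the part of the first \<open>b + 1\<close> columns below
  row \<open>b\<close> has the size of the difference of partial sums of \<open>\<mu>'\<close> and \<open>\<rho>\<close>. In this
  difference the multiple of \<open>\<nu>\<close> cancels against that in \<open>lam'\<close>, and \<open>dominant\<close>
  applies. From row \<open>m\<close> on the multiple of \<open>\<nu>\<close> is absent and the column degree is
  enough.\<close>
lemma lower_exponents_bound:
  assumes cs: "\<And>b. b < n \<Longrightarrow> (\<Sum>a<n. e (a, b)) = \<mu>' (Suc b)"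
    and rs: "\<And>a. a < n \<Longrightarrow> (\<Sum>b<n. e (a, b)) = \<rho> a"
    and low: "\<And>a b. a < b \<Longrightarrow> b < n \<Longrightarrow> e (a, b) = 0"
    and \<rho>: "\<And>i. i \<le> n \<Longrightarrow> (\<Sum>a<i. lam' (Suc a)) \<le> (\<Sum>a<i. \<rho> a)"
    and b: "b < n"
  shows "(\<Sum>a\<in>{b<..<n}. e (a, b)) + \<mu> (Suc (Suc b)) \<le> \<mu> (Suc b)"
proof -
  let ?E = "\<Sum>a\<in>{b<..<n}. e (a, b)"
  have split: "(\<Sum>a<n. g a) = (\<Sum>a\<le>b. g a) + (\<Sum>a\<in>{b<..<n}. g a)" for g :: "nat \<Rightarrow> nat"
  proof -
    have "{..<n} = {..b} \<union> {b<..<n}" using b by auto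
    then have "(\<Sum>a<n. g a) = (\<Sum>a\<in>{..b} \<union> {b<..<n}. g a)" by (rule arg_cong)
    also have "\<dots> = (\<Sum>a\<le>b. g a) + (\<Sum>a\<in>{b<..<n}. g a)" by (rule sum.union_disjoint) auto
    finally show ?thesis .
  qed
  have E: "?E \<le> \<mu>' (Suc b)" using split[of "\<lambda>a. e (a, b)"] cs[OF b] by simp
  consider "Suc b < m" | "Suc b = m" | "m < Suc b" by linarith
  then show ?thesis
  proof cases
    case 1
    have "(\<Sum>a\<le>b. \<rho> a) = (\<Sum>a\<le>b. \<Sum>c\<le>b. e (a, c))"
    proof (intro sum.cong refl)
      fix a assume a: "a \<in> {..b}"
      have "\<rho> a = (\<Sum>c<n. e (a, c))" using rs[of a] a b by simp
      also have "\<dots> = (\<Sum>c\<le>b. e (a, c))"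
      proof (rule sum.mono_neutral_right)
        show "\<forall>c\<in>{..<n} - {..b}. e (a, c) = 0"
        proof
          fix c assume "c \<in> {..<n} - {..b}"
          then show "e (a, c) = 0" using a by (intro low) auto
        qed
      qed (use b in auto)
      finally show "\<rho> a = (\<Sum>c\<le>b. e (a, c))" .
    qed
    then have eq: "(\<Sum>a\<le>b. \<rho> a) = (\<Sum>c\<le>b. \<Sum>a\<le>b. e (a, c))" using sum.swap[of "\<lambda>a c. e (a, c)" "{..b}" "{..b}"] by (simp only:)
    have "(\<Sum>c\<le>b. \<mu>' (Suc c)) = (\<Sum>c\<le>b. (\<Sum>a\<le>b. e (a, c)) + (\<Sum>a\<in>{b<..<n}. e (a, c)))"
    proof (intro sum.cong refl)
      fix c assume "c \<in> {..b}"
      then have "c < n" using b by simp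
      show "\<mu>' (Suc c) = (\<Sum>a\<le>b. e (a, c)) + (\<Sum>a\<in>{b<..<n}. e (a, c))"
        using cs[OF \<open>c < n\<close>] split[of "\<lambda>a. e (a, c)"] by (simp only:)
    qed
    then have "(\<Sum>a\<le>b. \<rho> a) + (\<Sum>c\<le>b. \<Sum>a\<in>{b<..<n}. e (a, c)) = (\<Sum>c\<le>b. \<mu>' (Suc c))"
      unfolding eq sum.distrib by (rule sym)
    moreover have "?E \<le> (\<Sum>c\<le>b. \<Sum>a\<in>{b<..<n}. e (a, c))"
      by (rule member_le_sum[of b "{..b}" "\<lambda>c. \<Sum>a\<in>{b<..<n}. e (a, c)"]) auto
    moreover have "(\<Sum>a\<le>b. lam' (Suc a)) \<le> (\<Sum>a\<le>b. \<rho> a)"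
      using \<rho>[of "Suc b"] b by (simp add: lessThan_Suc_atMost)
    ultimately have "(\<Sum>a\<le>b. lam (Suc a)) + ?E \<le> (\<Sum>a\<le>b. \<mu> (Suc a))"
      by (simp add: sum.distrib)
    then show ?thesis using dominant[OF 1] by linarith
  next
    case 2
    then show ?thesis using E \<nu>_len[of "Suc b"] \<mu>_len[of "Suc (Suc b)"] by (simp add: seq_scale_def)
  next
    case 3
    then show ?thesis using E \<nu>_len[of "Suc b"] \<mu>_len[of "Suc b"] \<mu>_len[of "Suc (Suc b)"]
      by (simp add: seq_scale_def)
  qed
qed

text \<open>The diagonal entries of a lower unitriangular matrix are \<open>1\<close>, so the diagonal exponents can be
  changed to give the column degrees of \<open>\<mu>\<close>. By the bound, the diagonal letters fill at least those cells
  of a row that are not bottoms of columns.\<close>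
lemma monomial_is_bidet_on_lower_unitriangular:
  assumes low: "\<And>a b. a < b \<Longrightarrow> b < n \<Longrightarrow> e (a, b) = 0"
    and bound: "\<And>b. b < n \<Longrightarrow> (\<Sum>a\<in>{b<..<n}. e (a, b)) + \<mu> (Suc (Suc b)) \<le> \<mu> (Suc b)"
  shows "\<exists>w\<in>words n (diagram \<mu>). \<forall>u. lower_unitriangular n u \<longrightarrow>
    bidet \<mu> w u = (monomial (square n) e u :: 'k)"
proof -
  let ?E = "\<lambda>b. \<Sum>a\<in>{b<..<n}. e (a, b)"
  define d where "d = (\<lambda>(a, b). if a < n \<and> b < n then
    if a = b then \<mu> (Suc b) - ?E b else if b < a then e (a, b) else 0 else 0)"
  have supp: "d i = 0" if "i \<notin> square n" for i using that by (cases i) (auto simp: d_def)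
  have cs: "column_sums n \<mu> d"
    unfolding column_sums_def
  proof (intro allI impI)
    fix b assume b: "b < n"
    have "{..<n} = {..<b} \<union> (insert b {b<..<n})" using b by auto
    then have "(\<Sum>a<n. d (a, b)) = (\<Sum>a\<in>{..<b} \<union> (insert b {b<..<n}). d (a, b))" by simp
    also have "\<dots> = (\<Sum>a<b. d (a, b)) + (\<Sum>a\<in>insert b {b<..<n}. d (a, b))"
      by (rule sum.union_disjoint) auto
    also have "(\<Sum>a<b. d (a, b)) = 0" using b by (intro sum.neutral) (auto simp: d_def)
    also have "(\<Sum>a\<in>insert b {b<..<n}. d (a, b)) = d (b, b) + (\<Sum>a\<in>{b<..<n}. d (a, b))" by simp
    also have "(\<Sum>a\<in>{b<..<n}. d (a, b)) = ?E b" using b by (intro sum.cong) (auto simp: d_def)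
    finally show "(\<Sum>a<n. d (a, b)) = \<mu> (Suc b)" using b bound[OF b] by (simp add: d_def)
  qed
  let ?w = "filling \<mu> d"
  have w: "?w \<in> words n (diagram \<mu>)" by (rule filling_in_words[OF seqs(1) cs])
  have inner: "?w (i, j) = i - 1" if D: "(i, j) \<in> diagram \<mu>" "(Suc i, j) \<in> diagram \<mu>" for i j
  proof -
    obtain b where b: "i = Suc b" "b < n"
      using diagram_row_bounds[OF seqs(1) D(1)] by (cases i) auto
    have j: "1 \<le> j" "j \<le> (\<Sum>a<n. d (a, b))"
      using diagram_cell[OF seqs(1) cs D(1)] b by simp_all
    have zero: "(\<Sum>a<b. d (a, b)) = 0" using b by (intro sum.neutral) (auto simp: d_def)
    have "j \<le> d (b, b)"
      using D(2) bound[OF b(2)] b by (auto simp: diagram_def d_def)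
    then have "entry (\<lambda>a. d (a, b)) j = b"
      using entry_eq_iff[OF j, of b] zero j(1) by (simp add: lessThan_Suc_atMost[symmetric])
    then show ?thesis using D(1) b by (simp add: filling_def)
  qed
  have "bidet \<mu> ?w u = monomial (square n) e u" if u: "lower_unitriangular n u" for u :: "nat \<times> nat \<Rightarrow> 'k"
  proof -
    have sq: "(?w c, fst c - 1) \<in> square n" if "c \<in> diagram \<mu>" for c
      using words_less[OF w that] diagram_row_bounds(3)[OF seqs(1) that] by simp
    have "bidet \<mu> ?w u = (\<Prod>c\<in>diagram \<mu>. u (?w c, fst c - 1))"
      by (rule bidet_lower_unitriangular[OF \<mu> w u inner])
    also have "\<dots> = monomial (square n) (word_exponents (diagram \<mu>) ?w (\<lambda>c. fst c - 1)) u"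
      by (rule word_exponents_monomial[where w = ?w and f = "\<lambda>c. fst c - 1",
            OF finite_diagram[OF seqs(1)] sq, symmetric])
    also have "word_exponents (diagram \<mu>) ?w (\<lambda>c. fst c - 1) = d"
      by (rule word_exponents_filling[OF seqs(1) cs supp])
    also have "monomial (square n) d u = monomial (square n) e u"
      unfolding monomial_def
    proof (intro prod.cong refl)
      fix i assume "i \<in> square n"
      then obtain a b where i: "i = (a, b)" "a < n" "b < n" by auto
      consider "a = b" | "b < a" | "a < b" by linarith
      then show "u i ^ d i = u i ^ e i"
        using u i low[of a b] by cases (auto simp: d_def lower_unitriangular_def)
    qed
    finally show ?thesis .
  qed
  then show ?thesis using w by blast
qed

text \<open>Each monomial in the restriction to lower unitriangular matrices is the restriction of a
  bideterminant of shape \<open>\<mu>\<close>. The corresponding combination of bideterminants, multiplied by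
  the power of \<open>f\<close>, has the same restriction as \<open>F'\<close>.\<close>
lemma divisible:
  fixes F' :: "(nat \<times> nat \<Rightarrow> 'k) \<Rightarrow> 'k"
  assumes F': "semi_invariant n \<mu>' F'" "row_weight n \<rho> F'"
    and \<rho>: "\<And>i. i \<le> n \<Longrightarrow> (\<Sum>a<i. lam' (Suc a)) \<le> (\<Sum>a<i. \<rho> a)"
  shows "\<exists>F. semi_invariant n \<mu> F \<and> (\<forall>X. F' X = F X * f X ^ q)"
proof -
  obtain h where h: "expansion (square n) h F'"
    using F'(1) unfolding semi_invariant_def polynomial_on_def by blast
  let ?S = "{e. h e \<noteq> 0}"
  have finS: "finite ?S" using h unfolding expansion_def by blast
  define L where "L e \<longleftrightarrow> (\<forall>a b. a < b \<longrightarrow> b < n \<longrightarrow> e (a, b) = 0)" for e :: "nat \<times> nat \<Rightarrow> nat"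
  have "\<exists>w\<in>words n (diagram \<mu>). \<forall>u. lower_unitriangular n u \<longrightarrow> bidet \<mu> w u = (monomial (square n) e u :: 'k)"
    if "h e \<noteq> 0" "L e" for e
  proof (rule monomial_is_bidet_on_lower_unitriangular)
    show low: "e (a, b) = 0" if "a < b" "b < n" for a b using \<open>L e\<close> that by (simp add: L_def)
    show "(\<Sum>a\<in>{b<..<n}. e (a, b)) + \<mu> (Suc (Suc b)) \<le> \<mu> (Suc b)" if "b < n" for b
      using semi_invariant_column_degree[OF inf F'(1) h \<open>h e \<noteq> 0\<close>]
        row_weight_degree[OF inf F'(2) h \<open>h e \<noteq> 0\<close>] low \<rho> that
      by (rule lower_exponents_bound)
  qed
  then obtain W where W: "\<And>e. h e \<noteq> 0 \<Longrightarrow> L e \<Longrightarrow> W e \<in> words n (diagram \<mu>)"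
      "\<And>e u. h e \<noteq> 0 \<Longrightarrow> L e \<Longrightarrow> lower_unitriangular n u \<Longrightarrow> bidet \<mu> (W e) u = (monomial (square n) e u :: 'k)"
    by metis
  define F where "F X = (\<Sum>e\<in>{e\<in>?S. L e}. h e * bidet \<mu> (W e) X)" for X :: "nat \<times> nat \<Rightarrow> 'k"
  have F: "semi_invariant n \<mu> F"
    unfolding F_def using W(1) by (intro semi_invariant_sum semi_invariant_scale semi_invariant_bidet[OF \<mu>]) auto
  have Fu: "F u = F' u" if u: "lower_unitriangular n u" for u
  proof -
    have "F' u = (\<Sum>e\<in>?S. h e * monomial (square n) e u)" using h unfolding expansion_def by blast
    also have "\<dots> = (\<Sum>e\<in>{e\<in>?S. L e}. h e * monomial (square n) e u)"
    proof (intro sum.mono_neutral_right finS ballI)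
      fix e assume "e \<in> ?S - {e\<in>?S. L e}"
      then obtain a b where "a < b" "b < n" "e (a, b) \<noteq> 0" by (auto simp: L_def)
      then have "monomial (square n) e u = 0" using monomial_lower_unitriangular_zero[OF u, of a b e] by simp
      then show "h e * monomial (square n) e u = 0" by simp
    qed blast
    also have "\<dots> = F u" unfolding F_def using W(2) u by (intro sum.cong) auto
    finally show ?thesis by simp
  qed
  have "F' X + (-1) * (F X * f X ^ q) = 0" for X
  proof (rule semi_invariant_zero_if_zero_on_lower_unitriangular[OF inf,
        where n = n and \<mu> = \<mu>' and F = "\<lambda>X. F' X + (-1) * (F X * f X ^ q)"])
    show "semi_invariant n \<mu>' (\<lambda>X. F' X + (-1) * (F X * f X ^ q))"
      by (intro semi_invariant_add[OF F'(1)] semi_invariant_scale semi_invariant_mult_power F semi_invariant_f)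
    show "F' u + (-1) * (F u * f u ^ q) = 0" if "lower_unitriangular n u" for u
      using Fu[OF that] flag_minors_lower_unitriangular[OF \<nu> that] by simp
  qed
  then have "F' X = F X * f X ^ q" for X by (simp add: algebra_simps)
  then show ?thesis using F by blast
qed

lemma cancel_f:
  fixes F :: "(nat \<times> nat \<Rightarrow> 'k) \<Rightarrow> 'k"
  assumes "semi_invariant n \<mu> F" and "\<And>X. F X * f X ^ q = 0"
  shows "F X = 0"
proof (rule semi_invariant_zero_if_zero_on_lower_unitriangular[OF inf assms(1)])
  show "F u = 0" if "lower_unitriangular n u" for u
    using assms(2)[of u] flag_minors_lower_unitriangular[OF \<nu> that] by simp
qed

text \<open>In characteristic \<open>p\<close> the power of the translated function is the sum of the powers of its terms.
  A term other than the leading one lowers a partial sum of the row weight by at least \<open>q\<close>, and by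
  \<open>q_large\<close> no function in \<open>V(\<mu>)\<close> has a row weight that compensates for this.\<close>
lemma pairing_translate_f:
  assumes x: "x \<in> (weyl n \<mu>' :: 'k tensor set)" and tw: "torus_weight n \<mu>' lam' x"
    and F: "semi_invariant n \<mu> F" and b: "upper n b"
  shows "pairing n \<mu>' x (\<lambda>X. F X * f (mmul n b X) ^ q) =
    wt n \<nu> b ^ q * pairing n \<mu>' x (\<lambda>X. F X * f X ^ q)"
proof -
  let ?V = "words n (diagram \<nu>)" and ?W = "words n (diagram \<mu>)"
  note rw = row_word_in_words[OF seqs(2)]
  have finV: "finite ?V" by (rule finite_words[OF finite_diagram[OF seqs(2)]])
  define p where "p u = (\<Prod>c\<in>diagram \<nu>. b (row_word \<nu> c, u c))" for u
  have semi: "semi_invariant n \<mu>' (\<lambda>X. G X * bidet \<nu> u X ^ q)"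
    if "semi_invariant n \<mu> G" "u \<in> ?V" for G u
    by (rule semi_invariant_mult_power[OF that(1) semi_invariant_bidet[OF \<nu> that(2)]])
  have expand: "F X * f (mmul n b X) ^ q = (\<Sum>u\<in>?V. p u ^ q * (F X * bidet \<nu> u X ^ q))" for X
  proof -
    have "f (mmul n b X) = (\<Sum>u\<in>?V. p u * bidet \<nu> u X)"
      unfolding p_def by (rule bidet_left[OF seqs(2) rw])
    then have "f (mmul n b X) ^ q = (\<Sum>u\<in>?V. (p u * bidet \<nu> u X) ^ q)"
      using freshmans_dream_sum'[OF prime_char q] by simp
    then show ?thesis by (simp add: sum_distrib_left power_mult_distrib mult.left_commute)
  qed
  have vanish: "p u ^ q * pairing n \<mu>' x (\<lambda>X. F X * bidet \<nu> u X ^ q) = 0"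
    if u: "u \<in> ?V" "u \<noteq> row_word \<nu>" for u
  proof (cases "p u = 0")
    case True
    have "0 < CHAR('k)" by (rule prime_gt_0_nat[OF prime_char])
    then have "q \<noteq> 0" unfolding q by simp
    then show ?thesis using True by simp
  next
    case False
    have ge: "row_word \<nu> c \<le> u c" if c: "c \<in> diagram \<nu>" for c
    proof (rule ccontr)
      assume "\<not> ?thesis"
      then have "b (row_word \<nu> c, u c) = 0" using b words_less[OF rw c] by (simp add: upper_def)
      then have "p u = 0" unfolding p_def using c finite_diagram[OF seqs(2)] by (intro prod_zero) auto
      then show False using False by simp
    qed
    obtain c where c: "u c \<noteq> row_word \<nu> c" using u(2) by (metis ext)
    then have cD: "c \<in> diagram \<nu>" using words_outside[OF u(1)] words_outside[OF rw] by metis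
    \<comment> \<open>The partial sum of the weight of \<open>u\<close> is smaller than that of the row word at this place.\<close>
    define i where "i = u c"
    have i: "i < n" unfolding i_def by (rule words_less[OF u(1) cD])
    have "card {c \<in> diagram \<nu>. u c < i} < card {c \<in> diagram \<nu>. row_word \<nu> c < i}"
    proof (rule psubset_card_mono)
      show "finite {c \<in> diagram \<nu>. row_word \<nu> c < i}" using finite_diagram[OF seqs(2)] by simp
      have "c \<in> {c \<in> diagram \<nu>. row_word \<nu> c < i}" "c \<notin> {c \<in> diagram \<nu>. u c < i}"
        using cD c ge[OF cD] by (auto simp: i_def)
      moreover have "{c \<in> diagram \<nu>. u c < i} \<subseteq> {c \<in> diagram \<nu>. row_word \<nu> c < i}"
      proof (rule subsetI)
        fix e assume "e \<in> {c \<in> diagram \<nu>. u c < i}"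
        then show "e \<in> {c \<in> diagram \<nu>. row_word \<nu> c < i}" using ge[of e] by simp
      qed
      ultimately show "{c \<in> diagram \<nu>. u c < i} \<subset> {c \<in> diagram \<nu>. row_word \<nu> c < i}" by blast
    qed
    then have "(\<Sum>a<i. word_content (diagram \<nu>) u a) < (\<Sum>a<i. word_content (diagram \<nu>) (row_word \<nu>) a)"
      by (simp add: sum_word_content[OF finite_diagram[OF seqs(2)]])
    also have "\<dots> = (\<Sum>a<i. \<nu> (Suc a))" using i by (intro sum.cong) (auto simp: word_content_row_word)
    finally have less: "(\<Sum>a<i. word_content (diagram \<nu>) u a) + 1 \<le> (\<Sum>a<i. \<nu> (Suc a))" by simp
    have zero: "pairing n \<mu>' x (\<lambda>X. bidet \<mu> v X * bidet \<nu> u X ^ q) = 0" if v: "v \<in> ?W" for v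
    proof (cases "\<forall>X :: nat \<times> nat \<Rightarrow> 'k. bidet \<mu> v X = 0")
      case True
      then show ?thesis by (simp add: pairing_fun_0[OF inf \<mu>' x])
    next
      case False
      then obtain X :: "nat \<times> nat \<Rightarrow> 'k" where X: "bidet \<mu> v X \<noteq> 0" by blast
      let ?\<rho> = "\<lambda>a. word_content (diagram \<mu>) v a + q * word_content (diagram \<nu>) u a"
      have "\<exists>a<i. ?\<rho> a \<noteq> lam' (Suc a)"
      proof (rule ccontr)
        assume "\<not> ?thesis"
        then have "(\<Sum>a<i. ?\<rho> a) = (\<Sum>a<i. lam' (Suc a))" by (intro sum.cong) auto
        then have "(\<Sum>a<i. word_content (diagram \<mu>) v a) + q * (\<Sum>a<i. word_content (diagram \<nu>) u a) =
            (\<Sum>a<i. lam (Suc a)) + q * (\<Sum>a<i. \<nu> (Suc a))"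
          by (simp add: sum.distrib sum_distrib_left seq_scale_def)
        moreover have "q * (\<Sum>a<i. word_content (diagram \<nu>) u a) + q \<le> q * (\<Sum>a<i. \<nu> (Suc a))"
          using mult_le_mono2[OF less, of q] by (simp add: distrib_left)
        moreover have "(\<Sum>a<i. word_content (diagram \<mu>) v a) \<le> (\<Sum>a<i. \<mu> (Suc a))"
          using row_weight_dominated[OF inf semi_invariant_bidet[OF \<mu> v] row_weight_bidet[OF seqs(1) v] X] i
          by simp
        ultimately show False using q_large[of i] i by linarith
      qed
      then obtain a where "a < i" and a': "?\<rho> a \<noteq> lam' (Suc a)" by blast
      then have a: "a < n" "?\<rho> a \<noteq> lam' (Suc a)" using i by simp_all
      show ?thesis
        by (rule pairing_weight_zero[OF inf \<mu>' x tw semi[OF semi_invariant_bidet[OF \<mu> v] u(1)]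
              row_weight_mult_power[OF row_weight_bidet[OF seqs(1) v] row_weight_bidet[OF seqs(2) u(1)]] a])
    qed
    obtain k where k: "\<And>X. F X = (\<Sum>v\<in>?W. k v * bidet \<mu> v X)"
      using semi_invariant_coeffs[OF inf \<mu> F] by blast
    have "pairing n \<mu>' x (\<lambda>X. F X * bidet \<nu> u X ^ q) =
        pairing n \<mu>' x (\<lambda>X. \<Sum>v\<in>?W. k v * (bidet \<mu> v X * bidet \<nu> u X ^ q))"
      by (simp add: k sum_distrib_right mult.assoc)
    also have "\<dots> = (\<Sum>v\<in>?W. pairing n \<mu>' x (\<lambda>X. k v * (bidet \<mu> v X * bidet \<nu> u X ^ q)))"
      by (intro pairing_fun_sum[OF inf \<mu>' x] semi_invariant_scale semi semi_invariant_bidet[OF \<mu>] u(1))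
    also have "\<dots> = 0"
    proof (rule sum.neutral, rule ballI)
      fix v assume v: "v \<in> ?W"
      show "pairing n \<mu>' x (\<lambda>X. k v * (bidet \<mu> v X * bidet \<nu> u X ^ q)) = 0"
        unfolding pairing_fun_scale[OF inf \<mu>' x semi[OF semi_invariant_bidet[OF \<mu> v] u(1)]] zero[OF v]
        by simp
    qed
    finally show ?thesis by simp
  qed
  have "pairing n \<mu>' x (\<lambda>X. F X * f (mmul n b X) ^ q) =
      (\<Sum>u\<in>?V. pairing n \<mu>' x (\<lambda>X. p u ^ q * (F X * bidet \<nu> u X ^ q)))"
    unfolding expand by (intro pairing_fun_sum[OF inf \<mu>' x] semi_invariant_scale semi F)
  also have "\<dots> = (\<Sum>u\<in>?V. if u = row_word \<nu> then p u ^ q * pairing n \<mu>' x (\<lambda>X. F X * bidet \<nu> u X ^ q) else 0)"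
  proof (intro sum.cong refl)
    fix u assume u: "u \<in> ?V"
    have "pairing n \<mu>' x (\<lambda>X. p u ^ q * (F X * bidet \<nu> u X ^ q)) =
        p u ^ q * pairing n \<mu>' x (\<lambda>X. F X * bidet \<nu> u X ^ q)"
      by (rule pairing_fun_scale[OF inf \<mu>' x semi[OF F u]])
    then show "pairing n \<mu>' x (\<lambda>X. p u ^ q * (F X * bidet \<nu> u X ^ q)) =
        (if u = row_word \<nu> then p u ^ q * pairing n \<mu>' x (\<lambda>X. F X * bidet \<nu> u X ^ q) else 0)"
      using vanish[OF u] by (cases "u = row_word \<nu>") simp_all
  qed
  also have "\<dots> = p (row_word \<nu>) ^ q * pairing n \<mu>' x (\<lambda>X. F X * f X ^ q)"
    using finV rw by simp
  finally have eq: "pairing n \<mu>' x (\<lambda>X. F X * f (mmul n b X) ^ q) =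
      p (row_word \<nu>) ^ q * pairing n \<mu>' x (\<lambda>X. F X * f X ^ q)" .
  have "p (row_word \<nu>) = wt n \<nu> b"
  proof -
    have "p (row_word \<nu>) = (\<Prod>c\<in>diagram \<nu>. (\<lambda>i. b (i, i)) (fst c - 1))"
      unfolding p_def by (intro prod.cong) (auto simp: row_word_def)
    also have "\<dots> = wt n \<nu> b" unfolding wt_def by (rule diagram_prod_rows[OF seqs(2)])
    finally show ?thesis .
  qed
  then show ?thesis by (simp only: eq)
qed

end

section \<open>Comparison of primitive vectors\<close>

context weight_shift
begin

text \<open>The transpose of the multiplication by the power of \<open>f\<close>.\<close>
definition restrict_weight :: "'k tensor \<Rightarrow> 'k tensor" where
  "restrict_weight x = (\<lambda>w. if w \<in> words n (diagram \<mu>)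
     then pairing n \<mu>' x (\<lambda>X. bidet \<mu> w X * f X ^ q) else 0)"

lemma semi_invariant_times_f:
  "semi_invariant n \<mu> F \<Longrightarrow> semi_invariant n \<mu>' (\<lambda>X. F X * f X ^ q)"
  by (rule semi_invariant_mult_power[OF _ semi_invariant_f])

lemma pairing_combination:
  assumes x: "x \<in> weyl n \<mu>'"
    and F: "\<And>X. F X = (\<Sum>w\<in>words n (diagram \<mu>). c w * bidet \<mu> w X)"
  shows "(\<Sum>w\<in>words n (diagram \<mu>). c w * restrict_weight x w) =
    pairing n \<mu>' x (\<lambda>X. F X * f X ^ q)"
proof -
  let ?W = "words n (diagram \<mu>)"
  have semi: "semi_invariant n \<mu>' (\<lambda>X. bidet \<mu> w X * f X ^ q)" if "w \<in> ?W" for w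
    by (rule semi_invariant_times_f[OF semi_invariant_bidet[OF \<mu> that]])
  have "pairing n \<mu>' x (\<lambda>X. F X * f X ^ q) =
      pairing n \<mu>' x (\<lambda>X. \<Sum>w\<in>?W. c w * (bidet \<mu> w X * f X ^ q))"
    by (simp add: F sum_distrib_right mult.assoc)
  also have "\<dots> = (\<Sum>w\<in>?W. pairing n \<mu>' x (\<lambda>X. c w * (bidet \<mu> w X * f X ^ q)))"
    by (intro pairing_fun_sum[OF inf \<mu>' x] semi_invariant_scale semi)
  also have "\<dots> = (\<Sum>w\<in>?W. c w * restrict_weight x w)"
  proof (intro sum.cong refl)
    fix w assume w: "w \<in> ?W"
    show "pairing n \<mu>' x (\<lambda>X. c w * (bidet \<mu> w X * f X ^ q)) = c w * restrict_weight x w"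
      unfolding pairing_fun_scale[OF inf \<mu>' x semi[OF w]] using w by (simp add: restrict_weight_def)
  qed
  finally show ?thesis by simp
qed

lemma restrict_weight_in_weyl:
  assumes x: "x \<in> weyl n \<mu>'"
  shows "restrict_weight x \<in> weyl n \<mu>"
proof (rule weylI[OF inf seqs(1)])
  show "restrict_weight x \<in> tensors n (diagram \<mu>)" by (simp add: restrict_weight_def tensors_def)
  fix c :: "(cell \<Rightarrow> nat) \<Rightarrow> 'k"
  assume c: "\<And>X. (\<Sum>w\<in>words n (diagram \<mu>). c w * bidet \<mu> w X) = 0"
  have "(\<Sum>w\<in>words n (diagram \<mu>). c w * restrict_weight x w) =
      pairing n \<mu>' x (\<lambda>X. (\<lambda>X. 0) X * f X ^ q)"
    by (rule pairing_combination[OF x]) (simp only: c)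
  then show "(\<Sum>w\<in>words n (diagram \<mu>). c w * restrict_weight x w) = 0"
    by (simp add: pairing_fun_0[OF inf \<mu>' x])
qed

lemma pairing_restrict_weight:
  assumes x: "x \<in> weyl n \<mu>'" and F: "semi_invariant n \<mu> F"
  shows "pairing n \<mu> (restrict_weight x) F = pairing n \<mu>' x (\<lambda>X. F X * f X ^ q)"
proof -
  obtain c where c: "\<And>X. F X = (\<Sum>w\<in>words n (diagram \<mu>). c w * bidet \<mu> w X)"
    using semi_invariant_coeffs[OF inf \<mu> F] by blast
  show ?thesis
    unfolding pairing_eq[OF inf \<mu> restrict_weight_in_weyl[OF x] c] by (rule pairing_combination[OF x c])
qed

text \<open>By \<open>pairing_translate_f\<close>, the multiplier behaves towards \<open>x\<close> like an eigenfunction for left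
  translation.\<close>
lemma restrict_weight_primitive:
  assumes x: "x \<in> primitives n \<mu>' lam'"
  shows "restrict_weight x \<in> primitives n \<mu> lam"
proof -
  have xw: "x \<in> weyl n \<mu>'" using x by (simp add: primitives_def)
  have tw: "torus_weight n \<mu>' lam' x" by (rule primitives_torus_weight[OF inf seqs(3) x])
  have "act n (diagram \<mu>) b (restrict_weight x) = tensor_scale (wt n lam b) (restrict_weight x)"
    if b: "upper n b" for b
  proof
    fix w
    show "act n (diagram \<mu>) b (restrict_weight x) w = tensor_scale (wt n lam b) (restrict_weight x) w"
    proof (cases "w \<in> words n (diagram \<mu>)")
      case False
      then show ?thesis by (simp add: act_def restrict_weight_def tensor_scale_def)
    next
      case w: True
      have semi: "semi_invariant n \<mu> (bidet \<mu> w)" by (rule semi_invariant_bidet[OF \<mu> w])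
      have trans: "semi_invariant n \<mu> (\<lambda>X. bidet \<mu> w (mmul n b X))"
        by (rule semi_invariant_translate[OF inf \<mu> semi])
      have "act n (diagram \<mu>) b (restrict_weight x) w =
          (\<Sum>u\<in>words n (diagram \<mu>). (\<Prod>c\<in>diagram \<mu>. b (w c, u c)) * restrict_weight x u)"
        using w by (simp add: act_def)
      also have "\<dots> = pairing n \<mu>' x (\<lambda>X. bidet \<mu> w (mmul n b X) * f X ^ q)"
        by (rule pairing_combination[OF xw bidet_left[OF seqs(1) w]])
      finally have lhs: "act n (diagram \<mu>) b (restrict_weight x) w =
          pairing n \<mu>' x (\<lambda>X. bidet \<mu> w (mmul n b X) * f X ^ q)" .
      have "wt n \<nu> b ^ q * pairing n \<mu>' x (\<lambda>X. bidet \<mu> w (mmul n b X) * f X ^ q) =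
          pairing n \<mu>' x (\<lambda>X. bidet \<mu> w (mmul n b X) * f (mmul n b X) ^ q)"
        by (rule pairing_translate_f[OF xw tw trans b, symmetric])
      also have "\<dots> = pairing n \<mu>' (act n (diagram \<mu>') b x) (\<lambda>X. bidet \<mu> w X * f X ^ q)"
        by (rule pairing_translate[OF inf \<mu>' xw act_upper_in_weyl[OF inf \<mu>' xw b] semi_invariant_times_f[OF semi]])
      also have "\<dots> = wt n lam' b * pairing n \<mu>' x (\<lambda>X. bidet \<mu> w X * f X ^ q)"
        using x b by (simp add: primitives_def pairing_scale)
      also have "\<dots> = wt n \<nu> b ^ q * (wt n lam b * restrict_weight x w)"
        using w by (simp add: wt_shift restrict_weight_def mult_ac)
      finally have "pairing n \<mu>' x (\<lambda>X. bidet \<mu> w (mmul n b X) * f X ^ q) = wt n lam b * restrict_weight x w"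
        using wt_nonzero[OF b, of \<nu>] by simp
      then show ?thesis using lhs by (simp add: tensor_scale_def)
    qed
  qed
  then show ?thesis using restrict_weight_in_weyl[OF xw] unfolding primitives_def by blast
qed

lemma divisible_bidet:
  assumes w: "w \<in> words n (diagram \<mu>')"
    and above: "\<And>i. i \<le> n \<Longrightarrow> (\<Sum>a<i. lam' (Suc a)) \<le> (\<Sum>a<i. word_content (diagram \<mu>') w a)"
  shows "\<exists>F. semi_invariant n \<mu> F \<and> (\<forall>X. bidet \<mu>' w X = F X * f X ^ q)"
  by (rule divisible[OF semi_invariant_bidet[OF \<mu>' w] row_weight_bidet[OF seqs(3) w] above])

text \<open>The functions of weight \<open>lam'\<close> are all divisible by the power of \<open>f\<close>.\<close>
lemma restrict_weight_inj:
  assumes x: "x \<in> primitives n \<mu>' lam'" and 0: "restrict_weight x = 0"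
  shows "x = 0"
proof
  have xw: "x \<in> weyl n \<mu>'" using x by (simp add: primitives_def)
  have tw: "torus_weight n \<mu>' lam' x" by (rule primitives_torus_weight[OF inf seqs(3) x])
  fix w
  show "x w = 0 w"
  proof (cases "w \<in> words n (diagram \<mu>') \<and> (\<forall>a<n. word_content (diagram \<mu>') w a = lam' (Suc a))")
    case True
    then have w: "w \<in> words n (diagram \<mu>')" by blast
    have "(\<Sum>a<i. lam' (Suc a)) \<le> (\<Sum>a<i. word_content (diagram \<mu>') w a)" if "i \<le> n" for i
      using True that by (intro sum_mono) simp
    then obtain F where F: "semi_invariant n \<mu> F" "\<And>X. bidet \<mu>' w X = F X * f X ^ q"
      using divisible_bidet[OF w] by blast
    have "x w = pairing n \<mu>' x (bidet \<mu>' w)" by (rule pairing_bidet[OF inf \<mu>' xw w, symmetric])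
    also have "bidet \<mu>' w = (\<lambda>X. F X * f X ^ q)" using F(2) by (rule ext)
    also have "pairing n \<mu>' x (\<lambda>X. F X * f X ^ q) = pairing n \<mu> (restrict_weight x) F"
      by (rule pairing_restrict_weight[OF xw F(1), symmetric])
    also have "\<dots> = 0" by (simp add: 0 pairing_def)
    finally show ?thesis by simp
  next
    case False
    then show ?thesis
      using tw weyl_subset_tensors[OF inf seqs(3)] xw unfolding torus_weight_def tensors_def by auto
  qed
qed

text \<open>The preimage \<open>y\<close> is \<open>0\<close> outside the weight \<open>lam'\<close> and is defined by division by the
  power of \<open>f\<close> in this weight. For its primitivity one tests with a bideterminant of any row
  weight. If this weight is above \<open>lam'\<close>, the bideterminant is divisible, too, and
  \<open>pairing_translate_f\<close> applies. Otherwise, since translation by upper triangular matrices lowers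
  weights, no translate has a component of weight \<open>lam'\<close>.\<close>
lemma restrict_weight_surj:
  assumes x: "x \<in> primitives n \<mu> lam"
  shows "\<exists>y\<in>primitives n \<mu>' lam'. restrict_weight y = x"
proof -
  let ?W = "words n (diagram \<mu>)" and ?W' = "words n (diagram \<mu>')"
  have xw: "x \<in> weyl n \<mu>" using x by (simp add: primitives_def)
  have twx: "torus_weight n \<mu> lam x" by (rule primitives_torus_weight[OF inf seqs(1) x])
  have finW': "finite ?W'" by (rule finite_words[OF finite_diagram[OF seqs(3)]])
  define U where "U = {w\<in>?W'. \<forall>a<n. word_content (diagram \<mu>') w a = lam' (Suc a)}"
  have UW: "U \<subseteq> ?W'" unfolding U_def by blast
  have "\<exists>F. semi_invariant n \<mu> F \<and> (\<forall>X. bidet \<mu>' w X = F X * f X ^ q)" if w: "w \<in> U" for w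
  proof (rule divisible_bidet)
    show "w \<in> ?W'" using w by (simp add: U_def)
    show "(\<Sum>a<i. lam' (Suc a)) \<le> (\<Sum>a<i. word_content (diagram \<mu>') w a)" if "i \<le> n" for i
      using w that unfolding U_def by (intro sum_mono) simp
  qed
  then obtain Q where Q: "\<And>w. w \<in> U \<Longrightarrow> semi_invariant n \<mu> (Q w)"
      "\<And>w X. w \<in> U \<Longrightarrow> bidet \<mu>' w X = Q w X * f X ^ q" by metis
  define y where "y = (\<lambda>w. if w \<in> U then pairing n \<mu> x (Q w) else 0)"
  have combine: "(\<Sum>w\<in>?W'. c w * y w) = pairing n \<mu> x (\<lambda>X. \<Sum>w\<in>U. c w * Q w X)" for c
  proof -
    have "(\<Sum>w\<in>?W'. c w * y w) = (\<Sum>w\<in>U. c w * y w)"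
      using UW finW' by (intro sum.mono_neutral_right) (auto simp: y_def)
    also have "\<dots> = (\<Sum>w\<in>U. pairing n \<mu> x (\<lambda>X. c w * Q w X))"
    proof (intro sum.cong refl)
      fix w assume w: "w \<in> U"
      show "c w * y w = pairing n \<mu> x (\<lambda>X. c w * Q w X)"
        unfolding pairing_fun_scale[OF inf \<mu> xw Q(1)[OF w]] using w by (simp add: y_def)
    qed
    also have "\<dots> = pairing n \<mu> x (\<lambda>X. \<Sum>w\<in>U. c w * Q w X)"
      by (intro pairing_fun_sum[OF inf \<mu> xw, symmetric] semi_invariant_scale Q(1))
    finally show ?thesis .
  qed
  have yw: "y \<in> weyl n \<mu>'"
  proof (rule weylI[OF inf seqs(3)])
    show "y \<in> tensors n (diagram \<mu>')" using UW by (auto simp: y_def tensors_def)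
    fix c :: "(cell \<Rightarrow> nat) \<Rightarrow> 'k"
    assume c: "\<And>X. (\<Sum>w\<in>?W'. c w * bidet \<mu>' w X) = 0"
    have "(\<Sum>w\<in>{w\<in>?W'. \<forall>a<n. word_content (diagram \<mu>') w a = lam' (Suc a)}. c w * bidet \<mu>' w X) = 0" for X
      by (rule row_weight_component_zero[OF inf finW' _ c])
        (rule row_weight_scale[OF row_weight_bidet[OF seqs(3)]])
    then have U0: "(\<Sum>w\<in>U. c w * bidet \<mu>' w X) = 0" for X by (simp only: U_def)
    have "(\<Sum>w\<in>U. c w * Q w X) = 0" for X
    proof (rule cancel_f[where F = "\<lambda>X. \<Sum>w\<in>U. c w * Q w X"])
      show "semi_invariant n \<mu> (\<lambda>X. \<Sum>w\<in>U. c w * Q w X)"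
        by (intro semi_invariant_sum semi_invariant_scale Q(1))
      show "(\<Sum>w\<in>U. c w * Q w X) * f X ^ q = 0" for X
      proof -
        have "(\<Sum>w\<in>U. c w * Q w X) * f X ^ q = (\<Sum>w\<in>U. c w * bidet \<mu>' w X)"
          unfolding sum_distrib_right by (intro sum.cong refl) (simp only: Q(2) mult.assoc)
        then show ?thesis using U0 by simp
      qed
    qed
    then show "(\<Sum>w\<in>?W'. c w * y w) = 0"
      unfolding combine by (simp only: pairing_fun_0[OF inf \<mu> xw])
  qed
  have twy: "torus_weight n \<mu>' lam' y" by (auto simp: torus_weight_def y_def U_def)
  have restrict: "restrict_weight y = x"
  proof
    fix w
    show "restrict_weight y w = x w"
    proof (cases "w \<in> ?W")
      case False
      then show ?thesis using weyl_subset_tensors[OF inf seqs(1)] xw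
        by (auto simp: restrict_weight_def tensors_def)
    next
      case w: True
      let ?\<rho> = "\<lambda>a. word_content (diagram \<mu>) w a + q * \<nu> (Suc a)"
      have semi: "semi_invariant n \<mu>' (\<lambda>X. bidet \<mu> w X * f X ^ q)"
        by (rule semi_invariant_times_f[OF semi_invariant_bidet[OF \<mu> w]])
      have rw: "row_weight n ?\<rho> (\<lambda>X. bidet \<mu> w X * f X ^ q)"
      proof -
        have "row_weight n (\<lambda>a. word_content (diagram \<mu>) w a + q * word_content (diagram \<nu>) (row_word \<nu>) a)
            (\<lambda>X. bidet \<mu> w X * f X ^ q)"
          by (rule row_weight_mult_power[OF row_weight_bidet[OF seqs(1) w]
                row_weight_bidet[OF seqs(2) row_word_in_words[OF seqs(2)]]])
        then show ?thesis unfolding row_weight_def by (simp add: word_content_row_word)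
      qed
      have eq: "restrict_weight y w = pairing n \<mu>' y (\<lambda>X. bidet \<mu> w X * f X ^ q)"
        using w by (simp add: restrict_weight_def)
      show ?thesis
      proof (cases "\<forall>a<n. word_content (diagram \<mu>) w a = lam (Suc a)")
        case False
        then obtain a where a: "a < n" "word_content (diagram \<mu>) w a \<noteq> lam (Suc a)" by blast
        have "restrict_weight y w = 0"
          unfolding eq by (rule pairing_weight_zero[OF inf \<mu>' yw twy semi rw a(1)])
            (use a(2) in \<open>simp add: seq_scale_def\<close>)
        moreover have "x w = 0" using twx w a unfolding torus_weight_def by blast
        ultimately show ?thesis by simp
      next
        case True
        obtain c where c: "\<And>w. c w \<noteq> 0 \<Longrightarrow> \<forall>a<n. word_content (diagram \<mu>') w a = ?\<rho> a"
            and exp: "\<And>X. bidet \<mu> w X * f X ^ q = (\<Sum>u\<in>?W'. c u * bidet \<mu>' u X)"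
          using semi_invariant_weight_component[OF inf \<mu>' semi rw] by blast
        have cU: "c u = 0" if "u \<in> ?W' - U" for u
          using c[of u] that True by (auto simp: U_def seq_scale_def)
        have "bidet \<mu> w X + (-1) * (\<Sum>u\<in>U. c u * Q u X) = 0" for X
        proof (rule cancel_f[where F = "\<lambda>X. bidet \<mu> w X + (-1) * (\<Sum>u\<in>U. c u * Q u X)"])
          show "semi_invariant n \<mu> (\<lambda>X. bidet \<mu> w X + (-1) * (\<Sum>u\<in>U. c u * Q u X))"
            by (intro semi_invariant_add semi_invariant_bidet[OF \<mu> w] semi_invariant_scale
                semi_invariant_sum Q(1))
          fix X :: "nat \<times> nat \<Rightarrow> 'k"
          have "(\<Sum>u\<in>U. c u * Q u X) * f X ^ q = (\<Sum>u\<in>U. c u * bidet \<mu>' u X)"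
            unfolding sum_distrib_right by (intro sum.cong refl) (simp only: Q(2) mult.assoc)
          also have "\<dots> = (\<Sum>u\<in>?W'. c u * bidet \<mu>' u X)"
            using UW finW' cU by (intro sum.mono_neutral_left) auto
          also have "\<dots> = bidet \<mu> w X * f X ^ q" by (rule exp[symmetric])
          finally have "(\<Sum>u\<in>U. c u * Q u X) * f X ^ q = bidet \<mu> w X * f X ^ q" .
          then show "(bidet \<mu> w X + (-1) * (\<Sum>u\<in>U. c u * Q u X)) * f X ^ q = 0"
            by (simp only: distrib_right mult.assoc) simp
        qed
        then have bw: "bidet \<mu> w = (\<lambda>X. \<Sum>u\<in>U. c u * Q u X)" by (simp add: fun_eq_iff)
        have "restrict_weight y w = (\<Sum>u\<in>?W'. c u * y u)"
          unfolding eq by (rule pairing_eq[OF inf \<mu>' yw exp])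
        also have "\<dots> = pairing n \<mu> x (bidet \<mu> w)" unfolding combine bw ..
        also have "\<dots> = x w" by (rule pairing_bidet[OF inf \<mu> xw w])
        finally show ?thesis .
      qed
    qed
  qed
  have "act n (diagram \<mu>') b y = tensor_scale (wt n lam' b) y" if b: "upper n b" for b
  proof
    fix w
    show "act n (diagram \<mu>') b y w = tensor_scale (wt n lam' b) y w"
    proof (cases "w \<in> ?W'")
      case False
      then show ?thesis using UW by (auto simp: act_def y_def tensor_scale_def)
    next
      case w: True
      show ?thesis
      proof (cases "\<forall>i\<le>n. (\<Sum>a<i. lam' (Suc a)) \<le> (\<Sum>a<i. word_content (diagram \<mu>') w a)")
        case True
        then obtain F where F: "semi_invariant n \<mu> F" "\<And>X. bidet \<mu>' w X = F X * f X ^ q"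
          using divisible_bidet[OF w] by blast
        have trans: "semi_invariant n \<mu> (\<lambda>X. F (mmul n b X))"
          by (rule semi_invariant_translate[OF inf \<mu> F(1)])
        have xF: "pairing n \<mu> x F = y w"
        proof -
          have "pairing n \<mu> x F = pairing n \<mu>' y (\<lambda>X. F X * f X ^ q)"
            using pairing_restrict_weight[OF yw F(1)] unfolding restrict .
          also have "\<dots> = pairing n \<mu>' y (bidet \<mu>' w)" unfolding F(2)[symmetric] ..
          also have "\<dots> = y w" by (rule pairing_bidet[OF inf \<mu>' yw w])
          finally show ?thesis .
        qed
        have "act n (diagram \<mu>') b y w = pairing n \<mu>' (act n (diagram \<mu>') b y) (bidet \<mu>' w)"
          by (rule pairing_bidet[OF inf \<mu>' act_upper_in_weyl[OF inf \<mu>' yw b] w, symmetric])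
        also have "\<dots> = pairing n \<mu>' y (\<lambda>X. bidet \<mu>' w (mmul n b X))"
          by (rule pairing_translate[OF inf \<mu>' yw act_upper_in_weyl[OF inf \<mu>' yw b]
                semi_invariant_bidet[OF \<mu>' w], symmetric])
        also have "\<dots> = pairing n \<mu>' y (\<lambda>X. F (mmul n b X) * f (mmul n b X) ^ q)"
          by (simp only: F(2))
        also have "\<dots> = wt n \<nu> b ^ q * pairing n \<mu>' y (\<lambda>X. F (mmul n b X) * f X ^ q)"
          by (rule pairing_translate_f[OF yw twy trans b])
        also have "pairing n \<mu>' y (\<lambda>X. F (mmul n b X) * f X ^ q) = pairing n \<mu> x (\<lambda>X. F (mmul n b X))"
          using pairing_restrict_weight[OF yw trans] unfolding restrict by (rule sym)
        also have "pairing n \<mu> x (\<lambda>X. F (mmul n b X)) = pairing n \<mu> (act n (diagram \<mu>) b x) F"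
          by (rule pairing_translate[OF inf \<mu> xw act_upper_in_weyl[OF inf \<mu> xw b] F(1)])
        also have "pairing n \<mu> (act n (diagram \<mu>) b x) F = wt n lam b * y w"
          using x b by (simp add: primitives_def pairing_scale xF)
        finally show ?thesis unfolding tensor_scale_def wt_shift by (simp only: mult_ac)
      next
        case False
        then obtain i where i: "i \<le> n" "(\<Sum>a<i. word_content (diagram \<mu>') w a) < (\<Sum>a<i. lam' (Suc a))"
          using not_le_imp_less by blast
        have notU: "u \<notin> U" if "(\<Sum>a<i. word_content (diagram \<mu>') u a) < (\<Sum>a<i. lam' (Suc a))" for u
        proof
          assume "u \<in> U"
          then have "(\<Sum>a<i. word_content (diagram \<mu>') u a) = (\<Sum>a<i. lam' (Suc a))"
            using i(1) by (intro sum.cong) (auto simp: U_def)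
          then show False using that by simp
        qed
        have "(\<Prod>c\<in>diagram \<mu>'. b (w c, u c)) * y u = 0" if u: "u \<in> ?W'" for u
        proof (cases "\<exists>c\<in>diagram \<mu>'. u c < w c")
          case True
          then obtain c where c: "c \<in> diagram \<mu>'" "u c < w c" by blast
          then have "b (w c, u c) = 0" using b words_less[OF w c(1)] by (simp add: upper_def)
          then have "(\<Prod>c\<in>diagram \<mu>'. b (w c, u c)) = 0"
            using c(1) finite_diagram[OF seqs(3)] by (intro prod_zero) auto
          then show ?thesis by simp
        next
          case False
          have "{c \<in> diagram \<mu>'. u c < i} \<subseteq> {c \<in> diagram \<mu>'. w c < i}"
          proof
            fix c assume c: "c \<in> {c \<in> diagram \<mu>'. u c < i}"
            then have "w c \<le> u c" using False not_less by blast
            then show "c \<in> {c \<in> diagram \<mu>'. w c < i}" using c by simp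
          qed
          then have "(\<Sum>a<i. word_content (diagram \<mu>') u a) \<le> (\<Sum>a<i. word_content (diagram \<mu>') w a)"
            unfolding sum_word_content[OF finite_diagram[OF seqs(3)]]
            using finite_diagram[OF seqs(3)] by (intro card_mono) auto
          then have "u \<notin> U" using i(2) by (intro notU) simp
          then show ?thesis by (simp add: y_def)
        qed
        then have "(\<Sum>u\<in>?W'. (\<Prod>c\<in>diagram \<mu>'. b (w c, u c)) * y u) = 0" by (rule sum.neutral[OF ballI])
        then have "act n (diagram \<mu>') b y w = 0" using w by (simp add: act_def)
        moreover have "y w = 0" using notU[OF i(2)] by (simp add: y_def)
        ultimately show ?thesis by (simp add: tensor_scale_def)
      qed
    qed
  qed
  then have "y \<in> primitives n \<mu>' lam'" using yw unfolding primitives_def by blast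
  then show ?thesis using restrict by blast
qed

lemma dim_primitives_shift:
  "tensor_space.dim (primitives n \<mu>' lam' :: 'k tensor set) = tensor_space.dim (primitives n \<mu> lam :: 'k tensor set)"
proof (rule dim_eq_if_linear_bij[where T = restrict_weight])
  let ?P = "primitives n \<mu>' lam' :: 'k tensor set"
  note sub = subspace_primitives[where ?'k = 'k, of n \<mu>' lam']
  have add: "restrict_weight (x + y) = restrict_weight x + restrict_weight y" for x y
    by (simp add: restrict_weight_def fun_eq_iff pairing_add)
  have scale: "restrict_weight (tensor_scale c x) = tensor_scale c (restrict_weight x)" for c x
    by (simp add: restrict_weight_def fun_eq_iff pairing_scale) (simp add: tensor_scale_def)
  show "tensor_space.subspace ?P" by (rule sub)
  show "bij_betw restrict_weight ?P (primitives n \<mu> lam)"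
  proof (rule bij_betwI')
    fix x y assume xy: "x \<in> ?P" "y \<in> ?P"
    show "(restrict_weight x = restrict_weight y) = (x = y)"
    proof
      assume eq: "restrict_weight x = restrict_weight y"
      have mem: "x + tensor_scale (-1) y \<in> ?P"
        by (intro tensor_space.subspace_add[OF sub] tensor_space.subspace_scale[OF sub] xy)
      have "restrict_weight (x + tensor_scale (-1) y) = 0"
        unfolding add scale eq by (simp add: tensor_scale_def fun_eq_iff)
      then have "x + tensor_scale (-1) y = 0" by (rule restrict_weight_inj[OF mem])
      then show "x = y" by (simp add: tensor_scale_def fun_eq_iff)
    qed simp
  next
    show "restrict_weight x \<in> primitives n \<mu> lam" if "x \<in> ?P" for x
      by (rule restrict_weight_primitive[OF that])
    show "\<exists>y\<in>?P. x = restrict_weight y" if "x \<in> primitives n \<mu> lam" for x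
      using restrict_weight_surj[OF that] by blast
  qed
  show "restrict_weight (x + y) = restrict_weight x + restrict_weight y" for x y by (rule add)
  show "restrict_weight (tensor_scale c x) = tensor_scale c (restrict_weight x)" for c x by (rule scale)
qed (rule tensor_space.vector_space_axioms)+

end

section \<open>Periodicity\<close>

lemma partition_support:
  assumes \<mu>: "\<mu> \<in> partitions n"
  shows "{i. \<mu> i \<noteq> 0} = {1..len \<mu>}"
proof -
  let ?S = "{i. \<mu> i \<noteq> 0}"
  have sub: "?S \<subseteq> {1..n}" using partitions_sequences[OF \<mu>] by (auto simp: sequences_def)
  then have fin: "finite ?S" using finite_subset by blast
  have "?S = {1..card ?S}"
  proof (cases "?S = {}")
    case False
    have "?S = {1..Max ?S}"
    proof (rule equalityI)
      show "?S \<subseteq> {1..Max ?S}" using sub fin by auto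
      show "{1..Max ?S} \<subseteq> ?S"
      proof
        fix i assume i: "i \<in> {1..Max ?S}"
        have "\<mu> (Max ?S) \<noteq> 0" using Max_in[OF fin False] by simp
        moreover have "\<mu> (Max ?S) \<le> \<mu> i" using i by (intro partitions_antimono[OF \<mu>]) auto
        ultimately show "i \<in> ?S" by simp
      qed
    qed
    then show ?thesis by (metis card_atLeastAtMost diff_Suc_1)
  next
    case True
    then show ?thesis by simp
  qed
  then show ?thesis by (simp only: len_def)
qed

lemma partition_zero_iff:
  assumes "\<mu> \<in> partitions n" and "1 \<le> i"
  shows "\<mu> i = 0 \<longleftrightarrow> len \<mu> < i"
proof -
  have "i \<in> {i. \<mu> i \<noteq> 0} \<longleftrightarrow> i \<in> {1..len \<mu>}" by (simp only: partition_support[OF assms(1)])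
  then show ?thesis using assms(2) by auto
qed

theorem corollary4p6:
  fixes n r p g m :: nat
    and lam \<mu> \<nu> :: "nat \<Rightarrow> nat"
    and d :: "nat \<Rightarrow> nat"
  assumes "infinite (UNIV :: 'k::field set)"
    and "CHAR('k) = p" and "p > 0"
    and "r > 0"
    and "lam \<in> partitions_of n r" and "\<mu> \<in> partitions_of n r" and "\<nu> \<in> partitions n"
    and "g = len \<nu>" and "g \<ge> 1" and "m = len \<mu>"
    and "lam \<in> P_set n r \<mu>"
    and "\<mu> \<in> partitions_g n g"
    and "g < m"
    and "\<nu> \<in> partitions_g n g"
    and "\<And>k. d k = dim_weyl_hom TYPE('k) n (lam + seq_scale k \<nu>) (\<mu> + seq_scale k \<nu>)"
  shows "\<exists>N. \<forall>k. d (k + p ^ N) = d k"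
proof (intro exI allI)
  fix k
  note inf = assms(1)
  have lam: "lam \<in> partitions n" and \<mu>: "\<mu> \<in> partitions n" and \<nu>: "\<nu> \<in> partitions n"
    and sum_\<mu>: "(\<Sum>i = 1..n. \<mu> i) = r"
    using assms(5-7) by (auto simp: partitions_of_def weights_def)
  have prime: "prime CHAR('k)" using assms(2,3) by (intro prime_CHAR_semidom) simp
  \<comment> \<open>The exponent \<open>r\<close> suffices: partial sums of \<open>\<mu>\<close> and \<open>lam\<close> differ by at most \<open>r\<close>.\<close>
  have "2 ^ r \<le> p ^ r" using prime_ge_2_nat[OF prime] assms(2) by (intro power_mono) simp_all
  then have "r < p ^ r" by (rule less_le_trans[OF less_exp])
  define \<mu>k lamk where "\<mu>k = \<mu> + seq_scale k \<nu>" and "lamk = lam + seq_scale k \<nu>"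
  have \<mu>k: "\<mu>k \<in> partitions n" and lamk: "lamk \<in> partitions n"
    unfolding \<mu>k_def lamk_def by (intro partitions_shift \<mu> \<nu> lam)+
  have \<nu>0: "\<nu> i = 0" if "m \<le> i" for i
    using partition_zero_iff[OF \<nu>, of i] assms(8,9,13) that by simp
  interpret weight_shift n m "p ^ r" r \<mu>k \<nu> lamk "TYPE('k)"
  proof
    show "infinite (UNIV :: 'k set)" by (rule inf)
    show "prime CHAR('k)" by (rule prime)
    show "p ^ r = CHAR('k) ^ r" using assms(2) by simp
    show "\<mu>k \<in> partitions n" by (rule \<mu>k)
    show "\<nu> \<in> partitions n" by (rule \<nu>)
    show "\<nu> i = 0" if "m \<le> i" for i by (rule \<nu>0[OF that])
    show "\<mu>k i = 0" if "m < i" for i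
      using partition_zero_iff[OF \<mu>, of i] \<nu>0[of i] assms(10) that by (simp add: \<mu>k_def seq_scale_def)
    show "(\<Sum>i\<le>b. \<mu>k (Suc i)) + \<mu>k (Suc (Suc b)) \<le> (\<Sum>i\<le>b. lamk (Suc i)) + \<mu>k (Suc b)"
      if b: "Suc b < m" for b
    proof -
      have "Suc (Suc b) \<in> {2..len \<mu>}" and "len \<mu> \<noteq> 1" using b assms(10) by auto
      then have "(\<Sum>j = 1..Suc (Suc b) - 2. \<mu> j) + \<mu> (Suc (Suc b)) \<le> (\<Sum>j = 1..Suc (Suc b) - 1. lam j)"
        using assms(11) unfolding P_set_def by (simp only: if_False mem_Collect_eq)
      then have "(\<Sum>i<b. \<mu> (Suc i)) + \<mu> (Suc (Suc b)) \<le> (\<Sum>i\<le>b. lam (Suc i))"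
        by (simp add: sum.atLeast1_atMost_eq lessThan_Suc_atMost[symmetric])
      then have "(\<Sum>i\<le>b. \<mu> (Suc i)) + \<mu> (Suc (Suc b)) \<le> (\<Sum>i\<le>b. lam (Suc i)) + \<mu> (Suc b)"
        by (simp add: lessThan_Suc_atMost[symmetric])
      moreover have "k * \<nu> (Suc (Suc b)) \<le> k * \<nu> (Suc b)"
        by (intro mult_left_mono partitions_antimono[OF \<nu>]) simp_all
      ultimately show ?thesis
        unfolding \<mu>k_def lamk_def seq_scale_def plus_fun_apply sum.distrib by linarith
    qed
    show "(\<Sum>a<i. \<mu>k (Suc a)) < (\<Sum>a<i. lamk (Suc a)) + p ^ r" if "i \<le> n" for i
    proof -
      have "(\<Sum>a<i. \<mu> (Suc a)) \<le> (\<Sum>a<n. \<mu> (Suc a))" using that by (intro sum_mono2) auto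
      also have "\<dots> = r" using sum_\<mu> by (simp add: sum.atLeast1_atMost_eq)
      also have "\<dots> < p ^ r" by fact
      finally show ?thesis by (simp add: \<mu>k_def lamk_def seq_scale_def sum.distrib)
    qed
  qed
  have shift: "\<kappa> + seq_scale (k + p ^ r) \<nu> = (\<kappa> + seq_scale k \<nu>) + seq_scale (p ^ r) \<nu>" for \<kappa>
    by (simp add: fun_eq_iff seq_scale_def distrib_right)
  have dim: "dim_weyl_hom TYPE('k) n \<alpha> \<beta> = tensor_space.dim (primitives n \<beta> \<alpha> :: 'k tensor set)"
    if "\<alpha> \<in> partitions n" "\<beta> \<in> partitions n" for \<alpha> \<beta>
    by (rule dim_weyl_hom_eq_dim_primitives[OF inf that(1) partitions_sequences[OF that(2)]])
  show "d (k + p ^ r) = d k"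
    unfolding assms(15) shift \<mu>k_def[symmetric] lamk_def[symmetric]
    unfolding dim[OF partitions_shift[OF lamk \<nu>] partitions_shift[OF \<mu>k \<nu>]] dim[OF lamk \<mu>k]
    by (rule dim_primitives_shift)
qed

end
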